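(* Let $p$ be a prime and let $q$ be an odd prime that divides $p-1$. Then there exists a finite solvable group $G$ with $\mathrm{dl}(G)=4$, Fitting height $3$, and $$\mathrm{cd}(G)=\Big\{1,\ q,\ \Big(\tfrac{p^q-1}{p-1}\Big)_{q'}(p-1)_q\,q,\ p^q\Big(\tfrac{p^q-1}{p-1}\Big)_{q'}(p-1)_q\,q\Big\}.$$
   Context: $\mathrm{cd}(G)$ is the set of degrees of irreducible complex characters of $G$, and $\mathrm{dl}(G)$ is the derived length of $G$. For a positive integer $N$ and a prime $q$, $N_q$ denotes the largest power of $q$ dividing $N$, and $N_{q'}=N/N_q$. *)

theory Defs
  imports "HOL-Algebra.Solvable_Groups" "Jordan_Normal_Form.Matrix"
    "HOL-Computational_Algebra.Primes"
begin

definition is_rep :: "('a, 'b) monoid_scheme \<Rightarrow> nat \<Rightarrow> ('a \<Rightarrow> complex mat) \<Rightarrow> bool" where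
  "is_rep G n \<rho> \<longleftrightarrow>
     (\<forall>g \<in> carrier G. \<rho> g \<in> carrier_mat n n) \<and>
     (\<forall>g \<in> carrier G. \<forall>h \<in> carrier G. \<rho> (g \<otimes>\<^bsub>G\<^esub> h) = \<rho> g * \<rho> h) \<and>
     \<rho> \<one>\<^bsub>G\<^esub> = 1\<^sub>m n"

definition invariant_subspace ::
  "('a, 'b) monoid_scheme \<Rightarrow> nat \<Rightarrow> ('a \<Rightarrow> complex mat) \<Rightarrow> complex vec set \<Rightarrow> bool" where
  "invariant_subspace G n \<rho> W \<longleftrightarrow>
     W \<subseteq> carrier_vec n \<and> 0\<^sub>v n \<in> W \<and>
     (\<forall>v \<in> W. \<forall>w \<in> W. v + w \<in> W) \<and>
     (\<forall>c. \<forall>v \<in> W. c \<cdot>\<^sub>v v \<in> W) \<and>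
     (\<forall>g \<in> carrier G. \<forall>v \<in> W. \<rho> g *\<^sub>v v \<in> W)"

definition irreducible_rep :: "('a, 'b) monoid_scheme \<Rightarrow> nat \<Rightarrow> ('a \<Rightarrow> complex mat) \<Rightarrow> bool" where
  "irreducible_rep G n \<rho> \<longleftrightarrow> is_rep G n \<rho> \<and> n > 0 \<and>
     (\<forall>W. invariant_subspace G n \<rho> W \<longrightarrow> W = {0\<^sub>v n} \<or> W = carrier_vec n)"

definition char_degrees :: "('a, 'b) monoid_scheme \<Rightarrow> nat set" where
  "char_degrees G = {n. \<exists>\<rho>. irreducible_rep G n \<rho>}"

definition derived_length :: "('a, 'b) monoid_scheme \<Rightarrow> nat" where
  "derived_length G = (LEAST n. ((derived G) ^^ n) (carrier G) = {\<one>\<^bsub>G\<^esub>})"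

definition commutator_subgroup :: "('a, 'b) monoid_scheme \<Rightarrow> 'a set \<Rightarrow> 'a set \<Rightarrow> 'a set" where
  "commutator_subgroup G A B = generate G
     {a \<otimes>\<^bsub>G\<^esub> b \<otimes>\<^bsub>G\<^esub> inv\<^bsub>G\<^esub> a \<otimes>\<^bsub>G\<^esub> inv\<^bsub>G\<^esub> b | a b. a \<in> A \<and> b \<in> B}"

fun lower_central :: "('a, 'b) monoid_scheme \<Rightarrow> 'a set \<Rightarrow> nat \<Rightarrow> 'a set" where
  "lower_central G N 0 = N"
| "lower_central G N (Suc k) = commutator_subgroup G (lower_central G N k) N"

text \<open>For normal subgroups M \<subseteq> N of G, the quotient N/M is nilpotent iff some term of
  the lower central series of N lies in M (gamma_k(N/M) = gamma_k(N)M/M).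
  With M = 1 this is nilpotency of N.\<close>
definition nilpotent_mod :: "('a, 'b) monoid_scheme \<Rightarrow> 'a set \<Rightarrow> 'a set \<Rightarrow> bool" where
  "nilpotent_mod G N M \<longleftrightarrow> (\<exists>k. lower_central G N k \<subseteq> M)"

text \<open>Given a normal subgroup M, the preimage of the Fitting subgroup F(G/M): the
  subgroup generated by all normal subgroups N \<supseteq> M of G with N/M nilpotent.\<close>
definition fitting_step :: "('a, 'b) monoid_scheme \<Rightarrow> 'a set \<Rightarrow> 'a set" where
  "fitting_step G M = generate G (\<Union>{N. N \<lhd> G \<and> M \<subseteq> N \<and> nilpotent_mod G N M})"

fun fitting_series :: "('a, 'b) monoid_scheme \<Rightarrow> nat \<Rightarrow> 'a set" where
  "fitting_series G 0 = {\<one>\<^bsub>G\<^esub>}"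
| "fitting_series G (Suc i) = fitting_step G (fitting_series G i)"

definition fitting_height :: "('a, 'b) monoid_scheme \<Rightarrow> nat" where
  "fitting_height G = (LEAST h. fitting_series G h = carrier G)"

definition ppart :: "nat \<Rightarrow> nat \<Rightarrow> nat" where
  "ppart q N = q ^ multiplicity q N"

definition pprime_part :: "nat \<Rightarrow> nat \<Rightarrow> nat" where
  "pprime_part q N = N div ppart q N"

end

theory Submission
  imports Defs "HOL-Algebra.Multiplicative_Group" "HOL-Computational_Algebra.Polynomial"
    "HOL-Number_Theory.Residue_Primitive_Roots" "HOL-Library.Nat_Bijection"
begin

text \<open>Let \<open>F\<close> be the field with \<open>p\<^sup>q\<close> elements, \<open>(p\<^sup>q - 1) / (p - 1) = q m\<close> (so \<open>q\<close> does not divide \<open>m\<close>), let \<open>s\<close> be the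
  \<open>q\<close>-part of \<open>p - 1\<close>, and let \<open>d\<close> be an element of \<open>F\<close> of order \<open>n = m s q\<close>. The maps
  \<open>y \<mapsto> d\<^sup>i y^(p\<^sup>i)\<close> for \<open>i\<close> modulo \<open>n\<close> form a group of order \<open>n\<close> that acts freely on \<open>F - {0}\<close>: this is
  immediate for \<open>q\<close> dividing \<open>i\<close>, and otherwise raising \<open>d\<^sup>i y^(p\<^sup>i) = y\<close> to the power \<open>q m\<close>
  would give \<open>s dvd i\<close>. It also acts on the Heisenberg group \<open>P\<close> of \<open>F\<close>, and the semidirect product \<open>G\<close>
  is a Frobenius group with kernel \<open>P\<close>. The complement has an abelian normal subgroup of index
  \<open>q\<close> and is not nilpotent; so its character degrees are \<open>1\<close> and \<open>q\<close>, and \<open>G\<close> has derived length \<open>4\<close> and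
  Fitting height \<open>3\<close>. The nontrivial characters of \<open>P\<close> have degree \<open>1\<close> or \<open>p\<^sup>q\<close> and trivial
  stabilizer in the complement, which accounts for the degrees \<open>n\<close> and \<open>p\<^sup>q n\<close>.

  For the degrees, an eigenvector of a normal subgroup \<open>N\<close> for a linear character whose stabilizer in
  \<open>G\<close> is \<open>N\<close> makes an irreducible representation isomorphic to the induced one, so of degree
  \<open>|G : N|\<close>. This is applied to successively larger \<open>N\<close> that act by commuting matrices.\<close>

hide_const (open) up_ring.monom up_ring.coeff Polynomial.order

section \<open>Representations, intertwiners and common eigenvectors\<close>

text \<open>The obstacle is freeness. The full group generated by multiplication by d and the
  Frobenius map contains the Frobenius map itself, which fixes 1. Tying the Frobenius exponent
  modulo q to the exponent of d leaves a subgroup of index q; it is closed because p = 1 modulo q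
  makes i + j p^i agree with i + j modulo q. The power q m works because (p^i - 1) q m is a multiple
  of p^q - 1, so y cancels. The centre of P scales by d^(2i), hence the need for n odd. The
  complement is not nilpotent because m is coprime to p^i - 1 when q does not divide i. Oddness of q
  makes the q-part of (p^q - 1) / (p - 1) exactly q. No inner products of characters occur: degrees
  come from explicit eigenvectors and matrices. The field is the quotient of Z[X] by a maximal ideal
  containing p and X^q - a, with a a primitive root modulo p; irreducibility of X^q - a modulo p is
  replaced by the linear independence of 1, ..., X^(q-1) modulo that ideal.\<close>

definition subspace_vec :: "nat \<Rightarrow> complex vec set \<Rightarrow> bool" where
  "subspace_vec n W \<longleftrightarrow> W \<subseteq> carrier_vec n \<and> 0\<^sub>v n \<in> W \<and>
     (\<forall>v \<in> W. \<forall>w \<in> W. v + w \<in> W) \<and> (\<forall>c. \<forall>v \<in> W. c \<cdot>\<^sub>v v \<in> W)"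

lemma invariant_subspace_iff:
  "invariant_subspace G n \<rho> W \<longleftrightarrow>
     subspace_vec n W \<and> (\<forall>g \<in> carrier G. \<forall>v \<in> W. \<rho> g *\<^sub>v v \<in> W)"
  unfolding invariant_subspace_def subspace_vec_def by auto

lemma subspace_vec_sum:
  fixes m :: nat
  assumes W: "subspace_vec n W" and x: "\<And>j. j < m \<Longrightarrow> x j \<in> W"
  shows "vec n (\<lambda>i. \<Sum>j<m. c j * x j $ i) \<in> W"
  using x
proof (induction m)
  case 0
  have "vec n (\<lambda>i. \<Sum>j<0. c j * x j $ i) = 0\<^sub>v n" by auto
  with W show ?case by (simp add: subspace_vec_def)
next
  case (Suc m)
  have xm: "x m \<in> W" "x m \<in> carrier_vec n" using Suc.prems W by (auto simp: subspace_vec_def)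
  have "vec n (\<lambda>i. \<Sum>j<Suc m. c j * x j $ i) = vec n (\<lambda>i. \<Sum>j<m. c j * x j $ i) + c m \<cdot>\<^sub>v x m"
    using xm by (intro eq_vecI) auto
  with Suc xm W show ?case by (simp add: subspace_vec_def)
qed

lemma mult_mat_vec_sum:
  fixes T :: "complex mat" and m :: nat
  assumes T: "T \<in> carrier_mat n n" and x: "\<And>j. j < m \<Longrightarrow> x j \<in> carrier_vec n"
  shows "T *\<^sub>v vec n (\<lambda>i. \<Sum>j<m. c j * x j $ i) = vec n (\<lambda>i. \<Sum>j<m. c j * (T *\<^sub>v x j) $ i)"
  using x
proof (induction m)
  case 0
  show ?case using T by (intro eq_vecI) (auto simp: scalar_prod_def)
next
  case (Suc m)
  have xm: "x m \<in> carrier_vec n" using Suc.prems by auto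
  have "T *\<^sub>v vec n (\<lambda>i. \<Sum>j<Suc m. c j * x j $ i) =
        T *\<^sub>v (vec n (\<lambda>i. \<Sum>j<m. c j * x j $ i) + c m \<cdot>\<^sub>v x m)"
    using xm by (intro arg_cong[where f = "\<lambda>v. T *\<^sub>v v"] eq_vecI) auto
  also have "\<dots> = vec n (\<lambda>i. \<Sum>j<m. c j * (T *\<^sub>v x j) $ i) + c m \<cdot>\<^sub>v (T *\<^sub>v x m)"
    using T xm Suc by (simp add: mult_add_distrib_mat_vec[OF T] mult_mat_vec[OF T])
  also have "\<dots> = vec n (\<lambda>i. \<Sum>j<Suc m. c j * (T *\<^sub>v x j) $ i)"
    using T xm by (intro eq_vecI) auto
  finally show ?case .
qed

lemma is_repD:
  assumes "is_rep G n \<rho>"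
  shows "g \<in> carrier G \<Longrightarrow> \<rho> g \<in> carrier_mat n n"
    and "g \<in> carrier G \<Longrightarrow> h \<in> carrier G \<Longrightarrow> \<rho> (g \<otimes>\<^bsub>G\<^esub> h) = \<rho> g * \<rho> h"
    and "\<rho> \<one>\<^bsub>G\<^esub> = 1\<^sub>m n"
    and "g \<in> carrier G \<Longrightarrow> v \<in> carrier_vec n \<Longrightarrow> \<rho> g *\<^sub>v v \<in> carrier_vec n"
  using assms unfolding is_rep_def by (auto intro: mult_mat_vec_carrier)

lemma is_rep_mult_vec:
  assumes "is_rep G n \<rho>" "g \<in> carrier G" "h \<in> carrier G" "v \<in> carrier_vec n"
  shows "\<rho> (g \<otimes>\<^bsub>G\<^esub> h) *\<^sub>v v = \<rho> g *\<^sub>v (\<rho> h *\<^sub>v v)"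
  using is_repD(2)[OF assms(1-3)] is_repD(1)[OF assms(1)] assms
  by (simp add: assoc_mult_mat_vec[where ?n\<^sub>1.0 = n and ?n\<^sub>2.0 = n and ?n\<^sub>3.0 = n])

lemma one_mult_vec: "v \<in> carrier_vec n \<Longrightarrow> is_rep G n \<rho> \<Longrightarrow> \<rho> \<one>\<^bsub>G\<^esub> *\<^sub>v v = v"
  by (simp add: is_rep_def)

text \<open>Compare the traces of \<open>M N\<close> and \<open>N M\<close>.\<close>
lemma invertible_mat_square:
  fixes M N :: "complex mat"
  assumes M: "M \<in> carrier_mat n k" and N: "N \<in> carrier_mat k n"
    and MN: "M * N = 1\<^sub>m n" and NM: "N * M = 1\<^sub>m k"
  shows "n = k"
proof -
  have 1: "(\<Sum>i<n. \<Sum>j<k. M $$ (i,j) * N $$ (j,i)) = of_nat n"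
  proof -
    have "(\<Sum>j<k. M $$ (i,j) * N $$ (j,i)) = 1" if "i < n" for i
    proof -
      have "(M * N) $$ (i,i) = (\<Sum>j<k. M $$ (i,j) * N $$ (j,i))"
        using M N that by (simp add: scalar_prod_def atLeast0LessThan)
      with MN that show ?thesis by simp
    qed
    then show ?thesis by simp
  qed
  have 2: "(\<Sum>j<k. \<Sum>i<n. N $$ (j,i) * M $$ (i,j)) = of_nat k"
  proof -
    have "(\<Sum>i<n. N $$ (j,i) * M $$ (i,j)) = 1" if "j < k" for j
    proof -
      have "(N * M) $$ (j,j) = (\<Sum>i<n. N $$ (j,i) * M $$ (i,j))"
        using M N that by (simp add: scalar_prod_def atLeast0LessThan)
      with NM that show ?thesis by simp
    qed
    then show ?thesis by simp
  qed
  have "(of_nat n :: complex) = of_nat k"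
    using 1 2 by (subst (asm) sum.swap) (simp add: mult.commute)
  then show ?thesis using of_nat_eq_iff by blast
qed

lemma mult_mat_vec_zero:
  fixes M :: "complex mat"
  shows "M \<in> carrier_mat n k \<Longrightarrow> M *\<^sub>v 0\<^sub>v k = 0\<^sub>v n"
  by (intro eq_vecI) auto

lemma smult_vec_right_cancel:
  fixes v :: "complex vec"
  assumes v: "v \<in> carrier_vec n" "v \<noteq> 0\<^sub>v n" and eq: "c \<cdot>\<^sub>v v = d \<cdot>\<^sub>v v"
  shows "c = d"
proof -
  obtain i where i: "i < n" "v $ i \<noteq> 0"
    using v by (metis carrier_vecD eq_vecI index_zero_vec(1) index_zero_vec(2))
  show ?thesis using arg_cong[OF eq, of "\<lambda>w. w $ i"] i v by simp
qed

lemma mult_unit_vec_col: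
  fixes M :: "complex mat"
  assumes "M \<in> carrier_mat n k" "j < k"
  shows "M *\<^sub>v unit_vec k j = col M j"
  using assms by (intro eq_vecI) (auto simp: scalar_prod_right_unit)

section \<open>Schur's lemma\<close>

text \<open>Schur's lemma: the kernel of M is a proper invariant subspace and its image a nonzero
  one, so irreducibility on both sides makes M bijective.\<close>

lemma intertwiner_degree_eq:
  assumes \<rho>: "irreducible_rep G n \<rho>" and \<tau>: "irreducible_rep G k \<tau>"
    and M: "M \<in> carrier_mat n k" "M \<noteq> 0\<^sub>m n k"
    and MG: "\<And>g. g \<in> carrier G \<Longrightarrow> \<rho> g * M = M * \<tau> g"
  shows "n = k"
proof -
  have r\<rho>: "is_rep G n \<rho>" and r\<tau>: "is_rep G k \<tau>" using \<rho> \<tau> by (auto simp: irreducible_rep_def)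
  have MGv: "\<rho> g *\<^sub>v (M *\<^sub>v x) = M *\<^sub>v (\<tau> g *\<^sub>v x)" if "g \<in> carrier G" "x \<in> carrier_vec k" for g x
  proof -
    have "\<rho> g *\<^sub>v (M *\<^sub>v x) = (\<rho> g * M) *\<^sub>v x"
      using is_repD(1)[OF r\<rho> that(1)] M that by (simp add: assoc_mult_mat_vec)
    also have "\<dots> = M *\<^sub>v (\<tau> g *\<^sub>v x)"
      using is_repD(1)[OF r\<tau> that(1)] M that MG by (simp add: assoc_mult_mat_vec)
    finally show ?thesis .
  qed
  obtain i j where ij: "i < n" "j < k" "M $$ (i,j) \<noteq> 0"
    using M by (metis carrier_matD eq_matI index_zero_mat(1-3))
  have nz: "M *\<^sub>v unit_vec k j \<noteq> 0\<^sub>v n"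
  proof
    assume "M *\<^sub>v unit_vec k j = 0\<^sub>v n"
    then have "col M j $ i = 0" using ij mult_unit_vec_col[OF M(1)] by simp
    with ij M show False by simp
  qed
  define Ker where "Ker = {x \<in> carrier_vec k. M *\<^sub>v x = 0\<^sub>v n}"
  have "invariant_subspace G k \<tau> Ker"
    unfolding invariant_subspace_def
  proof (intro conjI ballI allI)
    show "0\<^sub>v k \<in> Ker" using mult_mat_vec_zero[OF M(1)] by (simp add: Ker_def)
    show "v + w \<in> Ker" if "v \<in> Ker" "w \<in> Ker" for v w
      using that by (auto simp: Ker_def mult_add_distrib_mat_vec[OF M(1)])
    show "c \<cdot>\<^sub>v v \<in> Ker" if "v \<in> Ker" for c v
      using that by (auto simp: Ker_def mult_mat_vec[OF M(1)])
    show "\<tau> g *\<^sub>v v \<in> Ker" if "g \<in> carrier G" "v \<in> Ker" for g v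
      using that MGv[of g v, symmetric] is_repD(4)[OF r\<tau>] mult_mat_vec_zero[OF is_repD(1)[OF r\<rho>]]
      by (auto simp: Ker_def)
  qed (auto simp: Ker_def)
  moreover have "Ker \<noteq> carrier_vec k"
  proof
    assume "Ker = carrier_vec k"
    then have "unit_vec k j \<in> Ker" by simp
    with nz show False by (simp add: Ker_def)
  qed
  ultimately have Ker: "Ker = {0\<^sub>v k}" using \<tau> by (auto simp: irreducible_rep_def)
  define Im where "Im = {M *\<^sub>v x | x. x \<in> carrier_vec k}"
  have "invariant_subspace G n \<rho> Im"
    unfolding invariant_subspace_def
  proof (intro conjI ballI allI)
    show "Im \<subseteq> carrier_vec n" using M by (auto simp: Im_def)
    show "0\<^sub>v n \<in> Im"
      using mult_mat_vec_zero[OF M(1)] unfolding Im_def by (metis (mono_tags) mem_Collect_eq zero_carrier_vec)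
    show "v + w \<in> Im" if vw: "v \<in> Im" "w \<in> Im" for v w
    proof -
      obtain x y where "x \<in> carrier_vec k" "y \<in> carrier_vec k" "v = M *\<^sub>v x" "w = M *\<^sub>v y"
        using vw by (auto simp: Im_def)
      then have "x + y \<in> carrier_vec k" "v + w = M *\<^sub>v (x + y)"
        by (auto simp: mult_add_distrib_mat_vec[OF M(1)])
      then show ?thesis unfolding Im_def by blast
    qed
    show "c \<cdot>\<^sub>v v \<in> Im" if vI: "v \<in> Im" for c v
    proof -
      obtain x where "x \<in> carrier_vec k" "v = M *\<^sub>v x" using vI by (auto simp: Im_def)
      then have "c \<cdot>\<^sub>v x \<in> carrier_vec k" "c \<cdot>\<^sub>v v = M *\<^sub>v (c \<cdot>\<^sub>v x)"
        by (auto simp: mult_mat_vec[OF M(1)])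
      then show ?thesis unfolding Im_def by blast
    qed
    show "\<rho> g *\<^sub>v v \<in> Im" if "g \<in> carrier G" "v \<in> Im" for g v
      using that MGv is_repD(4)[OF r\<tau>] unfolding Im_def by auto
  qed
  moreover have "Im \<noteq> {0\<^sub>v n}"
  proof
    assume "Im = {0\<^sub>v n}"
    moreover have "M *\<^sub>v unit_vec k j \<in> Im" by (auto simp: Im_def)
    ultimately show False using nz by simp
  qed
  ultimately have Im: "Im = carrier_vec n" using \<rho> by (auto simp: irreducible_rep_def)
  have "\<forall>l. \<exists>y. l < n \<longrightarrow> y \<in> carrier_vec k \<and> M *\<^sub>v y = unit_vec n l"
  proof
    fix l
    have "unit_vec n l \<in> Im" using Im by simp
    then show "\<exists>y. l < n \<longrightarrow> y \<in> carrier_vec k \<and> M *\<^sub>v y = unit_vec n l"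
      unfolding Im_def by force
  qed
  then obtain y where y: "\<And>l. l < n \<Longrightarrow> y l \<in> carrier_vec k \<and> M *\<^sub>v y l = unit_vec n l" by metis
  \<comment> \<open>The columns of N are preimages of the unit vectors, which makes N a right
    inverse; injectivity of M makes it a left inverse too.\<close>
  define N where "N = mat k n (\<lambda>(i,l). y l $ i)"
  have N: "N \<in> carrier_mat k n" by (simp add: N_def)
  have MN: "M * N = 1\<^sub>m n"
  proof (rule eq_matI)
    fix a b assume "a < dim_row (1\<^sub>m n :: complex mat)" "b < dim_col (1\<^sub>m n :: complex mat)"
    then have ab: "a < n" "b < n" by auto
    have "col N b = y b" using y[OF ab(2)] ab by (auto simp: N_def)
    then have "(M * N) $$ (a,b) = (M *\<^sub>v y b) $ a" using M N ab by simp
    then show "(M * N) $$ (a,b) = 1\<^sub>m n $$ (a,b)" using y[OF ab(2)] ab by simp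
  qed (use M N in auto)
  have NM: "N * M = 1\<^sub>m k"
  proof (rule eq_matI)
    fix a b assume "a < dim_row (1\<^sub>m k :: complex mat)" "b < dim_col (1\<^sub>m k :: complex mat)"
    then have ab: "a < k" "b < k" by auto
    let ?e = "unit_vec k b :: complex vec"
    have c: "M *\<^sub>v ?e \<in> carrier_vec n" "N *\<^sub>v (M *\<^sub>v ?e) \<in> carrier_vec k" using M N by auto
    have "M *\<^sub>v (N *\<^sub>v (M *\<^sub>v ?e)) = (M * N) *\<^sub>v (M *\<^sub>v ?e)"
      using M N by (simp add: assoc_mult_mat_vec)
    also have "\<dots> = M *\<^sub>v ?e" using c by (simp add: MN)
    finally have "M *\<^sub>v (N *\<^sub>v (M *\<^sub>v ?e) - ?e) = 0\<^sub>v n"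
      using c M by (simp add: mult_minus_distrib_mat_vec[OF M(1)])
    then have "N *\<^sub>v (M *\<^sub>v ?e) - ?e \<in> Ker" using c by (auto simp: Ker_def)
    then have "N *\<^sub>v (M *\<^sub>v ?e) - ?e = 0\<^sub>v k" using Ker by auto
    then have "(N *\<^sub>v (M *\<^sub>v ?e) - ?e) $ a = 0" using ab by simp
    then have "(N *\<^sub>v (M *\<^sub>v ?e)) $ a = ?e $ a" using ab c by simp
    moreover have "(N *\<^sub>v (M *\<^sub>v ?e)) $ a = (N * M) $$ (a,b)"
      using M N ab by (simp add: mult_unit_vec_col)
    ultimately show "(N * M) $$ (a,b) = 1\<^sub>m k $$ (a,b)" using ab by simp
  qed (use M N in auto)
  show ?thesis using invertible_mat_square[OF M(1) N MN NM] .
qed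

section \<open>Common eigenvectors of commuting matrices\<close>

text \<open>With m the group order, the m-th power of \<open>\<rho> g\<close> is the identity, so v
  is the average over the m-th roots of unity c of its components, the sums of c^j
  \<open>\<rho>\<close> (g^j) v over j < m. A nonzero component is an eigenvector for 1/c, and if v
  is moved then one with c different from 1 is nonzero.\<close>

lemma eigenvector_average:
  assumes G: "group G" "finite (carrier G)" and r: "is_rep G n \<rho>" and g: "g \<in> carrier G"
    and W: "subspace_vec n W" "\<And>w. w \<in> W \<Longrightarrow> \<rho> g *\<^sub>v w \<in> W"
    and v: "v \<in> W" "v \<noteq> 0\<^sub>v n"
  shows "\<exists>u\<in>W. \<exists>c. u \<noteq> 0\<^sub>v n \<and> \<rho> g *\<^sub>v u = c \<cdot>\<^sub>v u \<and> (\<rho> g *\<^sub>v v \<noteq> v \<longrightarrow> c \<noteq> 1)"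
proof -
  interpret group G by fact
  define m where "m = order G"
  have m: "m > 0" using G(2) by (simp add: m_def order_gt_0_iff_finite)
  have vc: "v \<in> carrier_vec n" using W v by (auto simp: subspace_vec_def)
  define x where "x j = \<rho> (g [^]\<^bsub>G\<^esub> j) *\<^sub>v v" for j :: nat
  have xS: "\<rho> g *\<^sub>v x j = x (Suc j)" for j
    unfolding x_def using is_rep_mult_vec[OF r g, of "g [^]\<^bsub>G\<^esub> j"] g vc
    by (metis nat_pow_Suc2 nat_pow_closed)
  have x0: "x 0 = v" using r vc by (simp add: x_def one_mult_vec)
  have xm: "x m = v" using r vc g by (simp add: x_def m_def pow_order_eq_1[OF g] one_mult_vec)
  have xW: "x j \<in> W" for j by (induction j) (use x0 v W(2) in \<open>auto simp flip: xS\<close>)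
  have xc: "x j \<in> carrier_vec n" for j using xW W by (auto simp: subspace_vec_def)
  define u where "u c = vec n (\<lambda>i. \<Sum>j<m. c ^ j * x j $ i)" for c
  have uW: "u c \<in> W" for c unfolding u_def by (rule subspace_vec_sum[OF W(1) xW])
  have uc: "u c \<in> carrier_vec n" for c by (simp add: u_def)
  have shift: "c \<cdot>\<^sub>v (\<rho> g *\<^sub>v u c) = u c" if "c ^ m = 1" for c
  proof (rule eq_vecI)
    fix i assume "i < dim_vec (u c)"
    then have i: "i < n" by (simp add: u_def)
    have "(c \<cdot>\<^sub>v (\<rho> g *\<^sub>v u c)) $ i = c * (\<Sum>j<m. c ^ j * x (Suc j) $ i)"
      unfolding u_def using i is_repD(1)[OF r g]
      by (simp add: mult_mat_vec_sum[OF is_repD(1)[OF r g] xc] xS)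
    also have "\<dots> = (\<Sum>j<m. c ^ Suc j * x (Suc j) $ i)" by (simp add: sum_distrib_left mult.assoc)
    also have "\<dots> = (\<Sum>j<Suc m. c ^ j * x j $ i) - v $ i"
      by (subst sum.lessThan_Suc_shift) (simp add: x0)
    also have "\<dots> = u c $ i" using that i xm by (simp add: u_def)
    finally show "(c \<cdot>\<^sub>v (\<rho> g *\<^sub>v u c)) $ i = u c $ i" .
  qed (use is_repD(1)[OF r g] in \<open>auto simp: u_def\<close>)
  have eig: "\<rho> g *\<^sub>v u c = inverse c \<cdot>\<^sub>v u c" if "c ^ m = 1" for c
  proof -
    have "c \<noteq> 0" using that m by (auto simp: power_0_left)
    then have "\<rho> g *\<^sub>v u c = inverse c \<cdot>\<^sub>v (c \<cdot>\<^sub>v (\<rho> g *\<^sub>v u c))" by (simp add: smult_smult_assoc)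
    then show ?thesis using shift[OF that] by simp
  qed
  define z where "z = cis (2 * pi / real m)"
  have zm: "z ^ m = 1" using m by (simp add: z_def DeMoivre)
  have zl: "(z ^ l) ^ m = 1" for l by (metis mult.commute power_mult power_one zm)
  have zj: "z ^ j \<noteq> 1" if "0 < j" "j < m" for j
  proof
    assume "z ^ j = 1"
    then have "cos (real j * (2 * pi / real m)) = 1"
      by (simp add: z_def DeMoivre complex_eq_iff)
    then obtain k :: int where k: "real j * (2 * pi / real m) = of_int k * 2 * pi"
      using cos_one_2pi_int by auto
    then have "real j = of_int k * real m" using m by (simp add: field_simps)
    then have "int j = k * int m" by (metis of_int_eq_iff of_int_mult of_int_of_nat_eq)
    then have "m dvd j" by (metis dvd_triv_right int_dvd_int_iff)
    with that show False by (auto dest: dvd_imp_le)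
  qed
  have tot: "(\<Sum>l<m. u (z ^ l) $ i) = of_nat m * v $ i" if i: "i < n" for i
  proof -
    have "(\<Sum>l<m. u (z ^ l) $ i) = (\<Sum>j<m. (\<Sum>l<m. (z ^ j) ^ l) * x j $ i)"
    proof -
      have "(z ^ l) ^ j = (z ^ j) ^ l" for l j by (metis power_mult mult.commute)
      then have "(\<Sum>l<m. u (z ^ l) $ i) = (\<Sum>l<m. \<Sum>j<m. (z ^ j) ^ l * x j $ i)"
        using i by (simp add: u_def)
      also have "\<dots> = (\<Sum>j<m. \<Sum>l<m. (z ^ j) ^ l * x j $ i)" by (rule sum.swap)
      finally show ?thesis by (simp add: sum_distrib_right)
    qed
    also have "\<dots> = (\<Sum>j<m. if j = 0 then of_nat m * v $ i else 0)"
    proof (intro sum.cong refl)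
      fix j assume j: "j \<in> {..<m}"
      have "(\<Sum>l<m. (z ^ j) ^ l) = 0" if "j \<noteq> 0"
      proof -
        have "z ^ j \<noteq> 1" using zj j that by auto
        then show ?thesis using geometric_sum[of "z ^ j" m] zl[of j] by simp
      qed
      then show "(\<Sum>l<m. (z ^ j) ^ l) * x j $ i = (if j = 0 then of_nat m * v $ i else 0)"
        by (auto simp: x0)
    qed
    also have "\<dots> = of_nat m * v $ i" using m by simp
    finally show ?thesis .
  qed
  show ?thesis
  proof (cases "\<exists>l<m. l \<noteq> 0 \<and> u (z ^ l) \<noteq> 0\<^sub>v n")
    case True
    then obtain l where l: "l < m" "l \<noteq> 0" "u (z ^ l) \<noteq> 0\<^sub>v n" by auto
    have "inverse (z ^ l) \<noteq> 1" using zj l by (simp add: inverse_eq_1_iff)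
    then show ?thesis using l eig[OF zl[of l]] uW by blast
  next
    case False
    \<comment> \<open>All other components vanish, so v is a multiple of the fixed vector
      \<open>u 1\<close> and serves as the eigenvector itself.\<close>
    have u1: "u 1 = of_nat m \<cdot>\<^sub>v v"
    proof (rule eq_vecI)
      fix i assume "i < dim_vec (of_nat m \<cdot>\<^sub>v v)"
      then have i: "i < n" using vc by simp
      have "(\<Sum>l<m. u (z ^ l) $ i) = (\<Sum>l<m. if l = 0 then u 1 $ i else 0)"
        using False i by (intro sum.cong) auto
      then show "u 1 $ i = (of_nat m \<cdot>\<^sub>v v) $ i" using tot[OF i] m i vc by simp
    qed (use vc in \<open>simp add: u_def\<close>)
    have fixu: "\<rho> g *\<^sub>v u 1 = u 1" using eig[of 1] by (simp add: u_def)
    have vu: "v = inverse (of_nat m) \<cdot>\<^sub>v u 1" using u1 m by (simp add: smult_smult_assoc)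
    have "\<rho> g *\<^sub>v v = inverse (of_nat m) \<cdot>\<^sub>v (\<rho> g *\<^sub>v u 1)"
      by (subst vu) (simp add: mult_mat_vec[OF is_repD(1)[OF r g] uc])
    then have "\<rho> g *\<^sub>v v = v" using fixu vu by simp
    then show ?thesis using v by (intro bexI[of _ v] exI[of _ 1]) auto
  qed
qed

lemma common_eigenvector:
  assumes G: "group G" "finite (carrier G)" and r: "is_rep G n \<rho>"
    and B: "B \<subseteq> carrier G" "\<And>a b. a \<in> B \<Longrightarrow> b \<in> B \<Longrightarrow> \<rho> a * \<rho> b = \<rho> b * \<rho> a"
    and W: "subspace_vec n W" "\<And>b w. b \<in> B \<Longrightarrow> w \<in> W \<Longrightarrow> \<rho> b *\<^sub>v w \<in> W"
    and v: "v \<in> W" "v \<noteq> 0\<^sub>v n"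
  obtains u \<psi> where "u \<in> W" "u \<noteq> 0\<^sub>v n" "\<And>b. b \<in> B \<Longrightarrow> \<rho> b *\<^sub>v u = \<psi> b \<cdot>\<^sub>v u"
proof -
  have "\<exists>u\<in>W. u \<noteq> 0\<^sub>v n \<and> (\<exists>\<psi>. \<forall>b\<in>F. \<rho> b *\<^sub>v u = \<psi> b \<cdot>\<^sub>v u)" if "finite F" "F \<subseteq> B" for F
    using that
  proof (induction F rule: finite_induct)
    case empty
    then show ?case using v by auto
  next
    case (insert b F)
    then obtain u \<psi> where u: "u \<in> W" "u \<noteq> 0\<^sub>v n" "\<And>a. a \<in> F \<Longrightarrow> \<rho> a *\<^sub>v u = \<psi> a \<cdot>\<^sub>v u" by auto
    \<comment> \<open>The simultaneous eigenspace found so far is stable under b because the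
      matrices commute, so the next eigenvector can be sought inside it.\<close>
    define W' where "W' = {w \<in> W. \<forall>a\<in>F. \<rho> a *\<^sub>v w = \<psi> a \<cdot>\<^sub>v w}"
    have Fc: "\<rho> a \<in> carrier_mat n n" if "a \<in> F" for a
      using insert.prems B(1) that is_repD(1)[OF r] by blast
    have bc: "\<rho> b \<in> carrier_mat n n" and bG: "b \<in> carrier G"
      using insert.prems B(1) is_repD(1)[OF r] by blast+
    have Wc: "w \<in> carrier_vec n" if "w \<in> W" for w using W(1) that by (auto simp: subspace_vec_def)
    have "subspace_vec n W'"
      unfolding subspace_vec_def
    proof (intro conjI ballI allI)
      show "0\<^sub>v n \<in> W'" using W(1) mult_mat_vec_zero[OF Fc] by (auto simp: W'_def subspace_vec_def)
      show "x + y \<in> W'" if "x \<in> W'" "y \<in> W'" for x y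
        using that W(1) Wc
        by (auto simp: W'_def subspace_vec_def mult_add_distrib_mat_vec[OF Fc]
            smult_add_distrib_vec[where n = n])
      show "c \<cdot>\<^sub>v x \<in> W'" if "x \<in> W'" for c x
        using that W(1) Wc
        by (auto simp: W'_def subspace_vec_def mult_mat_vec[OF Fc] smult_smult_assoc mult.commute)
    qed (use Wc in \<open>auto simp: W'_def\<close>)
    moreover have "\<rho> b *\<^sub>v w \<in> W'" if "w \<in> W'" for w
    proof -
      have w: "w \<in> W" "w \<in> carrier_vec n" using that Wc by (auto simp: W'_def)
      have "\<rho> a *\<^sub>v (\<rho> b *\<^sub>v w) = \<psi> a \<cdot>\<^sub>v (\<rho> b *\<^sub>v w)" if a: "a \<in> F" for a
      proof -
        have "\<rho> a *\<^sub>v (\<rho> b *\<^sub>v w) = (\<rho> a * \<rho> b) *\<^sub>v w"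
          using Fc[OF a] bc w by (simp add: assoc_mult_mat_vec)
        also have "\<dots> = (\<rho> b * \<rho> a) *\<^sub>v w" using B(2) insert.prems a by auto
        also have "\<dots> = \<rho> b *\<^sub>v (\<rho> a *\<^sub>v w)" using Fc[OF a] bc w by (simp add: assoc_mult_mat_vec)
        also have "\<dots> = \<psi> a \<cdot>\<^sub>v (\<rho> b *\<^sub>v w)"
          using \<open>w \<in> W'\<close> a w by (simp add: W'_def mult_mat_vec[OF bc])
        finally show ?thesis .
      qed
      then show ?thesis using W(2) w insert.prems by (auto simp: W'_def)
    qed
    moreover have "u \<in> W'" using u by (auto simp: W'_def)
    ultimately obtain u' c where u': "u' \<in> W'" "u' \<noteq> 0\<^sub>v n" "\<rho> b *\<^sub>v u' = c \<cdot>\<^sub>v u'"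
      using eigenvector_average[OF G r bG] u(2) by blast
    show ?case
      using u' by (intro bexI[of _ u'] conjI exI[of _ "\<psi>(b := c)"]) (auto simp: W'_def)
  qed
  from this[of B] show ?thesis using that B(1) G(2) finite_subset by blast
qed

section \<open>Induced representations\<close>

definition linear_char :: "('a, 'b) monoid_scheme \<Rightarrow> 'a set \<Rightarrow> ('a \<Rightarrow> complex) \<Rightarrow> bool" where
  "linear_char G A \<psi> \<longleftrightarrow> \<psi> \<one>\<^bsub>G\<^esub> = 1 \<and> (\<forall>a\<in>A. \<forall>b\<in>A. \<psi> (a \<otimes>\<^bsub>G\<^esub> b) = \<psi> a * \<psi> b)"

text \<open>Representatives of the left cosets of A, numbered below k because they index the rows
  and columns of a matrix.\<close>

definition transversal :: "('a, 'b) monoid_scheme \<Rightarrow> 'a set \<Rightarrow> nat \<Rightarrow> (nat \<Rightarrow> 'a) \<Rightarrow> bool" where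
  "transversal G A k t \<longleftrightarrow> (\<forall>i<k. t i \<in> carrier G) \<and>
     (\<forall>g\<in>carrier G. \<exists>!i. i < k \<and> inv\<^bsub>G\<^esub> (t i) \<otimes>\<^bsub>G\<^esub> g \<in> A)"

text \<open>The monomial matrix of the induced representation in the basis given by the cosets
  \<open>t j\<close> A. For a transversal at most one entry in each column survives.\<close>

definition induced ::
  "('a, 'b) monoid_scheme \<Rightarrow> 'a set \<Rightarrow> ('a \<Rightarrow> complex) \<Rightarrow> nat \<Rightarrow> (nat \<Rightarrow> 'a) \<Rightarrow> 'a \<Rightarrow> complex mat" where
  "induced G A \<psi> k t g = mat k k (\<lambda>(i, j). if inv\<^bsub>G\<^esub> (t i) \<otimes>\<^bsub>G\<^esub> g \<otimes>\<^bsub>G\<^esub> t j \<in> A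
     then \<psi> (inv\<^bsub>G\<^esub> (t i) \<otimes>\<^bsub>G\<^esub> g \<otimes>\<^bsub>G\<^esub> t j) else 0)"

lemma (in group) m_inv_cancel:
  assumes "x \<in> carrier G" "y \<in> carrier G"
  shows "x \<otimes> (inv x \<otimes> y) = y" "inv x \<otimes> (x \<otimes> y) = y"
  using assms by (simp_all add: m_assoc[symmetric])

lemma transversal_exists:
  assumes G: "group G" "finite (carrier G)" and A: "subgroup A G"
    and k: "card (carrier G) = k * card A"
  obtains t where "transversal G A k t"
proof -
  interpret group G by fact
  interpret A: subgroup A G by fact
  have "card A > 0" using A.finite_imp_card_positive[OF G(2)] .
  then have ck: "card (rcosets\<^bsub>G\<^esub> A) = k"
    using lagrange[OF A] k by (simp add: Coset.order_def)
  have "finite (rcosets\<^bsub>G\<^esub> A)" using G(2) by (auto simp: RCOSETS_def)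
  then obtain f where f: "bij_betw f {..<k} (rcosets\<^bsub>G\<^esub> A)"
    using ck by (metis atLeast0LessThan ex_bij_betw_nat_finite)
  have "\<forall>i. \<exists>x. i < k \<longrightarrow> x \<in> carrier G \<and> f i = A #>\<^bsub>G\<^esub> x"
    using bij_betwE[OF f] by (auto simp: RCOSETS_def)
  then obtain x where x: "\<And>i. i < k \<Longrightarrow> x i \<in> carrier G \<and> f i = A #>\<^bsub>G\<^esub> x i" by metis
  \<comment> \<open>Right coset representatives x become left coset representatives after
    inversion.\<close>
  have "transversal G A k (\<lambda>i. inv\<^bsub>G\<^esub> x i)"
    unfolding transversal_def
  proof (intro conjI allI impI ballI)
    show "inv\<^bsub>G\<^esub> x i \<in> carrier G" if "i < k" for i using x that by auto
    fix g assume g: "g \<in> carrier G"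
    have iff: "inv\<^bsub>G\<^esub> (inv\<^bsub>G\<^esub> x i) \<otimes>\<^bsub>G\<^esub> g \<in> A \<longleftrightarrow> f i = A #>\<^bsub>G\<^esub> inv\<^bsub>G\<^esub> g" if i: "i < k" for i
    proof -
      have xi: "x i \<in> carrier G" using x i by auto
      have "x i \<otimes>\<^bsub>G\<^esub> g \<in> A \<longleftrightarrow> x i \<in> A #>\<^bsub>G\<^esub> inv\<^bsub>G\<^esub> g"
        using A.rcos_module[OF group_axioms, of "inv\<^bsub>G\<^esub> g" "x i"] xi g by simp
      also have "\<dots> \<longleftrightarrow> A #>\<^bsub>G\<^esub> x i = A #>\<^bsub>G\<^esub> inv\<^bsub>G\<^esub> g"
        using repr_independence[OF _ _ A] rcos_self[OF _ A] g xi by (metis inv_closed)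
      finally show ?thesis using x i xi by simp
    qed
    have "A #>\<^bsub>G\<^esub> inv\<^bsub>G\<^esub> g \<in> rcosets\<^bsub>G\<^esub> A" using g by (auto simp: RCOSETS_def)
    then have "A #>\<^bsub>G\<^esub> inv\<^bsub>G\<^esub> g \<in> f ` {..<k}" using f by (simp add: bij_betw_def)
    then obtain i where i: "i < k" "f i = A #>\<^bsub>G\<^esub> inv\<^bsub>G\<^esub> g" by force
    show "\<exists>!i. i < k \<and> inv\<^bsub>G\<^esub> (inv\<^bsub>G\<^esub> x i) \<otimes>\<^bsub>G\<^esub> g \<in> A"
    proof (rule ex1I[of _ i])
      show "i < k \<and> inv\<^bsub>G\<^esub> (inv\<^bsub>G\<^esub> x i) \<otimes>\<^bsub>G\<^esub> g \<in> A" using i iff by auto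
      fix j assume "j < k \<and> inv\<^bsub>G\<^esub> (inv\<^bsub>G\<^esub> x j) \<otimes>\<^bsub>G\<^esub> g \<in> A"
      then have "j < k" "f j = f i" using i iff by auto
      then show "j = i" using f i by (auto simp: bij_betw_def inj_on_def)
    qed
  qed
  then show ?thesis using that by blast
qed

locale induction_datum = group G + subgroup A G
  for G :: "('a, 'b) monoid_scheme" (structure) and A +
  fixes \<psi> :: "'a \<Rightarrow> complex" and k :: nat and t :: "nat \<Rightarrow> 'a"
  assumes tr: "transversal G A k t" and char: "linear_char G A \<psi>"
begin

lemma t_closed [simp, intro]: "i < k \<Longrightarrow> t i \<in> carrier G"
  using tr by (simp add: transversal_def)

lemma t_ex1: "g \<in> carrier G \<Longrightarrow> \<exists>!i. i < k \<and> inv (t i) \<otimes> g \<in> A"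
  using tr by (simp add: transversal_def)

lemma t_obtain:
  assumes "g \<in> carrier G"
  obtains l where "l < k" "inv (t l) \<otimes> g \<in> A"
    "\<And>l'. l' < k \<Longrightarrow> inv (t l') \<otimes> g \<in> A \<Longrightarrow> l' = l"
  using t_ex1[OF assms] by (elim ex1E) blast

lemma t_eq_iff: "i < k \<Longrightarrow> j < k \<Longrightarrow> inv (t i) \<otimes> t j \<in> A \<longleftrightarrow> i = j"
  using t_ex1[of "t j"] by (metis l_inv one_closed t_closed)

lemma k_pos: "k > 0" using t_ex1[OF group.is_monoid[THEN monoid.one_closed, OF group_axioms]] by auto

abbreviation "I \<equiv> induced G A \<psi> k t"

lemma I_carrier [simp]: "I g \<in> carrier_mat k k" by (simp add: induced_def)
lemma I_dim [simp]: "dim_row (I g) = k" "dim_col (I g) = k" by (simp_all add: induced_def)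

lemma I_index: "i < k \<Longrightarrow> j < k \<Longrightarrow> I g $$ (i, j) =
    (if inv (t i) \<otimes> g \<otimes> t j \<in> A then \<psi> (inv (t i) \<otimes> g \<otimes> t j) else 0)"
  by (simp add: induced_def)

lemma I_mult:
  assumes g: "g \<in> carrier G" and h: "h \<in> carrier G"
  shows "I (g \<otimes> h) = I g * I h"
proof (rule eq_matI)
  fix i j assume "i < dim_row (I g * I h)" "j < dim_col (I g * I h)"
  then have ij: "i < k" "j < k" by auto
  \<comment> \<open>The row of the only surviving entry in column j of \<open>I h\<close>; the
    matrix product collapses to this single summand.\<close>
  obtain l where l: "l < k" "inv (t l) \<otimes> (h \<otimes> t j) \<in> A"
    and lu: "\<And>l'. l' < k \<Longrightarrow> inv (t l') \<otimes> (h \<otimes> t j) \<in> A \<Longrightarrow> l' = l"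
    using t_obtain[of "h \<otimes> t j"] h ij by blast
  have prod: "inv (t i) \<otimes> (g \<otimes> h) \<otimes> t j = (inv (t i) \<otimes> g \<otimes> t l) \<otimes> (inv (t l) \<otimes> h \<otimes> t j)"
  proof -
    have "(inv (t i) \<otimes> g \<otimes> t l) \<otimes> (inv (t l) \<otimes> h \<otimes> t j)
        = inv (t i) \<otimes> g \<otimes> (t l \<otimes> (inv (t l) \<otimes> (h \<otimes> t j)))"
      using ij l g h by (simp add: m_assoc)
    also have "t l \<otimes> (inv (t l) \<otimes> (h \<otimes> t j)) = h \<otimes> t j"
      using ij l h by (simp add: m_inv_cancel)
    finally show ?thesis using ij l g h by (simp add: m_assoc)
  qed
  have lA: "inv (t l) \<otimes> h \<otimes> t j \<in> A" using l h ij by (simp add: m_assoc)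
  have iff: "inv (t i) \<otimes> (g \<otimes> h) \<otimes> t j \<in> A \<longleftrightarrow> inv (t i) \<otimes> g \<otimes> t l \<in> A"
  proof
    assume a: "inv (t i) \<otimes> (g \<otimes> h) \<otimes> t j \<in> A"
    have "inv (t i) \<otimes> g \<otimes> t l = (inv (t i) \<otimes> (g \<otimes> h) \<otimes> t j) \<otimes> inv (inv (t l) \<otimes> h \<otimes> t j)"
      unfolding prod using ij l g h by (simp add: inv_solve_right' m_assoc)
    then show "inv (t i) \<otimes> g \<otimes> t l \<in> A" using a lA by simp
  qed (use lA prod in auto)
  have "(I g * I h) $$ (i,j) = (\<Sum>m<k. I g $$ (i,m) * I h $$ (m,j))"
    using ij by (simp add: scalar_prod_def atLeast0LessThan)
  also have "\<dots> = (\<Sum>m<k. if m = l then I g $$ (i,l) * I h $$ (l,j) else 0)"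
  proof (intro sum.cong refl)
    fix m assume m: "m \<in> {..<k}"
    have "I h $$ (m, j) = 0" if "m \<noteq> l"
    proof -
      have "inv (t m) \<otimes> (h \<otimes> t j) \<notin> A" using lu[of m] m that by blast
      then show ?thesis using m ij h by (simp add: I_index m_assoc)
    qed
    then show "I g $$ (i,m) * I h $$ (m,j) = (if m = l then I g $$ (i,l) * I h $$ (l,j) else 0)"
      by simp
  qed
  also have "\<dots> = I g $$ (i,l) * I h $$ (l,j)" using l by simp
  also have "\<dots> = I (g \<otimes> h) $$ (i,j)"
    using ij l lA iff prod char by (auto simp: I_index linear_char_def)
  finally show "I (g \<otimes> h) $$ (i,j) = (I g * I h) $$ (i,j)" by simp
qed auto

lemma I_is_rep: "is_rep G k I"
  unfolding is_rep_def
proof (intro conjI ballI)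
  show "I \<one> = 1\<^sub>m k"
    using char by (intro eq_matI) (auto simp: I_index t_eq_iff linear_char_def l_inv)
qed (auto simp: I_mult)

text \<open>Frobenius reciprocity in matrix form: the eigenvector v determines a map from the
  induced module that sends the j-th basis vector to \<open>\<rho> (t j)\<close> v.\<close>

lemma induced_intertwiner:
  assumes r: "is_rep G n \<rho>" and v: "v \<in> carrier_vec n"
    and ev: "\<And>a. a \<in> A \<Longrightarrow> \<rho> a *\<^sub>v v = \<psi> a \<cdot>\<^sub>v v" and g: "g \<in> carrier G"
  defines "M \<equiv> mat n k (\<lambda>(i, j). (\<rho> (t j) *\<^sub>v v) $ i)"
  shows "\<rho> g * M = M * I g"
proof (rule eq_matI)
  have M: "M \<in> carrier_mat n k" by (simp add: M_def)
  have rg: "\<rho> g \<in> carrier_mat n n" using is_repD(1)[OF r g] .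
  fix i j assume "i < dim_row (M * I g)" "j < dim_col (M * I g)"
  then have ij: "i < n" "j < k" using M by auto
  have cM: "col M j' = \<rho> (t j') *\<^sub>v v" if "j' < k" for j'
    using that is_repD(4)[OF r _ v, of "t j'"]
    by (intro eq_vecI) (auto simp: M_def dest!: carrier_vecD)
  obtain l where l: "l < k" "inv (t l) \<otimes> (g \<otimes> t j) \<in> A"
    and lu: "\<And>l'. l' < k \<Longrightarrow> inv (t l') \<otimes> (g \<otimes> t j) \<in> A \<Longrightarrow> l' = l"
    using t_obtain[of "g \<otimes> t j"] g ij by blast
  let ?a = "inv (t l) \<otimes> (g \<otimes> t j)"
  have gt: "g \<otimes> t j = t l \<otimes> ?a" using g ij l by (simp add: m_inv_cancel)
  have "(\<rho> g * M) $$ (i,j) = (\<rho> g *\<^sub>v col M j) $ i" using ij M rg by simp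
  also have "\<rho> g *\<^sub>v col M j = \<rho> (g \<otimes> t j) *\<^sub>v v"
    using cM ij is_rep_mult_vec[OF r g _ v, of "t j"] by simp
  also have "\<dots> = \<rho> (t l) *\<^sub>v (\<rho> ?a *\<^sub>v v)"
    using gt is_rep_mult_vec[OF r _ _ v, of "t l" ?a] l g ij by simp
  also have "\<dots> = \<psi> ?a \<cdot>\<^sub>v (\<rho> (t l) *\<^sub>v v)"
    using ev l is_repD(1)[OF r, of "t l"] v by (simp add: mult_mat_vec)
  also have "\<dots> $ i = \<psi> ?a * M $$ (i, l)"
    using ij l carrier_vecD[OF is_repD(4)[OF r _ v, of "t l"]]
    by (simp add: M_def del: index_mult_mat_vec dim_mult_mat_vec)
  also have "\<dots> = (\<Sum>m<k. if m = l then M $$ (i,l) * \<psi> ?a else 0)" using l by simp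
  also have "\<dots> = (\<Sum>m<k. M $$ (i,m) * I g $$ (m,j))"
  proof (intro sum.cong refl)
    fix m assume m: "m \<in> {..<k}"
    show "(if m = l then M $$ (i,l) * \<psi> ?a else 0) = M $$ (i,m) * I g $$ (m,j)"
    proof (cases "m = l")
      case True
      then show ?thesis using l ij g by (simp add: I_index m_assoc)
    next
      case False
      then have "inv (t m) \<otimes> (g \<otimes> t j) \<notin> A" using lu[of m] m by blast
      then show ?thesis using False m ij g by (simp add: I_index m_assoc)
    qed
  qed
  also have "\<dots> = (M * I g) $$ (i,j)"
    using M ij by (simp add: scalar_prod_def atLeast0LessThan)
  finally show "(\<rho> g * M) $$ (i,j) = (M * I g) $$ (i,j)" .
qed (use is_repD(1)[OF r g] in \<open>auto simp: M_def\<close>)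

end

text \<open>The assumption \<open>free\<close> says that the inertia group of \<open>\<psi>\<close>
  is A itself, which is Clifford's criterion for the induced representation to be
  irreducible.\<close>

locale free_induction_datum = induction_datum + normal A G +
  assumes free: "\<And>g. g \<in> carrier G - A \<Longrightarrow> \<exists>a\<in>A. \<psi> (inv g \<otimes> a \<otimes> g) \<noteq> \<psi> a"
begin

lemma conj_A: "g \<in> carrier G \<Longrightarrow> a \<in> A \<Longrightarrow> inv g \<otimes> a \<otimes> g \<in> A"
  by (rule inv_op_closed1)

lemma I_diag:
  assumes a: "a \<in> A" and ij: "i < k" "j < k"
  shows "I a $$ (i, j) = (if i = j then \<psi> (inv (t i) \<otimes> a \<otimes> t i) else 0)"
proof (cases "i = j")
  case True
  then show ?thesis using assms conj_A[of "t i" a] by (simp add: I_index)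
next
  case False
  have "inv (t i) \<otimes> a \<otimes> t j \<notin> A"
  proof
    assume b: "inv (t i) \<otimes> a \<otimes> t j \<in> A"
    have "inv (t i) \<otimes> t j = (inv (t i) \<otimes> inv a \<otimes> t i) \<otimes> (inv (t i) \<otimes> a \<otimes> t j)"
    proof -
      have ac: "a \<in> carrier G" using a by simp
      have "(inv (t i) \<otimes> inv a \<otimes> t i) \<otimes> (inv (t i) \<otimes> a \<otimes> t j)
        = inv (t i) \<otimes> (inv a \<otimes> ((t i \<otimes> inv (t i)) \<otimes> (a \<otimes> t j)))"
        using ij ac by (simp add: m_assoc m_inv_cancel)
      also have "\<dots> = inv (t i) \<otimes> (inv a \<otimes> (a \<otimes> t j))" using ij ac by simp
      also have "inv a \<otimes> (a \<otimes> t j) = t j" using ij ac by (simp add: m_assoc[symmetric])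
      finally show ?thesis by simp
    qed
    then have "inv (t i) \<otimes> t j \<in> A" using b conj_A[of "t i" "inv a"] a ij by simp
    then show False using t_eq_iff ij False by simp
  qed
  then show ?thesis using False ij by (simp add: I_index)
qed

lemma I_diag_distinct:
  assumes ij: "i < k" "j < k" "i \<noteq> j"
  shows "\<exists>a\<in>A. \<psi> (inv (t i) \<otimes> a \<otimes> t i) \<noteq> \<psi> (inv (t j) \<otimes> a \<otimes> t j)"
proof -
  let ?g = "inv (t i) \<otimes> t j"
  have "?g \<in> carrier G - A" using t_eq_iff ij by auto
  then obtain a where a: "a \<in> A" "\<psi> (inv ?g \<otimes> a \<otimes> ?g) \<noteq> \<psi> a" using free by blast
  \<comment> \<open>Conjugating b by \<open>t i\<close> gives back a, while conjugating it by
    \<open>t j\<close> gives the conjugate of a by \<open>inv (t i) \<otimes> t j\<close>.\<close>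
  define b where "b = t i \<otimes> a \<otimes> inv (t i)"
  have ac: "a \<in> carrier G" using a by simp
  have b: "b \<in> A" using a ij by (simp add: b_def inv_op_closed2)
  have "inv (t i) \<otimes> b \<otimes> t i = a"
    unfolding b_def using ac ij by (simp add: m_assoc m_inv_cancel)
  moreover have "inv (t j) \<otimes> b \<otimes> t j = inv ?g \<otimes> a \<otimes> ?g"
    unfolding b_def using ac ij by (simp add: m_assoc inv_mult_group)
  ultimately show ?thesis using a b by metis
qed

lemma I_diag_vec:
  assumes a: "a \<in> A" and v: "v \<in> carrier_vec k" and i: "i < k"
  shows "(I a *\<^sub>v v) $ i = \<psi> (inv (t i) \<otimes> a \<otimes> t i) * v $ i"
proof -
  have "(I a *\<^sub>v v) $ i = (\<Sum>j<k. I a $$ (i, j) * v $ j)"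
    using v i by (simp add: scalar_prod_def atLeast0LessThan)
  also have "\<dots> = (\<Sum>j<k. if j = i then \<psi> (inv (t i) \<otimes> a \<otimes> t i) * v $ i else 0)"
    using a i by (intro sum.cong refl) (auto simp: I_diag)
  also have "\<dots> = \<psi> (inv (t i) \<otimes> a \<otimes> t i) * v $ i" using i by simp
  finally show ?thesis .
qed

lemma I_translate_unit:
  assumes ij: "i < k" "j < k"
  shows "I (t j \<otimes> inv (t i)) *\<^sub>v unit_vec k i = unit_vec k j"
proof (rule eq_vecI)
  fix l assume "l < dim_vec (unit_vec k j :: complex vec)"
  then have l: "l < k" by simp
  have "(I (t j \<otimes> inv (t i)) *\<^sub>v unit_vec k i) $ l = I (t j \<otimes> inv (t i)) $$ (l, i)"
    using l ij by (simp add: mult_unit_vec_col)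
  moreover have "inv (t l) \<otimes> (t j \<otimes> inv (t i)) \<otimes> t i = inv (t l) \<otimes> t j"
    using l ij by (simp add: m_assoc)
  ultimately show "(I (t j \<otimes> inv (t i)) *\<^sub>v unit_vec k i) $ l = unit_vec k j $ l"
    using char l ij t_eq_iff[OF l ij(2)] by (auto simp: I_index linear_char_def l_inv)
qed (use ij in auto)

text \<open>A nonzero vector of W with minimal support has only one nonzero coordinate, because
  distinct conjugates of \<open>\<psi>\<close> would allow a second one to be separated off. So W
  contains a unit vector, and the translations carry it to all the others.\<close>

lemma I_irreducible: "irreducible_rep G k I"
  unfolding irreducible_rep_def
proof (intro conjI allI impI I_is_rep k_pos)
  fix W assume inv: "invariant_subspace G k I W"
  then have W: "subspace_vec k W" and WG: "\<And>g v. g \<in> carrier G \<Longrightarrow> v \<in> W \<Longrightarrow> I g *\<^sub>v v \<in> W"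
    by (auto simp: invariant_subspace_iff)
  have Wc: "v \<in> carrier_vec k" if "v \<in> W" for v using W that by (auto simp: subspace_vec_def)
  show "W = {0\<^sub>v k} \<or> W = carrier_vec k"
  proof (cases "W = {0\<^sub>v k}")
    case False
    define S where "S v = {i. i < k \<and> v $ i \<noteq> 0}" for v :: "complex vec"
    obtain v0 where "v0 \<in> W" "v0 \<noteq> 0\<^sub>v k" using False W by (auto simp: subspace_vec_def)
    then obtain v where v: "v \<in> W" "v \<noteq> 0\<^sub>v k"
      and vmin: "\<And>w. w \<in> W \<Longrightarrow> w \<noteq> 0\<^sub>v k \<Longrightarrow> card (S v) \<le> card (S w)"
      using exists_least_lemma[of "\<lambda>m. \<exists>v. v \<in> W \<and> v \<noteq> 0\<^sub>v k \<and> card (S v) = m"]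
      by (metis (mono_tags, lifting) ex_has_least_nat[of "\<lambda>v. v \<in> W \<and> v \<noteq> 0\<^sub>v k" v0 "\<lambda>v. card (S v)"])
    have vc: "v \<in> carrier_vec k" using v Wc by auto
    obtain i where i: "i < k" "v $ i \<noteq> 0"
      using v(2) vc by (metis carrier_vecD eq_vecI index_zero_vec(1) index_zero_vec(2))
    have supp: "v $ j = 0" if j: "j < k" "j \<noteq> i" for j
    proof (rule ccontr)
      assume vj: "v $ j \<noteq> 0"
      obtain a where a: "a \<in> A" "\<psi> (inv (t i) \<otimes> a \<otimes> t i) \<noteq> \<psi> (inv (t j) \<otimes> a \<otimes> t j)"
        using I_diag_distinct i j by blast
      let ?c = "\<psi> (inv (t i) \<otimes> a \<otimes> t i)"
      \<comment> \<open>This combination kills coordinate i and keeps coordinate j, so it has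
        smaller nonempty support.\<close>
      define w where "w = I a *\<^sub>v v + (- ?c) \<cdot>\<^sub>v v"
      have wW: "w \<in> W" using W WG[of a v] v a by (simp add: w_def subspace_vec_def)
      have wl: "w $ l = (\<psi> (inv (t l) \<otimes> a \<otimes> t l) - ?c) * v $ l" if "l < k" for l
        using that vc a by (simp add: w_def I_diag_vec algebra_simps del: index_mult_mat_vec)
      have "w $ j \<noteq> 0" using wl j vj a by simp
      then have "w \<noteq> 0\<^sub>v k" using j by auto
      moreover have "S w \<subset> S v"
      proof (rule psubsetI)
        show "S w \<subseteq> S v" using wl by (auto simp: S_def)
        have "i \<in> S v" "i \<notin> S w" using i wl[of i] by (simp_all add: S_def)
        then show "S w \<noteq> S v" by blast
      qed
      then have "card (S w) < card (S v)" by (intro psubset_card_mono) (auto simp: S_def)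
      ultimately show False using vmin[OF wW] by simp
    qed
    have "unit_vec k i = inverse (v $ i) \<cdot>\<^sub>v v"
      using supp i vc by (intro eq_vecI) auto
    then have "unit_vec k i \<in> W" using W v by (simp add: subspace_vec_def)
    then have units: "unit_vec k j \<in> W" if "j < k" for j
      using WG[of "t j \<otimes> inv (t i)" "unit_vec k i"] I_translate_unit that i by simp
    have "x \<in> W" if x: "x \<in> carrier_vec k" for x
    proof -
      have "vec k (\<lambda>i. \<Sum>j<k. x $ j * unit_vec k j $ i) = x"
      proof (rule eq_vecI)
        fix l assume "l < dim_vec x"
        then have l: "l < k" using x by simp
        have "(\<Sum>j<k. x $ j * unit_vec k j $ l) = (\<Sum>j<k. if j = l then x $ l else 0)"
          using l by (intro sum.cong) auto
        then show "vec k (\<lambda>i. \<Sum>j<k. x $ j * unit_vec k j $ i) $ l = x $ l" using l by simp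
      qed (use x in auto)
      then show ?thesis using subspace_vec_sum[OF W, of k "unit_vec k" "($) x"] units by simp
    qed
    then show ?thesis using Wc by auto
  qed simp
qed

text \<open>The intertwiner built from v is nonzero, since its first column is the image of v under
  an invertible matrix; Schur's lemma then compares the degrees.\<close>

lemma irreducible_over_char_degree:
  assumes \<rho>: "irreducible_rep G n \<rho>" and v: "v \<in> carrier_vec n" "v \<noteq> 0\<^sub>v n"
    and ev: "\<And>a. a \<in> A \<Longrightarrow> \<rho> a *\<^sub>v v = \<psi> a \<cdot>\<^sub>v v"
  shows "n = k"
proof -
  have r: "is_rep G n \<rho>" using \<rho> by (simp add: irreducible_rep_def)
  define M where "M = mat n k (\<lambda>(i, j). (\<rho> (t j) *\<^sub>v v) $ i)"
  have M: "M \<in> carrier_mat n k" by (simp add: M_def)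
  have "M \<noteq> 0\<^sub>m n k"
  proof
    assume M0: "M = 0\<^sub>m n k"
    have t0: "t 0 \<in> carrier G" using k_pos by simp
    have "\<rho> (t 0) *\<^sub>v v = 0\<^sub>v n"
    proof (rule eq_vecI)
      fix i assume "i < dim_vec (0\<^sub>v n :: complex vec)"
      then have i: "i < n" by simp
      have "(\<rho> (t 0) *\<^sub>v v) $ i = M $$ (i, 0)" using i k_pos by (simp add: M_def)
      then show "(\<rho> (t 0) *\<^sub>v v) $ i = 0\<^sub>v n $ i" using M0 i k_pos by simp
    qed (use is_repD(4)[OF r t0 v(1)] in \<open>simp add: carrier_vecD del: dim_mult_mat_vec\<close>)
    then have "\<rho> (inv (t 0) \<otimes> t 0) *\<^sub>v v = 0\<^sub>v n"
      using is_rep_mult_vec[OF r _ t0 v(1), of "inv (t 0)"] t0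
        mult_mat_vec_zero[OF is_repD(1)[OF r, of "inv (t 0)"]] by simp
    then show False using v one_mult_vec[OF v(1) r] t0 by (simp add: l_inv)
  qed
  then show ?thesis
    using intertwiner_degree_eq[OF \<rho> I_irreducible M] induced_intertwiner[OF r v(1) ev]
    by (simp add: M_def)
qed

end

lemma eigenvector_linear_char:
  assumes r: "is_rep G n \<rho>" and G: "group G" and A: "subgroup A G"
    and v: "v \<in> carrier_vec n" "v \<noteq> 0\<^sub>v n"
    and ev: "\<And>a. a \<in> A \<Longrightarrow> \<rho> a *\<^sub>v v = \<psi> a \<cdot>\<^sub>v v"
  shows "linear_char G A \<psi>"
proof -
  interpret group G by fact
  interpret A: subgroup A G by fact
  note eq = smult_vec_right_cancel[OF v]
  have "\<psi> \<one>\<^bsub>G\<^esub> \<cdot>\<^sub>v v = 1 \<cdot>\<^sub>v v"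
    using ev[of "\<one>\<^bsub>G\<^esub>"] one_mult_vec[OF v(1) r] by simp
  moreover have "\<psi> (a \<otimes>\<^bsub>G\<^esub> b) = \<psi> a * \<psi> b" if ab: "a \<in> A" "b \<in> A" for a b
  proof (rule eq)
    have "\<psi> (a \<otimes>\<^bsub>G\<^esub> b) \<cdot>\<^sub>v v = \<rho> a *\<^sub>v (\<rho> b *\<^sub>v v)"
      using ev[of "a \<otimes>\<^bsub>G\<^esub> b"] is_rep_mult_vec[OF r _ _ v(1), of a b] ab by simp
    also have "\<dots> = \<psi> b \<cdot>\<^sub>v (\<psi> a \<cdot>\<^sub>v v)"
      using ev ab is_repD(1)[OF r, of a] v by (simp add: mult_mat_vec)
    finally show "\<psi> (a \<otimes>\<^bsub>G\<^esub> b) \<cdot>\<^sub>v v = (\<psi> a * \<psi> b) \<cdot>\<^sub>v v"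
      by (simp add: smult_smult_assoc mult.commute)
  qed
  ultimately show ?thesis using eq unfolding linear_char_def by blast
qed

section \<open>Commutators and linear characters\<close>

lemma mat_eqI_vec:
  fixes M N :: "complex mat"
  assumes "M \<in> carrier_mat n n" "N \<in> carrier_mat n n"
    and "\<And>v. v \<in> carrier_vec n \<Longrightarrow> M *\<^sub>v v = N *\<^sub>v v"
  shows "M = N"
proof (rule eq_matI)
  fix i j assume "i < dim_row N" "j < dim_col N"
  then have ij: "i < n" "j < n" using assms by auto
  have "col M j = col N j"
    using assms(3)[of "unit_vec n j"] mult_unit_vec_col[OF assms(1) ij(2)]
      mult_unit_vec_col[OF assms(2) ij(2)] by simp
  then show "M $$ (i,j) = N $$ (i,j)"
    using assms ij by (metis carrier_matD index_col)
qed (use assms in auto)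

context group
begin

definition cm :: "'a \<Rightarrow> 'a \<Rightarrow> 'a" where "cm g u = g \<otimes> u \<otimes> inv g \<otimes> inv u"

lemma cm_closed [simp]: "g \<in> carrier G \<Longrightarrow> u \<in> carrier G \<Longrightarrow> cm g u \<in> carrier G"
  by (simp add: cm_def)

lemma cm_mult: "g \<in> carrier G \<Longrightarrow> u \<in> carrier G \<Longrightarrow> g \<otimes> u = cm g u \<otimes> (u \<otimes> g)"
  by (simp add: cm_def m_assoc m_inv_cancel)

lemma inv_cm: "g \<in> carrier G \<Longrightarrow> u \<in> carrier G \<Longrightarrow> inv (cm g u) = cm u g"
  by (simp add: cm_def m_assoc inv_mult_group)

lemma cm_eq_oneI: "g \<in> carrier G \<Longrightarrow> u \<in> carrier G \<Longrightarrow> g \<otimes> u = u \<otimes> g \<Longrightarrow> cm g u = \<one>"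
  by (simp add: cm_def m_assoc m_inv_cancel)

lemma cm_normal:
  assumes "N \<lhd> G" "g \<in> carrier G" "u \<in> N"
  shows "cm g u \<in> N" "cm u g \<in> N"
proof -
  interpret normal N G by fact
  show 1: "cm g u \<in> N" using assms by (simp add: cm_def inv_op_closed2)
  then show "cm u g \<in> N" using inv_cm[of g u] assms by (metis m_inv_closed mem_carrier)
qed

text \<open>If u and v have the same commutator with g, then \<open>inv v \<otimes> u\<close>
  commutes with g and is trivial. So u to \<open>cm g u\<close> is an injection of the finite set N
  into itself.\<close>

lemma cm_surj:
  assumes fin: "finite (carrier G)" and N: "N \<lhd> G" and g: "g \<in> carrier G"
    and free: "\<And>u. u \<in> N \<Longrightarrow> g \<otimes> u = u \<otimes> g \<Longrightarrow> u = \<one>" and w: "w \<in> N"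
  shows "\<exists>u\<in>N. cm g u = w"
proof -
  interpret normal N G by fact
  have "inj_on (cm g) N"
  proof (rule inj_onI)
    fix u v assume uv: "u \<in> N" "v \<in> N" "cm g u = cm g v"
    have c: "u \<in> carrier G" "v \<in> carrier G" using uv by auto
    have "g \<otimes> u \<otimes> inv g = cm g u \<otimes> u" "g \<otimes> v \<otimes> inv g = cm g v \<otimes> v"
      using c g by (simp_all add: cm_def m_assoc)
    then have "inv (g \<otimes> v \<otimes> inv g) \<otimes> (g \<otimes> u \<otimes> inv g) = inv v \<otimes> u"
      using uv(3) c g by (simp add: inv_mult_group m_assoc m_inv_cancel)
    then have "g \<otimes> (inv v \<otimes> u) \<otimes> inv g = inv v \<otimes> u"
      using c g by (simp add: inv_mult_group m_assoc m_inv_cancel)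
    moreover have "g \<otimes> (inv v \<otimes> u) = g \<otimes> (inv v \<otimes> u) \<otimes> inv g \<otimes> g"
      using c g by (simp add: m_assoc)
    ultimately have "g \<otimes> (inv v \<otimes> u) = (inv v \<otimes> u) \<otimes> g" by simp
    then have "inv v \<otimes> u = \<one>" using free uv by simp
    then have "v \<otimes> (inv v \<otimes> u) = v" using c by simp
    then show "u = v" using c by (simp add: m_inv_cancel)
  qed
  moreover have "cm g ` N \<subseteq> N" using cm_normal[OF N g] by auto
  moreover have "finite N" using fin subset finite_subset by blast
  ultimately have "cm g ` N = N" by (intro endo_inj_surj)
  then show ?thesis using w by force
qed

text \<open>The inertia group of a linear character; it contains N because the values of the
  character commute.\<close>

lemma stabilizer_char_subgroup:
  assumes N: "N \<lhd> G" and \<psi>: "linear_char G N \<psi>"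
  defines "S \<equiv> {g \<in> carrier G. \<forall>a\<in>N. \<psi> (inv g \<otimes> a \<otimes> g) = \<psi> a}"
  shows "subgroup S G" "N \<subseteq> S"
proof -
  interpret normal N G by fact
  have hom: "\<psi> (a \<otimes> b) = \<psi> a * \<psi> b" if "a \<in> N" "b \<in> N" for a b
    using \<psi> that by (simp add: linear_char_def)
  show "subgroup S G"
  proof (rule subgroupI)
    have "\<one> \<in> S" by (auto simp: S_def)
    then show "S \<noteq> {}" by blast
    show "inv g \<in> S" if "g \<in> S" for g
    proof -
      have g: "g \<in> carrier G" "\<And>a. a \<in> N \<Longrightarrow> \<psi> (inv g \<otimes> a \<otimes> g) = \<psi> a" using that by (auto simp: S_def)
      have "\<psi> (g \<otimes> a \<otimes> inv g) = \<psi> a" if a: "a \<in> N" for a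
      proof -
        have "inv g \<otimes> (g \<otimes> a \<otimes> inv g) \<otimes> g = a" using a g by (simp add: m_assoc m_inv_cancel)
        then show ?thesis using g(2)[of "g \<otimes> a \<otimes> inv g"] a g(1) by (simp add: inv_op_closed2)
      qed
      then show ?thesis using g by (simp add: S_def)
    qed
    show "g \<otimes> h \<in> S" if "g \<in> S" "h \<in> S" for g h
    proof -
      have gh: "g \<in> carrier G" "h \<in> carrier G"
        "\<And>a. a \<in> N \<Longrightarrow> \<psi> (inv g \<otimes> a \<otimes> g) = \<psi> a" "\<And>a. a \<in> N \<Longrightarrow> \<psi> (inv h \<otimes> a \<otimes> h) = \<psi> a"
        using that by (auto simp: S_def)
      have "\<psi> (inv (g \<otimes> h) \<otimes> a \<otimes> (g \<otimes> h)) = \<psi> a" if a: "a \<in> N" for a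
      proof -
        have "inv (g \<otimes> h) \<otimes> a \<otimes> (g \<otimes> h) = inv h \<otimes> (inv g \<otimes> a \<otimes> g) \<otimes> h"
          using a gh by (simp add: inv_mult_group m_assoc)
        then show ?thesis using gh inv_op_closed1[OF gh(1) a] a by simp
      qed
      then show ?thesis using gh by (simp add: S_def)
    qed
  qed (auto simp: S_def)
  show "N \<subseteq> S"
  proof
    fix n assume n: "n \<in> N"
    have "\<psi> (inv n \<otimes> a \<otimes> n) = \<psi> a" if a: "a \<in> N" for a
    proof -
      have "\<psi> (inv n \<otimes> a \<otimes> n) = \<psi> a * (\<psi> (inv n) * \<psi> n)" using a n by (simp add: hom)
      also have "\<psi> (inv n) * \<psi> n = 1" using \<psi> n by (simp add: hom[symmetric] linear_char_def)
      finally show ?thesis by simp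
    qed
    then show "n \<in> S" using n by (simp add: S_def)
  qed
qed

text \<open>By Lagrange the index of K in S divides the prime q, so S is K or everything.\<close>

lemma subgroup_above_prime_index:
  assumes fin: "finite (carrier G)" and K: "subgroup K G" and S: "subgroup S G" and KS: "K \<subseteq> S"
    and q: "prime q" "card (carrier G) = q * card K" and g: "g \<in> S" "g \<notin> K"
  shows "S = carrier G"
proof -
  interpret S: subgroup S G by fact
  interpret K: subgroup K G by fact
  have "group (G\<lparr>carrier := S\<rparr>)" by (rule subgroup_imp_group[OF S])
  moreover have "subgroup K (G\<lparr>carrier := S\<rparr>)" using subgroup_incl[OF K S KS] .
  ultimately have "card (rcosets\<^bsub>G\<lparr>carrier := S\<rparr>\<^esub> K) * card K = card S"
    using group.lagrange[of "G\<lparr>carrier := S\<rparr>" K] by (simp add: Coset.order_def)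
  then have "card K dvd card S" by (metis dvd_triv_right)
  then obtain c where c: "card S = card K * c" by blast
  have "card S dvd card (carrier G)"
    using lagrange[OF S] by (metis dvd_triv_right Coset.order_def)
  moreover have K0: "card K > 0" using K.finite_imp_card_positive[OF fin] .
  ultimately have "c dvd q" using c q by (simp add: mult.commute)
  then have "c = 1 \<or> c = q" using q(1) prime_nat_iff by blast
  moreover have "c \<noteq> 1"
  proof
    assume "c = 1"
    then have "card K = card S" using c by simp
    then have "K = S" using KS card_subset_eq fin S.subset finite_subset by metis
    with g show False by blast
  qed
  ultimately have "card S = card (carrier G)" using c q by simp
  then show ?thesis using card_subset_eq[OF fin S.subset] by blast
qed

text \<open>A conjugate of a differs from a by a commutator, so a character that is nontrivial on
  some commutator of the element with N is moved by that element.\<close>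

lemma char_free_from_cm:
  assumes N: "N \<lhd> G" and \<psi>: "linear_char G N \<psi>"
    and cm: "\<And>g. g \<in> carrier G - N \<Longrightarrow> \<exists>a\<in>N. \<psi> (cm g a) \<noteq> 1" and g: "g \<in> carrier G - N"
  shows "\<exists>a\<in>N. \<psi> (inv g \<otimes> a \<otimes> g) \<noteq> \<psi> a"
proof -
  interpret normal N G by fact
  \<comment> \<open>\<open>cm g a\<close> conjugates by g, whereas the claim conjugates by the
    inverse, so the hypothesis is applied to \<open>inv g\<close>.\<close>
  have "inv g \<in> carrier G - N" using g by (metis Diff_iff inv_closed inv_inv m_inv_closed)
  then obtain a where a: "a \<in> N" "\<psi> (cm (inv g) a) \<noteq> 1" using cm by blast
  have "\<psi> (cm (inv g) a) = \<psi> (inv g \<otimes> a \<otimes> g) * \<psi> (inv a)"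
    using \<psi> a g inv_op_closed1[of g a] by (simp add: cm_def linear_char_def)
  moreover have "\<psi> a * \<psi> (inv a) = 1"
    using \<psi> a by (metis linear_char_def m_inv_closed mem_carrier r_inv)
  ultimately show ?thesis using a by metis
qed

text \<open>The two uses of an inertia group equal to N: it produces the degree k, and it forces
  that degree on every irreducible representation containing the character.\<close>

lemma char_degree_free:
  assumes fin: "finite (carrier G)" and N: "N \<lhd> G" and k: "card (carrier G) = k * card N"
    and \<psi>: "linear_char G N \<psi>"
    and free: "\<And>g. g \<in> carrier G - N \<Longrightarrow> \<exists>a\<in>N. \<psi> (inv g \<otimes> a \<otimes> g) \<noteq> \<psi> a"
  shows "k \<in> char_degrees G"
    and "\<And>n \<rho> v. irreducible_rep G n \<rho> \<Longrightarrow> v \<in> carrier_vec n \<Longrightarrow> v \<noteq> 0\<^sub>v n \<Longrightarrow>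
           (\<And>a. a \<in> N \<Longrightarrow> \<rho> a *\<^sub>v v = \<psi> a \<cdot>\<^sub>v v) \<Longrightarrow> n = k"
proof -
  obtain t where t: "transversal G N k t"
    using transversal_exists[OF group_axioms fin normal_imp_subgroup[OF N] k] .
  interpret free_induction_datum G N \<psi> k t
    by (intro free_induction_datum.intro induction_datum.intro N group_axioms normal_imp_subgroup
        induction_datum_axioms.intro free_induction_datum_axioms.intro t \<psi> free)
  show "k \<in> char_degrees G" using I_irreducible by (auto simp: char_degrees_def)
  show "n = k" if "irreducible_rep G n \<rho>" "v \<in> carrier_vec n" "v \<noteq> 0\<^sub>v n"
    "\<And>a. a \<in> N \<Longrightarrow> \<rho> a *\<^sub>v v = \<psi> a \<cdot>\<^sub>v v" for n \<rho> v
    using irreducible_over_char_degree that by blast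
qed

lemma rep_commute_of_cm:
  assumes r: "is_rep G n \<rho>" and a: "a \<in> carrier G" and b: "b \<in> carrier G"
    and one: "\<rho> (cm a b) = 1\<^sub>m n"
  shows "\<rho> a * \<rho> b = \<rho> b * \<rho> a"
proof -
  have "\<rho> a * \<rho> b = \<rho> (cm a b \<otimes> (b \<otimes> a))" using is_repD(2)[OF r a b] cm_mult[OF a b] by simp
  also have "\<dots> = \<rho> (cm a b) * \<rho> (b \<otimes> a)" using is_repD(2)[OF r] a b by simp
  also have "\<dots> = \<rho> b * \<rho> a"
    using one is_repD(1,2)[OF r] a b left_mult_one_mat[OF is_repD(1)[OF r, of "b \<otimes> a"]] by simp
  finally show ?thesis .
qed

text \<open>The character is read off a common eigenvector of \<open>B\<close> inside an eigenspace of \<open>w\<close>, for an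
  eigenvalue other than \<open>1\<close>, in the permutation representation on the cosets of \<open>N\<close>.\<close>
lemma separating_linear_char:
  assumes fin: "finite (carrier G)" and N: "N \<lhd> G" and B: "subgroup B G" and NB: "N \<subseteq> B"
    and cm: "\<And>a b. a \<in> B \<Longrightarrow> b \<in> B \<Longrightarrow> cm a b \<in> N" and w: "w \<in> B" "w \<notin> N"
  obtains \<psi> where "linear_char G B \<psi>" "\<And>a. a \<in> N \<Longrightarrow> \<psi> a = 1" "\<psi> w \<noteq> 1"
proof -
  interpret B: subgroup B G by fact
  interpret N: normal N G by fact
  have "card N dvd card (carrier G)"
    using lagrange[OF normal_imp_subgroup[OF N]] by (metis dvd_triv_right Coset.order_def)
  then obtain k where k: "card (carrier G) = k * card N" by (metis dvd_def mult.commute)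
  obtain t where t: "transversal G N k t"
    using transversal_exists[OF group_axioms fin normal_imp_subgroup[OF N] k] .
  interpret induction_datum G N "\<lambda>_. 1" k t
    by (intro induction_datum.intro group_axioms normal_imp_subgroup N induction_datum_axioms.intro t)
      (simp add: linear_char_def)
  have wc: "w \<in> carrier G" using w by simp
  have I1: "I a = 1\<^sub>m k" if a: "a \<in> N" for a
  proof (rule eq_matI)
    fix i j assume "i < dim_row (1\<^sub>m k :: complex mat)" "j < dim_col (1\<^sub>m k :: complex mat)"
    then have ij: "i < k" "j < k" by auto
    have ac: "a \<in> carrier G" using a by simp
    have eq: "inv (t i) \<otimes> a \<otimes> t j = (inv (t i) \<otimes> a \<otimes> t i) \<otimes> (inv (t i) \<otimes> t j)"
      using ij ac by (simp add: m_assoc m_inv_cancel)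
    have c: "inv (t i) \<otimes> a \<otimes> t i \<in> N" using N.inv_op_closed1 ij a by simp
    have "inv (t i) \<otimes> a \<otimes> t j \<in> N \<longleftrightarrow> inv (t i) \<otimes> t j \<in> N"
    proof
      assume "inv (t i) \<otimes> a \<otimes> t j \<in> N"
      then have "inv (inv (t i) \<otimes> a \<otimes> t i) \<otimes> (inv (t i) \<otimes> a \<otimes> t j) \<in> N" using c by simp
      then show "inv (t i) \<otimes> t j \<in> N" unfolding eq using ij ac by (simp add: m_inv_cancel)
    qed (use c in \<open>simp add: eq\<close>)
    then show "I a $$ (i, j) = 1\<^sub>m k $$ (i, j)" using ij t_eq_iff by (simp add: I_index)
  qed auto
  have comm: "I a * I b = I b * I a" if "a \<in> B" "b \<in> B" for a b
    using rep_commute_of_cm[OF I_is_rep] I1 cm that by simp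
  have W: "subspace_vec k (carrier_vec k)" by (auto simp: subspace_vec_def)
  have Iv: "I g *\<^sub>v v \<in> carrier_vec k" if "v \<in> carrier_vec k" for g v
    using that by (auto intro: mult_mat_vec_carrier[OF I_carrier])
  have nz: "unit_vec k 0 \<noteq> (0\<^sub>v k :: complex vec)"
    using k_pos by (metis index_unit_vec(1) index_zero_vec(1) one_neq_zero)
  \<comment> \<open>As w lies outside N it moves the coset of \<open>t 0\<close>; a moved vector is
    what yields an eigenvalue other than 1.\<close>
  have "inv (t 0) \<otimes> w \<otimes> t 0 \<notin> N"
  proof
    assume "inv (t 0) \<otimes> w \<otimes> t 0 \<in> N"
    then have "t 0 \<otimes> (inv (t 0) \<otimes> w \<otimes> t 0) \<otimes> inv (t 0) \<in> N"
      using k_pos by (intro N.inv_op_closed2) auto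
    moreover have "t 0 \<otimes> (inv (t 0) \<otimes> w \<otimes> t 0) \<otimes> inv (t 0) = w"
      using k_pos wc by (simp add: m_assoc m_inv_cancel)
    ultimately show False using w by simp
  qed
  then have "(I w *\<^sub>v unit_vec k 0) $ 0 = 0"
    using k_pos mult_unit_vec_col[OF I_carrier k_pos] by (simp add: I_index)
  then have mv: "I w *\<^sub>v unit_vec k 0 \<noteq> unit_vec k 0" using k_pos by force
  obtain u c where u: "u \<in> carrier_vec k" "u \<noteq> 0\<^sub>v k" "I w *\<^sub>v u = c \<cdot>\<^sub>v u" "c \<noteq> 1"
    using eigenvector_average[OF group_axioms fin I_is_rep wc W Iv unit_vec_carrier nz] mv by blast
  define W' where "W' = {x \<in> carrier_vec k. I w *\<^sub>v x = c \<cdot>\<^sub>v x}"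
  have W': "subspace_vec k W'"
    unfolding subspace_vec_def W'_def
    by (auto simp: mult_add_distrib_mat_vec[OF I_carrier] mult_mat_vec[OF I_carrier]
        smult_add_distrib_vec[where n = k] smult_smult_assoc mult.commute mult_mat_vec_zero[OF I_carrier])
  have W'B: "I b *\<^sub>v x \<in> W'" if "b \<in> B" "x \<in> W'" for b x
  proof -
    have x: "x \<in> carrier_vec k" "I w *\<^sub>v x = c \<cdot>\<^sub>v x" using that by (auto simp: W'_def)
    have "I w *\<^sub>v (I b *\<^sub>v x) = (I w * I b) *\<^sub>v x"
      using x assoc_mult_mat_vec[OF I_carrier I_carrier x(1)] by metis
    also have "\<dots> = (I b * I w) *\<^sub>v x" using comm that w by simp
    also have "\<dots> = I b *\<^sub>v (I w *\<^sub>v x)"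
      using x assoc_mult_mat_vec[OF I_carrier I_carrier x(1)] by metis
    also have "\<dots> = c \<cdot>\<^sub>v (I b *\<^sub>v x)" using x by (simp add: mult_mat_vec[OF I_carrier])
    finally show ?thesis using Iv x by (simp add: W'_def)
  qed
  have "u \<in> W'" using u by (simp add: W'_def)
  then obtain y \<psi> where y: "y \<in> W'" "y \<noteq> 0\<^sub>v k" "\<And>b. b \<in> B \<Longrightarrow> I b *\<^sub>v y = \<psi> b \<cdot>\<^sub>v y"
    using common_eigenvector[OF group_axioms fin I_is_rep B.subset comm W' W'B _ u(2)] by metis
  have yc: "y \<in> carrier_vec k" using y by (simp add: W'_def)
  note eq = smult_vec_right_cancel[OF yc y(2)]
  show ?thesis
  proof
    show "linear_char G B \<psi>"
      using eigenvector_linear_char[OF I_is_rep group_axioms B yc y(2,3)] .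
    show "\<psi> a = 1" if "a \<in> N" for a
      using y(3)[of a] I1[OF that] that NB yc by (intro eq) auto
    have "\<psi> w = c" using y(1) y(3)[of w] w by (intro eq) (simp add: W'_def)
    then show "\<psi> w \<noteq> 1" using u by simp
  qed
qed

text \<open>Invariance of \<open>\<psi>\<close> under conjugation makes its eigenspace a G-invariant
  subspace; it contains v, so it is the whole space.\<close>

lemma irreducible_scalar_on_normal:
  assumes \<rho>: "irreducible_rep G n \<rho>" and N: "N \<lhd> G"
    and v: "v \<in> carrier_vec n" "v \<noteq> 0\<^sub>v n" "\<And>a. a \<in> N \<Longrightarrow> \<rho> a *\<^sub>v v = \<psi> a \<cdot>\<^sub>v v"
    and inv: "\<And>g a. g \<in> carrier G \<Longrightarrow> a \<in> N \<Longrightarrow> \<psi> (inv g \<otimes> a \<otimes> g) = \<psi> a" and a: "a \<in> N"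
  shows "\<rho> a = \<psi> a \<cdot>\<^sub>m 1\<^sub>m n"
proof -
  interpret N: normal N G by fact
  have r: "is_rep G n \<rho>" using \<rho> by (simp add: irreducible_rep_def)
  define W where "W = {x \<in> carrier_vec n. \<forall>a\<in>N. \<rho> a *\<^sub>v x = \<psi> a \<cdot>\<^sub>v x}"
  have Nc: "\<rho> a \<in> carrier_mat n n" if "a \<in> N" for a using is_repD(1)[OF r] that by simp
  have "subspace_vec n W"
    unfolding subspace_vec_def W_def
    by (auto simp: mult_add_distrib_mat_vec[OF Nc] mult_mat_vec[OF Nc]
        smult_add_distrib_vec[where n = n] smult_smult_assoc mult.commute mult_mat_vec_zero[OF Nc])
  moreover have "\<rho> g *\<^sub>v x \<in> W" if g: "g \<in> carrier G" and x: "x \<in> W" for g x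
  proof -
    have xc: "x \<in> carrier_vec n" "\<And>a. a \<in> N \<Longrightarrow> \<rho> a *\<^sub>v x = \<psi> a \<cdot>\<^sub>v x" using x by (auto simp: W_def)
    have "\<rho> a *\<^sub>v (\<rho> g *\<^sub>v x) = \<psi> a \<cdot>\<^sub>v (\<rho> g *\<^sub>v x)" if a: "a \<in> N" for a
    proof -
      let ?b = "inv g \<otimes> a \<otimes> g"
      have b: "?b \<in> N" using N.inv_op_closed1 g a by simp
      have "\<rho> a *\<^sub>v (\<rho> g *\<^sub>v x) = \<rho> (a \<otimes> g) *\<^sub>v x"
        using is_rep_mult_vec[OF r _ g xc(1), of a] a by simp
      also have "a \<otimes> g = g \<otimes> ?b" using a g by (simp add: m_assoc m_inv_cancel)
      also have "\<rho> (g \<otimes> ?b) *\<^sub>v x = \<rho> g *\<^sub>v (\<rho> ?b *\<^sub>v x)"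
        using is_rep_mult_vec[OF r g _ xc(1), of ?b] b by simp
      also have "\<dots> = \<psi> a \<cdot>\<^sub>v (\<rho> g *\<^sub>v x)"
        using xc b inv g a by (simp add: mult_mat_vec[OF is_repD(1)[OF r g]])
      finally show ?thesis .
    qed
    then show ?thesis using is_repD(4)[OF r g xc(1)] by (simp add: W_def)
  qed
  ultimately have "invariant_subspace G n \<rho> W" by (simp add: invariant_subspace_iff)
  moreover have "v \<in> W" using v by (simp add: W_def)
  ultimately have W: "W = carrier_vec n" using \<rho> v by (auto simp: irreducible_rep_def)
  show ?thesis
  proof (rule mat_eqI_vec[OF Nc[OF a]])
    fix x :: "complex vec" assume x: "x \<in> carrier_vec n"
    then have "\<rho> a *\<^sub>v x = \<psi> a \<cdot>\<^sub>v x" using W a by (auto simp: W_def)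
    moreover have "(\<psi> a \<cdot>\<^sub>m 1\<^sub>m n) *\<^sub>v x = \<psi> a \<cdot>\<^sub>v x"
      using x by (intro eq_vecI) auto
    ultimately show "\<rho> a *\<^sub>v x = (\<psi> a \<cdot>\<^sub>m 1\<^sub>m n) *\<^sub>v x" by simp
  qed auto
qed

end

section \<open>Frobenius groups with a Heisenberg-like kernel\<close>

text \<open>The axioms describe a Frobenius group with kernel \<open>P\<close>: \<open>Z\<close> is the derived subgroup and centre
  of \<open>P\<close>, \<open>A\<close> an abelian subgroup on which \<open>P / A\<close> acts through a perfect pairing into \<open>Z\<close>,
  \<open>K / P\<close> the abelian normal subgroup of prime index in the complement \<open>G / P\<close>, and \<open>Q / P\<close> a part
  of it on which \<open>G / K\<close> acts without fixed points.\<close>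

locale frobenius_tower = group G for G :: "('a, 'b) monoid_scheme" (structure) +
  fixes Z A P Q K :: "'a set" and q h e :: nat
  assumes fin: "finite (carrier G)"
    and Z: "Z \<lhd> G" and A: "A \<lhd> G" and P: "P \<lhd> G" and Q: "Q \<lhd> G" and K: "K \<lhd> G"
    and ZA: "Z \<subseteq> A" and AP: "A \<subseteq> P" and PQ: "P \<subseteq> Q" and QK: "Q \<subseteq> K"
    and Z_nontrivial: "\<exists>z\<in>Z. z \<noteq> \<one>" and A_proper: "\<exists>u\<in>P. u \<notin> A" and P_proper: "\<exists>u\<in>Q. u \<notin> P"
    and q: "prime q"
    and index_K: "card (carrier G) = q * card K"
    and index_P: "card (carrier G) = h * card P"
    and index_A: "card (carrier G) = e * h * card A"
    and G_comm: "g \<in> carrier G \<Longrightarrow> u \<in> carrier G \<Longrightarrow> cm g u \<in> K"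
    and K_comm: "g \<in> K \<Longrightarrow> u \<in> K \<Longrightarrow> cm g u \<in> P"
    and P_comm: "g \<in> P \<Longrightarrow> u \<in> P \<Longrightarrow> cm g u \<in> Z"
    and A_comm: "g \<in> A \<Longrightarrow> u \<in> A \<Longrightarrow> g \<otimes> u = u \<otimes> g"
    and Z_central: "z \<in> Z \<Longrightarrow> u \<in> P \<Longrightarrow> z \<otimes> u = u \<otimes> z"
    and pairing: "g \<in> P - A \<Longrightarrow> z \<in> Z \<Longrightarrow> \<exists>b\<in>A. cm g b = z"
    and P_free: "g \<in> carrier G - P \<Longrightarrow> u \<in> P \<Longrightarrow> g \<otimes> u = u \<otimes> g \<Longrightarrow> u = \<one>"
    and Q_free: "g \<in> carrier G - K \<Longrightarrow> u \<in> Q \<Longrightarrow> cm g u \<in> P \<Longrightarrow> u \<in> P"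
begin

lemmas subgroups = normal_imp_subgroup[OF Z] normal_imp_subgroup[OF A] normal_imp_subgroup[OF P]
  normal_imp_subgroup[OF Q] normal_imp_subgroup[OF K]

lemma in_carrier:
  "x \<in> Z \<Longrightarrow> x \<in> carrier G" "x \<in> A \<Longrightarrow> x \<in> carrier G" "x \<in> P \<Longrightarrow> x \<in> carrier G"
  "x \<in> Q \<Longrightarrow> x \<in> carrier G" "x \<in> K \<Longrightarrow> x \<in> carrier G"
  using subgroups[THEN subgroup.subset] by blast+

lemma one_mem: "\<one> \<in> Z" "\<one> \<in> A" "\<one> \<in> P" "\<one> \<in> Q" "\<one> \<in> K"
  using subgroups[THEN subgroup.one_closed] by blast+

lemma incl: "Z \<subseteq> P" "P \<subseteq> K" "{\<one>} \<subseteq> A"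
  using ZA AP PQ QK one_mem by blast+

section \<open>Linear characters with prescribed inertia group\<close>

lemma K_proper: "\<exists>g\<in>carrier G. g \<notin> K"
proof (rule ccontr)
  assume "\<not> ?thesis"
  then have "K = carrier G" using in_carrier by blast
  then have "card K = q * card K" using index_K by simp
  moreover have "card K > 0" using subgroup.finite_imp_card_positive[OF subgroups(5) fin] .
  ultimately show False using q by (simp add: prime_nat_iff)
qed

lemma P_surj: "g \<in> carrier G - P \<Longrightarrow> w \<in> P \<Longrightarrow> \<exists>u\<in>P. cm g u = w"
  using cm_surj[OF fin P, of g] P_free by blast

lemma Z_surj: "g \<in> carrier G - P \<Longrightarrow> w \<in> Z \<Longrightarrow> \<exists>u\<in>Z. cm g u = w"
  using cm_surj[OF fin Z, of g] P_free ZA AP by blast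

text \<open>The element z, on which the character is nontrivial, is a commutator of g with some
  element of A: inside P by the perfect pairing, outside P because g acts freely on Z.\<close>

lemma free_A:
  assumes "linear_char G A \<psi>" "z \<in> Z" "\<psi> z \<noteq> 1" "g \<in> carrier G - A"
  shows "\<exists>a\<in>A. \<psi> (inv g \<otimes> a \<otimes> g) \<noteq> \<psi> a"
proof (rule char_free_from_cm[OF A assms(1) _ assms(4)])
  fix g assume g: "g \<in> carrier G - A"
  have "\<exists>a\<in>A. cm g a = z"
  proof (cases "g \<in> P")
    case True
    then show ?thesis using pairing g assms(2) by blast
  next
    case False
    then show ?thesis using Z_surj[of g z] g assms(2) ZA by blast
  qed
  then show "\<exists>a\<in>A. \<psi> (cm g a) \<noteq> 1" using assms(3) by blast
qed

lemma free_P: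
  assumes "linear_char G P \<psi>" "w \<in> P" "\<psi> w \<noteq> 1" "g \<in> carrier G - P"
  shows "\<exists>a\<in>P. \<psi> (inv g \<otimes> a \<otimes> g) \<noteq> \<psi> a"
proof (rule char_free_from_cm[OF P assms(1) _ assms(4)])
  fix g assume g: "g \<in> carrier G - P"
  show "\<exists>a\<in>P. \<psi> (cm g a) \<noteq> 1" using P_surj[OF g assms(2)] assms(3) by blast
qed

text \<open>The inertia group contains K, which has prime index. If any element outside K belonged
  to it, it would be all of G, contrary to the choice of \<open>g0\<close>.\<close>

lemma free_K:
  assumes \<psi>: "linear_char G K \<psi>" and g0: "g0 \<in> carrier G" "a0 \<in> K" "\<psi> (inv g0 \<otimes> a0 \<otimes> g0) \<noteq> \<psi> a0"
    and g: "g \<in> carrier G - K"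
  shows "\<exists>a\<in>K. \<psi> (inv g \<otimes> a \<otimes> g) \<noteq> \<psi> a"
proof (rule ccontr)
  assume not: "\<not> ?thesis"
  define S where "S = {g \<in> carrier G. \<forall>a\<in>K. \<psi> (inv g \<otimes> a \<otimes> g) = \<psi> a}"
  have "subgroup S G" "K \<subseteq> S" unfolding S_def by (fact stabilizer_char_subgroup[OF K \<psi>])+
  moreover have "g \<in> S" using not g by (auto simp: S_def)
  ultimately have "S = carrier G"
    using subgroup_above_prime_index[OF fin subgroups(5) _ _ q index_K] g by blast
  then have "g0 \<in> S" using g0 by simp
  then show False using g0 by (auto simp: S_def)
qed

section \<open>Character degrees\<close>

lemma degrees_exist: "{1, q, h, e * h} \<subseteq> char_degrees G"
proof -
  have G: "carrier G \<lhd> G" by (intro normal_invI subgroup_self) auto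
  have "1 \<in> char_degrees G"
    by (rule char_degree_free(1)[OF fin G, of 1 "\<lambda>_. 1"]) (auto simp: linear_char_def)
  moreover have "q \<in> char_degrees G"
  proof -
    obtain g where g: "g \<in> carrier G" "g \<notin> K" using K_proper by blast
    obtain u where u: "u \<in> Q" "u \<notin> P" using P_proper by blast
    have ig: "inv g \<in> carrier G - K"
      using g subgroup.m_inv_closed[OF subgroups(5), of "inv g"] by auto
    have uK: "u \<in> K" using u QK by blast
    \<comment> \<open>A character of K that is trivial on P but not at this commutator is moved by
      g.\<close>
    have w: "cm (inv g) u \<in> K" "cm (inv g) u \<notin> P"
      using Q_free[OF ig u(1)] u g G_comm in_carrier by blast+
    obtain \<psi> where \<psi>: "linear_char G K \<psi>" "\<psi> (cm (inv g) u) \<noteq> 1"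
      by (rule separating_linear_char[OF fin P subgroups(5) incl(2) K_comm w])
    have c: "inv g \<otimes> u \<otimes> g \<in> K" using normal.inv_op_closed1[OF K g(1) uK] .
    have "\<psi> (cm (inv g) u) = \<psi> (inv g \<otimes> u \<otimes> g) * \<psi> (inv u)"
      using \<psi>(1) c uK subgroup.m_inv_closed[OF subgroups(5)] g in_carrier
      by (simp add: cm_def linear_char_def)
    moreover have "\<psi> u * \<psi> (inv u) = 1"
      using \<psi>(1) uK subgroup.m_inv_closed[OF subgroups(5)] in_carrier
      by (metis linear_char_def r_inv)
    ultimately have "\<psi> (inv g \<otimes> u \<otimes> g) \<noteq> \<psi> u" using \<psi>(2) by metis
    then show ?thesis
      using char_degree_free(1)[OF fin K index_K \<psi>(1) free_K[OF \<psi>(1) g(1) uK]] by simp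
  qed
  moreover have "h \<in> char_degrees G"
  proof -
    obtain w where w: "w \<in> P" "w \<notin> Z" using A_proper ZA by blast
    obtain \<psi> where \<psi>: "linear_char G P \<psi>" "\<psi> w \<noteq> 1"
      by (rule separating_linear_char[OF fin Z subgroups(3) incl(1) P_comm w])
    show ?thesis
      using char_degree_free(1)[OF fin P index_P \<psi>(1) free_P[OF \<psi>(1) w(1) \<psi>(2)]] by simp
  qed
  moreover have "e * h \<in> char_degrees G"
  proof -
    obtain z where z: "z \<in> Z" "z \<noteq> \<one>" using Z_nontrivial by blast
    \<comment> \<open>Since A is abelian, separation from the trivial subgroup gives a character of
      A that is nontrivial at the chosen central element.\<close>
    have "cm a b \<in> {\<one>}" if "a \<in> A" "b \<in> A" for a b
      using cm_eq_oneI A_comm that in_carrier by simp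
    moreover have "z \<in> A" "z \<notin> {\<one>}" using z ZA by auto
    ultimately obtain \<psi> where \<psi>: "linear_char G A \<psi>" "\<psi> z \<noteq> 1"
      by (rule separating_linear_char[OF fin one_is_normal subgroups(2) incl(3)])
    show ?thesis
      using char_degree_free(1)[OF fin A index_A \<psi>(1) free_A[OF \<psi>(1) z(1) \<psi>(2)]] by simp
  qed
  ultimately show ?thesis by blast
qed

lemma trivial_if_char_trivial:
  assumes \<rho>: "irreducible_rep G n \<rho>" and N: "N \<lhd> G"
    and v: "v \<in> carrier_vec n" "v \<noteq> 0\<^sub>v n" "\<And>a. a \<in> N \<Longrightarrow> \<rho> a *\<^sub>v v = v" and a: "a \<in> N"
  shows "\<rho> a = 1\<^sub>m n"
proof -
  have "\<rho> a = 1 \<cdot>\<^sub>m 1\<^sub>m n"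
    by (rule irreducible_scalar_on_normal[OF \<rho> N v(1,2) _ _ a, of "\<lambda>_. 1"]) (use v in auto)
  also have "\<dots> = 1\<^sub>m n" by (intro eq_matI) auto
  finally show ?thesis .
qed

lemma char_of_commuting:
  assumes r: "is_rep G n \<rho>" and n: "n > 0" and B: "subgroup B G"
    and comm: "\<And>a b. a \<in> B \<Longrightarrow> b \<in> B \<Longrightarrow> \<rho> a * \<rho> b = \<rho> b * \<rho> a"
  obtains v \<psi> where "v \<in> carrier_vec n" "v \<noteq> 0\<^sub>v n" "\<And>b. b \<in> B \<Longrightarrow> \<rho> b *\<^sub>v v = \<psi> b \<cdot>\<^sub>v v"
    "linear_char G B \<psi>"
proof -
  have W: "subspace_vec n (carrier_vec n)" by (auto simp: subspace_vec_def)
  have nz: "unit_vec n 0 \<noteq> (0\<^sub>v n :: complex vec)"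
    using n by (metis index_unit_vec(1) index_zero_vec(1) one_neq_zero)
  obtain v \<psi> where v: "v \<in> carrier_vec n" "v \<noteq> 0\<^sub>v n" "\<And>b. b \<in> B \<Longrightarrow> \<rho> b *\<^sub>v v = \<psi> b \<cdot>\<^sub>v v"
    using common_eigenvector[OF group_axioms fin r subgroup.subset[OF B] comm W _ unit_vec_carrier nz]
      is_repD(4)[OF r] subgroup.mem_carrier[OF B] by metis
  then show ?thesis using that eigenvector_linear_char[OF r group_axioms B v] by blast
qed

lemma degree_cases:
  assumes \<rho>: "irreducible_rep G n \<rho>"
  shows "n \<in> {1, q, h, e * h}"
proof -
  have r: "is_rep G n \<rho>" and n: "n > 0" using \<rho> by (auto simp: irreducible_rep_def)
  have commute: "\<rho> a * \<rho> b = \<rho> b * \<rho> a"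
    if "a \<in> carrier G" "b \<in> carrier G" "\<rho> (cm a b) = 1\<^sub>m n" for a b
    using rep_commute_of_cm[OF r that] .
  have "\<rho> a * \<rho> b = \<rho> b * \<rho> a" if "a \<in> A" "b \<in> A" for a b
    using commute[of a b] that in_carrier cm_eq_oneI A_comm is_repD(3)[OF r] by simp
  then obtain v \<psi> where v: "v \<in> carrier_vec n" "v \<noteq> 0\<^sub>v n" "\<And>b. b \<in> A \<Longrightarrow> \<rho> b *\<^sub>v v = \<psi> b \<cdot>\<^sub>v v"
    and \<psi>: "linear_char G A \<psi>" using char_of_commuting[OF r n subgroups(2)] by metis
  show ?thesis
  proof (cases "\<forall>z\<in>Z. \<psi> z = 1")
    case False
    then obtain z where z: "z \<in> Z" "\<psi> z \<noteq> 1" by blast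
    have "n = e * h" by (rule char_degree_free(2)[OF fin A index_A \<psi> free_A[OF \<psi> z] \<rho> v])
    then show ?thesis by simp
  next
    case True
    \<comment> \<open>A normal subgroup with trivial character acts trivially, so the next group up,
      having its commutators there, acts by commuting matrices.\<close>
    have Z1: "\<rho> z = 1\<^sub>m n" if "z \<in> Z" for z
      by (rule trivial_if_char_trivial[OF \<rho> Z v(1,2) _ that]) (use v(3) ZA True in auto)
    have "\<rho> a * \<rho> b = \<rho> b * \<rho> a" if "a \<in> P" "b \<in> P" for a b
      using commute[of a b] that in_carrier Z1 P_comm by simp
    then obtain v \<psi> where v: "v \<in> carrier_vec n" "v \<noteq> 0\<^sub>v n" "\<And>b. b \<in> P \<Longrightarrow> \<rho> b *\<^sub>v v = \<psi> b \<cdot>\<^sub>v v"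
      and \<psi>: "linear_char G P \<psi>" using char_of_commuting[OF r n subgroups(3)] by metis
    show ?thesis
    proof (cases "\<forall>z\<in>P. \<psi> z = 1")
      case False
      then obtain w where w: "w \<in> P" "\<psi> w \<noteq> 1" by blast
      have "n = h" by (rule char_degree_free(2)[OF fin P index_P \<psi> free_P[OF \<psi> w] \<rho> v])
      then show ?thesis by simp
    next
      case True
      have P1: "\<rho> z = 1\<^sub>m n" if "z \<in> P" for z
        by (rule trivial_if_char_trivial[OF \<rho> P v(1,2) _ that]) (use v(3) True in auto)
      have "\<rho> a * \<rho> b = \<rho> b * \<rho> a" if "a \<in> K" "b \<in> K" for a b
        using commute[of a b] that in_carrier P1 K_comm by simp
      then obtain v \<psi> where v: "v \<in> carrier_vec n" "v \<noteq> 0\<^sub>v n" "\<And>b. b \<in> K \<Longrightarrow> \<rho> b *\<^sub>v v = \<psi> b \<cdot>\<^sub>v v"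
        and \<psi>: "linear_char G K \<psi>" using char_of_commuting[OF r n subgroups(5)] by metis
      show ?thesis
      proof (cases "\<exists>g\<in>carrier G. \<exists>a\<in>K. \<psi> (inv g \<otimes> a \<otimes> g) \<noteq> \<psi> a")
        case True
        then obtain g a where ga: "g \<in> carrier G" "a \<in> K" "\<psi> (inv g \<otimes> a \<otimes> g) \<noteq> \<psi> a" by blast
        have "n = q" by (rule char_degree_free(2)[OF fin K index_K \<psi> free_K[OF \<psi> ga] \<rho> v])
        then show ?thesis by simp
      next
        case False
        \<comment> \<open>An invariant character on K forces K to act by scalars.\<close>
        then have K1: "\<rho> a = \<psi> a \<cdot>\<^sub>m 1\<^sub>m n" if "a \<in> K" for a
          using irreducible_scalar_on_normal[OF \<rho> K v _ that] by blast
        have Kc: "\<rho> a * \<rho> g = \<rho> g * \<rho> a" if "a \<in> K" "g \<in> carrier G" for a g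
          using K1[OF that(1)] is_repD(1)[OF r that(2)]
            mult_smult_distrib[of "\<rho> g" n n "1\<^sub>m n" n "\<psi> a"]
            mult_smult_assoc_mat[of "1\<^sub>m n" n n "\<rho> g" n "\<psi> a"] by simp
        have comm: "\<rho> a * \<rho> b = \<rho> b * \<rho> a" if ab: "a \<in> carrier G" "b \<in> carrier G" for a b
        proof (cases "a \<in> K")
          case True
          then show ?thesis using Kc ab(2) by blast
        next
          case False
          \<comment> \<open>The elements whose matrices commute with \<open>\<rho> a\<close> include
            the scalars from K and also a, which is outside K; prime index leaves only S =
            G.\<close>
          define S where "S = {g \<in> carrier G. \<rho> a * \<rho> g = \<rho> g * \<rho> a}"
          have c: "\<rho> x \<in> carrier_mat n n" if "x \<in> carrier G" for x using is_repD(1)[OF r that] .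
          have "subgroup S G"
          proof (rule subgroupI)
            show "S \<noteq> {}" using ab by (auto simp: S_def)
            show "x \<otimes> y \<in> S" if "x \<in> S" "y \<in> S" for x y
            proof -
              have xy: "x \<in> carrier G" "\<rho> a * \<rho> x = \<rho> x * \<rho> a" "y \<in> carrier G" "\<rho> a * \<rho> y = \<rho> y * \<rho> a"
                using that by (auto simp: S_def)
              have cc: "\<rho> x \<in> carrier_mat n n" "\<rho> y \<in> carrier_mat n n" "\<rho> a \<in> carrier_mat n n"
                using c xy ab by auto
              have "\<rho> a * (\<rho> x * \<rho> y) = (\<rho> a * \<rho> x) * \<rho> y"
                using assoc_mult_mat[OF cc(3,1,2)] by simp
              also have "\<dots> = \<rho> x * (\<rho> a * \<rho> y)" using assoc_mult_mat[OF cc(1,3,2)] xy by simp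
              also have "\<dots> = \<rho> x * \<rho> y * \<rho> a" using assoc_mult_mat[OF cc(1,2,3)] xy(4) by simp
              finally show ?thesis using xy is_repD(2)[OF r] by (simp add: S_def)
            qed
            show "inv x \<in> S" if x: "x \<in> S" for x
            proof -
              have xc: "x \<in> carrier G" "\<rho> a * \<rho> x = \<rho> x * \<rho> a" using x by (auto simp: S_def)
              have i: "\<rho> (inv x) * \<rho> x = 1\<^sub>m n" "\<rho> x * \<rho> (inv x) = 1\<^sub>m n"
                using is_repD(2)[OF r, of "inv x" x] is_repD(2)[OF r, of x "inv x"] is_repD(3)[OF r] xc
                by (auto simp: l_inv)
              let ?y = "\<rho> (inv x)"
              have cc: "?y \<in> carrier_mat n n" "\<rho> x \<in> carrier_mat n n" "\<rho> a \<in> carrier_mat n n"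
                using c xc ab by auto
              have "?y * \<rho> a = ?y * \<rho> a * (\<rho> x * ?y)" using i cc by simp
              also have "\<dots> = ?y * (\<rho> a * \<rho> x) * ?y" using cc by (simp add: assoc_mult_mat[of _ n n _ n _ n])
              also have "\<dots> = ?y * (\<rho> x * \<rho> a) * ?y" using xc by simp
              also have "\<dots> = (?y * \<rho> x) * (\<rho> a * ?y)" using cc by (simp add: assoc_mult_mat[of _ n n _ n _ n])
              also have "\<dots> = \<rho> a * ?y" using i cc by simp
              finally show ?thesis using xc by (simp add: S_def)
            qed
          qed (auto simp: S_def)
          moreover have "K \<subseteq> S" using Kc[OF _ ab(1)] in_carrier by (force simp: S_def)
          moreover have "a \<in> S" using ab by (simp add: S_def)
          ultimately have "S = carrier G"
            using subgroup_above_prime_index[OF fin subgroups(5) _ _ q index_K] False by blast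
          then show ?thesis using ab by (auto simp: S_def)
        qed
        obtain v \<psi> where v: "v \<in> carrier_vec n" "v \<noteq> 0\<^sub>v n"
            "\<And>b. b \<in> carrier G \<Longrightarrow> \<rho> b *\<^sub>v v = \<psi> b \<cdot>\<^sub>v v"
          and \<psi>: "linear_char G (carrier G) \<psi>"
          using char_of_commuting[OF r n subgroup_self comm] by metis
        have G: "carrier G \<lhd> G" by (intro normal_invI subgroup_self) auto
        \<comment> \<open>The criterion is applied to the whole group, of index 1, where freeness is
          vacuous.\<close>
        have "n = 1"
          by (rule char_degree_free(2)[OF fin G _ \<psi> _ \<rho> v]) auto
        then show ?thesis by simp
      qed
    qed
  qed
qed

theorem char_degrees_eq: "char_degrees G = {1, q, h, e * h}"
  using degrees_exist degree_cases by (auto simp: char_degrees_def)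

section \<open>Derived length\<close>

lemma derived_subset:
  assumes "\<And>a b. a \<in> H \<Longrightarrow> b \<in> H \<Longrightarrow> cm a b \<in> N" "subgroup N G"
  shows "derived G H \<subseteq> N"
  unfolding derived_def using assms by (intro generate_subgroup_incl) (auto simp: cm_def)

lemma cm_mem_derived: "a \<in> H \<Longrightarrow> b \<in> H \<Longrightarrow> cm a b \<in> derived G H"
  unfolding derived_def cm_def by (intro generate.incl) auto

lemma derived_series_trivial: "(derived G ^^ 4) (carrier G) = {\<one>}"
proof -
  have 1: "derived G (carrier G) \<subseteq> K" using derived_subset G_comm subgroups by blast
  have 2: "derived G (derived G (carrier G)) \<subseteq> P"
    by (rule derived_subset[OF _ subgroups(3)]) (use 1 K_comm in blast)
  have 3: "derived G (derived G (derived G (carrier G))) \<subseteq> Z"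
    by (rule derived_subset[OF _ subgroups(1)]) (use 2 P_comm in blast)
  have "derived G (derived G (derived G (derived G (carrier G)))) \<subseteq> {\<one>}"
  proof (rule derived_subset[OF _ triv_subgroup])
    fix a b assume "a \<in> derived G (derived G (derived G (carrier G)))"
      "b \<in> derived G (derived G (derived G (carrier G)))"
    then have "a \<in> Z" "b \<in> P" using 3 incl by auto
    then show "cm a b \<in> {\<one>}" using cm_eq_oneI[OF in_carrier(1,3) Z_central] by blast
  qed
  moreover have "\<one> \<in> derived G X" for X by (simp add: derived_def generate.one)
  ultimately have "derived G (derived G (derived G (derived G (carrier G)))) = {\<one>}" by blast
  then show ?thesis by (simp add: eval_nat_numeral)
qed

text \<open>Each inclusion comes from commutators with one fixed element: g outside K for the first,
  a commutator outside P for the second, and an element of P outside A for the third.\<close>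

lemma derived_series_lower:
  "P \<subseteq> derived G (carrier G)" "P \<subseteq> (derived G ^^ 2) (carrier G)"
  "Z \<subseteq> (derived G ^^ 3) (carrier G)"
proof -
  obtain g where g: "g \<in> carrier G" "g \<notin> K" using K_proper by blast
  obtain u where u: "u \<in> Q" "u \<notin> P" using P_proper by blast
  obtain x where x: "x \<in> P" "x \<notin> A" using A_proper by blast
  have gP: "g \<in> carrier G - P" using g PQ QK by blast
  show 1: "P \<subseteq> derived G (carrier G)"
  proof
    fix w assume "w \<in> P"
    then obtain u where "u \<in> P" "cm g u = w" using P_surj[OF gP] by blast
    then show "w \<in> derived G (carrier G)" using cm_mem_derived[of g "carrier G" u] g in_carrier by auto
  qed
  \<comment> \<open>This commutator lies in the derived subgroup but not in P, so it still acts
    freely on P and reproduces P one step further down.\<close>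
  have c: "cm g u \<in> derived G (carrier G)" "cm g u \<in> carrier G - P"
    using cm_mem_derived[of g "carrier G" u] g u in_carrier Q_free[of g u] by auto
  have 2: "P \<subseteq> derived G (derived G (carrier G))"
  proof
    fix w assume "w \<in> P"
    then obtain y where "y \<in> P" "cm (cm g u) y = w" using P_surj[OF c(2)] by blast
    then show "w \<in> derived G (derived G (carrier G))"
      using cm_mem_derived[OF c(1), of y] 1 by auto
  qed
  have "Z \<subseteq> derived G (derived G (derived G (carrier G)))"
  proof
    fix z assume "z \<in> Z"
    then obtain b where "b \<in> A" "cm x b = z" using pairing x by blast
    then show "z \<in> derived G (derived G (derived G (carrier G)))"
      using cm_mem_derived[of x _ b] x 2 AP by blast
  qed
  then show "P \<subseteq> (derived G ^^ 2) (carrier G)" "Z \<subseteq> (derived G ^^ 3) (carrier G)"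
    using 2 by (simp_all add: eval_nat_numeral)
qed

theorem solvable: "solvable G"
  unfolding solvable_def
  using trivial_derived_seq_imp_solvable[OF subgroup_self derived_series_trivial] .

theorem derived_length_eq: "derived_length G = 4"
  unfolding derived_length_def
proof (rule Least_equality)
  show "(derived G ^^ 4) (carrier G) = {\<one>}" by (rule derived_series_trivial)
  fix m assume m: "(derived G ^^ m) (carrier G) = {\<one>}"
  obtain z where z: "z \<in> Z" "z \<noteq> \<one>" using Z_nontrivial by blast
  have "Z \<subseteq> P" using ZA AP by blast
  then have lt: "z \<in> (derived G ^^ m) (carrier G)" if "m < 4"
    using that derived_series_lower z in_carrier(1) by (auto simp: less_Suc_eq numeral_eq_Suc)
  show "4 \<le> m"
  proof (rule ccontr)
    assume "\<not> 4 \<le> m"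
    then have "z \<in> {\<one>}" using lt m by simp
    with z show False by simp
  qed
qed

section \<open>Fitting series\<close>

lemma lower_central_mono_cm:
  "a \<in> lower_central G N k \<Longrightarrow> b \<in> N \<Longrightarrow> cm a b \<in> lower_central G N (Suc k)"
  by (auto simp: commutator_subgroup_def cm_def intro!: generate.incl)

lemma lower_central_subset:
  assumes "\<And>a b. a \<in> lower_central G N k \<Longrightarrow> b \<in> N \<Longrightarrow> cm a b \<in> M" "subgroup M G"
  shows "lower_central G N (Suc k) \<subseteq> M"
proof -
  have "{a \<otimes> b \<otimes> inv a \<otimes> inv b | a b. a \<in> lower_central G N k \<and> b \<in> N} \<subseteq> M"
    using assms(1) by (auto simp: cm_def)
  then show ?thesis
    using generate_subgroup_incl[OF _ assms(2)] by (simp add: commutator_subgroup_def)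
qed

lemma fitting_step_eq:
  assumes T: "T \<lhd> G" "M \<subseteq> T" "nilpotent_mod G T M"
    and max: "\<And>N. N \<lhd> G \<Longrightarrow> M \<subseteq> N \<Longrightarrow> nilpotent_mod G N M \<Longrightarrow> N \<subseteq> T"
  shows "fitting_step G M = T"
proof -
  have U: "\<Union>{N. N \<lhd> G \<and> M \<subseteq> N \<and> nilpotent_mod G N M} = T" using T max by blast
  show ?thesis
    unfolding fitting_step_def U
    using generate_subgroup_incl[OF order_refl normal_imp_subgroup[OF T(1)]]
    by (auto intro: generate.incl)
qed

lemma fitting_1: "fitting_step G {\<one>} = P"
proof (rule fitting_step_eq[OF P])
  show "{\<one>} \<subseteq> P" using one_mem by simp
  have l: "lower_central G P (Suc 0) \<subseteq> Z"
    using P_comm subgroups by (intro lower_central_subset) auto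
  have "lower_central G P (Suc (Suc 0)) \<subseteq> {\<one>}"
  proof (rule lower_central_subset[OF _ triv_subgroup])
    fix a b assume "a \<in> lower_central G P (Suc 0)" "b \<in> P"
    then show "cm a b \<in> {\<one>}" using l cm_eq_oneI[OF in_carrier(1,3) Z_central] by blast
  qed
  then show "nilpotent_mod G P {\<one>}" unfolding nilpotent_mod_def by blast
  fix N assume N: "N \<lhd> G" "{\<one>} \<subseteq> N" "nilpotent_mod G N {\<one>}"
  show "N \<subseteq> P"
  proof
    fix g assume g: "g \<in> N"
    show "g \<in> P"
    proof (rule ccontr)
      assume gP: "g \<notin> P"
      have gc: "g \<in> carrier G - P"
        using g gP subgroup.mem_carrier[OF normal_imp_subgroup[OF N(1)]] by blast
      \<comment> \<open>A normal subgroup with an element g outside P contains all commutators of g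
        with P, which already exhaust P; the same argument keeps P in every later term.\<close>
      have "P \<subseteq> lower_central G N k" for k
      proof (induction k)
        case 0
        show ?case
        proof
          fix w assume "w \<in> P"
          then obtain u where "u \<in> P" "cm g u = w" using P_surj[OF gc] by blast
          then show "w \<in> lower_central G N 0" using cm_normal(2)[OF N(1) _ g, of u] in_carrier by auto
        qed
      next
        case (Suc k)
        show ?case
        proof
          fix w assume w: "w \<in> P"
          \<comment> \<open>The lower central series has its factors in the order
            \<open>cm u g\<close>, the inverse of \<open>cm g u\<close>.\<close>
          then have "inv w \<in> P" using subgroup.m_inv_closed[OF subgroups(3)] by blast
          then obtain u where u: "u \<in> P" "cm g u = inv w" using P_surj[OF gc] by blast
          then have "cm u g = w" using inv_cm[of g u] gc w in_carrier by simp
          then show "w \<in> lower_central G N (Suc k)"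
            using lower_central_mono_cm[of u N k g] u Suc g by blast
        qed
      qed
      then have "P \<subseteq> {\<one>}" using N(3) unfolding nilpotent_mod_def by blast
      then show False using A_proper one_mem by blast
    qed
  qed
qed

lemma fitting_2: "fitting_step G P = K"
proof (rule fitting_step_eq[OF K])
  show "P \<subseteq> K" using PQ QK by simp
  have "lower_central G K (Suc 0) \<subseteq> P"
    using K_comm subgroups by (intro lower_central_subset) auto
  then show "nilpotent_mod G K P" unfolding nilpotent_mod_def by blast
  fix N assume N: "N \<lhd> G" "P \<subseteq> N" "nilpotent_mod G N P"
  show "N \<subseteq> K"
  proof
    fix g assume g: "g \<in> N"
    show "g \<in> K"
    proof (rule ccontr)
      assume gK: "g \<notin> K"
      have gc: "g \<in> carrier G - K"
        using g gK subgroup.mem_carrier[OF normal_imp_subgroup[OF N(1)]] by blast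
      \<comment> \<open>Commutation with g never moves an element of Q outside P into P, so no term
        of the lower central series of N can fall into P.\<close>
      have step: "cm u g \<in> Q \<and> cm u g \<notin> P" if u: "u \<in> Q" "u \<notin> P" for u
      proof -
        have c: "cm g u \<in> Q" "cm g u \<notin> P" using cm_normal(1)[OF Q _ u(1)] Q_free[OF gc u(1)] gc u by auto
        have "inv (cm u g) = cm g u" using inv_cm[of u g] u gc in_carrier by simp
        then show ?thesis
          using c cm_normal(2)[OF Q _ u(1)] gc subgroup.m_inv_closed[OF subgroups(3), of "cm u g"] by auto
      qed
      have "\<exists>u. u \<in> lower_central G N k \<and> u \<in> Q \<and> u \<notin> P" for k
      proof (induction k)
        case 0
        obtain u where u: "u \<in> Q" "u \<notin> P" using P_proper by blast
        have "cm u g \<in> N" using cm_normal(1)[OF N(1) _ g] u in_carrier by blast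
        then show ?case using step[OF u] by auto
      next
        case (Suc k)
        then obtain u where "u \<in> lower_central G N k" "u \<in> Q" "u \<notin> P" by blast
        then show ?case using step lower_central_mono_cm[of u N k g] g by blast
      qed
      then show False using N(3) unfolding nilpotent_mod_def by blast
    qed
  qed
qed

lemma fitting_3: "fitting_step G K = carrier G"
proof (rule fitting_step_eq)
  show "carrier G \<lhd> G" by (intro normal_invI subgroup_self) auto
  have "lower_central G (carrier G) (Suc 0) \<subseteq> K"
    using G_comm subgroups by (intro lower_central_subset) auto
  then show "nilpotent_mod G (carrier G) K" unfolding nilpotent_mod_def by blast
qed (use in_carrier subgroup.subset[OF normal_imp_subgroup] in blast)+

theorem fitting_height_eq: "fitting_height G = 3"
  unfolding fitting_height_def
proof (rule Least_equality)
  show "fitting_series G 3 = carrier G"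
    by (simp add: numeral_3_eq_3 fitting_1 fitting_2 fitting_3)
  fix m assume m: "fitting_series G m = carrier G"
  obtain g where g: "g \<in> carrier G" "g \<notin> K" using K_proper by blast
  then have "g \<notin> P" "g \<noteq> \<one>" using incl one_mem by auto
  with g have "P \<noteq> carrier G" "K \<noteq> carrier G" "{\<one>} \<noteq> carrier G" by auto
  moreover have "fitting_series G 0 = {\<one>}" "fitting_series G 1 = P" "fitting_series G 2 = K"
    by (simp_all add: numeral_2_eq_2 fitting_1 fitting_2)
  ultimately have "m \<noteq> 0" "m \<noteq> 1" "m \<noteq> 2" using m by metis+
  then show "3 \<le> m" by linarith
qed

end

section \<open>The field with \<open>p\<^sup>q\<close> elements as a Kummer extension\<close>

text \<open>The fibres of f are the residue classes and its values are their names, so a quotient of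
  a polynomial ring can have its carrier in another type. \<open>inv_into\<close> picks a
  representative of a class; \<open>ring_congruence\<close> makes the choice immaterial.\<close>

definition image_comm_ring :: "('r::comm_ring_1 \<Rightarrow> 'b) \<Rightarrow> 'b ring" where
  "image_comm_ring f = \<lparr>carrier = range f, monoid.mult = (\<lambda>x y. f (inv_into UNIV f x * inv_into UNIV f y)), one = f 1,
     ring.zero = f 0, add = (\<lambda>x y. f (inv_into UNIV f x + inv_into UNIV f y))\<rparr>"

locale ring_congruence =
  fixes f :: "'r::comm_ring_1 \<Rightarrow> 'b"
  assumes cong_add: "f u = f u' \<Longrightarrow> f v = f v' \<Longrightarrow> f (u + v) = f (u' + v')"
    and cong_mult: "f u = f u' \<Longrightarrow> f v = f v' \<Longrightarrow> f (u * v) = f (u' * v')"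
begin

lemma image_simps:
  "carrier (image_comm_ring f) = range f"
  "\<one>\<^bsub>image_comm_ring f\<^esub> = f 1" "\<zero>\<^bsub>image_comm_ring f\<^esub> = f 0"
  "f u \<otimes>\<^bsub>image_comm_ring f\<^esub> f v = f (u * v)" "f u \<oplus>\<^bsub>image_comm_ring f\<^esub> f v = f (u + v)"
  unfolding image_comm_ring_def
  by (auto intro: cong_add cong_mult simp: f_inv_into_f)

lemma image_pow: "f u [^]\<^bsub>image_comm_ring f\<^esub> (n::nat) = f (u ^ n)"
proof (induction n)
  case 0
  then show ?case by (simp add: image_comm_ring_def nat_pow_def)
next
  case (Suc n)
  have "f u [^]\<^bsub>image_comm_ring f\<^esub> Suc n = f u [^]\<^bsub>image_comm_ring f\<^esub> n \<otimes>\<^bsub>image_comm_ring f\<^esub> f u"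
    by (simp add: nat_pow_def)
  then show ?case using Suc by (simp add: image_simps mult.commute)
qed

lemma image_cring: "cring (image_comm_ring f)"
proof (intro cringI abelian_groupI comm_monoidI)
  show "\<exists>y\<in>carrier (image_comm_ring f). y \<oplus>\<^bsub>image_comm_ring f\<^esub> x = \<zero>\<^bsub>image_comm_ring f\<^esub>"
    if x: "x \<in> carrier (image_comm_ring f)" for x
  proof -
    obtain u where "x = f u" using x unfolding image_simps by blast
    then show ?thesis by (intro bexI[of _ "f (- u)"]) (auto simp: image_simps)
  qed
qed (auto simp: image_simps algebra_simps)

lemma image_field:
  assumes "f 0 \<noteq> f 1" and inv: "\<And>u. f u \<noteq> f 0 \<Longrightarrow> \<exists>v. f (u * v) = f 1"
  shows "field (image_comm_ring f)"
proof -
  interpret cring "image_comm_ring f" by (rule image_cring)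
  show ?thesis
  proof (rule cring_fieldI)
    show "Units (image_comm_ring f) = carrier (image_comm_ring f) - {\<zero>\<^bsub>image_comm_ring f\<^esub>}"
    proof (intro equalityI subsetI)
      fix x assume x: "x \<in> Units (image_comm_ring f)"
      then obtain y where "x \<in> carrier (image_comm_ring f)" "y \<in> carrier (image_comm_ring f)"
        "x \<otimes>\<^bsub>image_comm_ring f\<^esub> y = \<one>\<^bsub>image_comm_ring f\<^esub>" by (auto simp: Units_def)
      moreover from this have "x \<noteq> \<zero>\<^bsub>image_comm_ring f\<^esub>" using assms(1) by (auto simp: image_simps)
      ultimately show "x \<in> carrier (image_comm_ring f) - {\<zero>\<^bsub>image_comm_ring f\<^esub>}" by simp
    next
      fix x assume "x \<in> carrier (image_comm_ring f) - {\<zero>\<^bsub>image_comm_ring f\<^esub>}"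
      then obtain u where u: "x = f u" "f u \<noteq> f 0" unfolding image_simps by blast
      then obtain v where "f (u * v) = f 1" using inv by blast
      then show "x \<in> Units (image_comm_ring f)" using u
        by (auto simp: Units_def image_simps mult.commute intro!: exI[of _ v])
    qed
  qed
qed

end

text \<open>The middle binomial coefficients are multiples of p. It is stated before passing to a
  quotient, hence as a divisibility.\<close>

lemma prime_dvd_add_power:
  fixes u v :: "'a::comm_ring_1"
  assumes "prime p"
  shows "of_nat p dvd (u + v) ^ p - u ^ p - v ^ p"
proof -
  have p: "p > 0" using assms prime_gt_0_nat by blast
  have "(u + v) ^ p = (\<Sum>k\<le>p. of_nat (p choose k) * u ^ k * v ^ (p - k))" by (rule binomial_ring)
  also have "{..p} = insert 0 (insert p {0<..<p})" using p by auto
  also have "(\<Sum>k\<in>\<dots>. of_nat (p choose k) * u ^ k * v ^ (p - k)) =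
      v ^ p + (u ^ p + (\<Sum>k\<in>{0<..<p}. of_nat (p choose k) * u ^ k * v ^ (p - k)))"
    using p by (subst sum.insert; simp)+
  finally have e: "(u + v) ^ p - u ^ p - v ^ p = (\<Sum>k\<in>{0<..<p}. of_nat (p choose k) * u ^ k * v ^ (p - k))"
    by simp
  have "(of_nat p :: 'a) dvd of_nat (p choose k) * u ^ k * v ^ (p - k)" if "k \<in> {0<..<p}" for k
  proof -
    have "p dvd (p choose k)" using that assms by (intro dvd_choose_prime) auto
    then have "(of_nat p :: 'a) dvd of_nat (p choose k)" by (metis dvd_def of_nat_mult)
    then show ?thesis by (simp add: mult.assoc)
  qed
  then show ?thesis unfolding e by (rule dvd_sum)
qed

definition ideal_set :: "'r::comm_ring_1 set \<Rightarrow> bool" where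
  "ideal_set M \<longleftrightarrow> 0 \<in> M \<and> (\<forall>u\<in>M. \<forall>v\<in>M. u + v \<in> M) \<and> (\<forall>r. \<forall>u\<in>M. r * u \<in> M)"

lemma ideal_setD:
  assumes "ideal_set M"
  shows "0 \<in> M" "u \<in> M \<Longrightarrow> v \<in> M \<Longrightarrow> u + v \<in> M" "u \<in> M \<Longrightarrow> r * u \<in> M" "u \<in> M \<Longrightarrow> u * r \<in> M"
    "u \<in> M \<Longrightarrow> - u \<in> M" "u \<in> M \<Longrightarrow> v \<in> M \<Longrightarrow> u - v \<in> M" "u - v \<in> M \<Longrightarrow> u \<in> M \<longleftrightarrow> v \<in> M"
proof -
  show *: "0 \<in> M" "\<And>u v. u \<in> M \<Longrightarrow> v \<in> M \<Longrightarrow> u + v \<in> M" "\<And>r u. u \<in> M \<Longrightarrow> r * u \<in> M"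
    using assms by (auto simp: ideal_set_def)
  show "\<And>u r. u \<in> M \<Longrightarrow> u * r \<in> M" using *(3) by (metis mult.commute)
  show neg: "- u \<in> M" if "u \<in> M" for u using *(3)[OF that, of "- 1"] by simp
  show minus: "u - v \<in> M" if "u \<in> M" "v \<in> M" for u v
    using *(2)[OF that(1) neg[OF that(2)]] by simp
  show "u \<in> M \<longleftrightarrow> v \<in> M" if "u - v \<in> M" for u v
    using *(2)[OF that, of v] minus[OF _ that, of u] by auto
qed

section \<open>The ideal generated by p and X^q - a\<close>

locale kummer =
  fixes p q a :: nat
  assumes p: "prime p" and q: "prime q" and qp: "q dvd p - 1" and a: "residue_primroot p a"
begin

definition binom :: "int poly" where "binom = monom 1 q - [:int a:]"

text \<open>The quotient of Z[X] by J is F_p[X] / (X^q - a), the intended field. It is approached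
  through a maximal ideal above J, which later turns out to have p^q residue classes.\<close>

definition J :: "int poly set" where "J = {[:int p:] * u + binom * v | u v. True}"

text \<open>The reduced polynomials of degree below q, intended as representatives of the p^q
  residue classes.\<close>

definition S :: "int poly set" where
  "S = {s. (\<forall>i\<ge>q. coeff s i = 0) \<and> (\<forall>i. 0 \<le> coeff s i \<and> coeff s i < int p)}"

text \<open>A primitive \<open>q\<close>-th root of unity modulo \<open>p\<close>; the Frobenius map sends \<open>X\<close> to \<open>z X\<close> since
  \<open>X\<^sup>p = X (X\<^sup>q)\<^bsup>(p-1)/q\<^esup>\<close>.\<close>

definition z :: nat where "z = a ^ ((p - 1) div q)"

lemma p_gt_1: "p > 1" and q_gt_1: "q > 1" using p q prime_gt_1_nat by auto

lemma coprime_pa: "coprime p a" and ord_a: "ord p a = p - 1"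
  using a p by (auto simp: residue_primroot_def totient_prime)

lemma J_ideal: "ideal_set J"
  unfolding ideal_set_def
proof (intro conjI ballI allI)
  show "0 \<in> J" unfolding J_def by (auto intro!: exI[of _ 0])
  show "u + v \<in> J" if uv: "u \<in> J" "v \<in> J" for u v
  proof -
    obtain u1 u2 v1 v2 where "u = [:int p:] * u1 + binom * u2" "v = [:int p:] * v1 + binom * v2"
      using uv unfolding J_def by blast
    then have "u + v = [:int p:] * (u1 + v1) + binom * (u2 + v2)" by (simp only: ring_distribs ac_simps)
    then show ?thesis unfolding J_def by blast
  qed
  show "r * u \<in> J" if u: "u \<in> J" for r u
  proof -
    obtain u1 u2 where "u = [:int p:] * u1 + binom * u2" using u unfolding J_def by blast
    then have "r * u = [:int p:] * (r * u1) + binom * (r * u2)" by (simp only: ring_distribs ac_simps)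
    then show ?thesis unfolding J_def by blast
  qed
qed

lemma binom_eq: "binom = [:0, 1:] ^ q - [:int a:]"
  by (simp add: binom_def monom_altdef)

lemma p_mem_J: "[:int p:] * u \<in> J" and binom_mem_J: "binom * u \<in> J"
proof -
  have "[:int p:] * u + binom * 0 \<in> J" unfolding J_def by blast
  then show "[:int p:] * u \<in> J" by simp
  have "[:int p:] * 0 + binom * u \<in> J" unfolding J_def by blast
  then show "binom * u \<in> J" by simp
qed

lemma dvd_coeffs_mem_J:
  assumes "\<And>i. int p dvd coeff f i"
  shows "f \<in> J"
proof -
  have "[:int p:] dvd f" using assms by (simp add: const_poly_dvd_iff)
  then show ?thesis using p_mem_J by (auto elim!: dvdE)
qed

lemma coeff_binom: "coeff binom i = (if i = q then 1 else if i = 0 then - int a else 0)"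
  using q_gt_1 by (auto simp: binom_def coeff_pCons split: nat.splits)

lemma reduce_low_degree:
  assumes g: "\<forall>i\<ge>q. coeff g i = 0"
  shows "\<exists>s\<in>S. g - s \<in> J"
proof -
  define s where "s = Poly (map (\<lambda>i. coeff g i mod int p) [0..<q])"
  have cs: "coeff s i = coeff g i mod int p" for i
    using g by (cases "i < q") (auto simp: s_def nth_default_def)
  have "s \<in> S" using g p_gt_1 by (auto simp: S_def cs)
  moreover have "g - s \<in> J" by (intro dvd_coeffs_mem_J) (simp add: cs mod_eq_dvd_iff[symmetric])
  ultimately show ?thesis by blast
qed

lemma reduce: "\<exists>s\<in>S. f - s \<in> J"
proof (induction f rule: pCons_induct)
  case 0
  show ?case by (rule reduce_low_degree) simp
next
  case (pCons c f)
  then obtain s where s: "s \<in> S" "f - s \<in> J" by blast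
  let ?c = "[:coeff s (q - 1):]"
  \<comment> \<open>Multiplying s by X raises its degree to at most q; subtracting the top
    coefficient times \<open>binom\<close> brings it below q again.\<close>
  define g where "g = pCons c s - binom * ?c"
  have "\<forall>i\<ge>q. coeff g i = 0"
  proof (intro allI impI)
    fix i assume i: "i \<ge> q"
    then obtain j where j: "i = Suc j" using q_gt_1 by (cases i) auto
    have "coeff g i = coeff s j - coeff s (q - 1) * coeff binom i"
      unfolding g_def by (simp add: j coeff_pCons mult.commute[of binom])
    then show "coeff g i = 0" using i j s(1) q_gt_1 by (cases "i = q") (auto simp: coeff_binom S_def)
  qed
  then obtain s' where s': "s' \<in> S" "g - s' \<in> J" using reduce_low_degree by blast
  have "pCons c f - s' = [:0, 1:] * (f - s) + (binom * ?c + (g - s'))"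
    by (simp add: g_def algebra_simps)
  then show ?case using s' s(2) ideal_setD[OF J_ideal] binom_mem_J by metis
qed

text \<open>Let d be the highest degree at which the cofactor v of \<open>binom\<close> has a
  coefficient prime to p. Since \<open>binom\<close> is monic of degree q, the coefficient of
  \<open>binom * v\<close> at d + q is prime to p, whereas that of 1 is zero.\<close>

lemma one_notin_J: "1 \<notin> J"
proof
  assume "1 \<in> J"
  then obtain u v where uv: "1 = [:int p:] * u + binom * v" unfolding J_def by blast
  have c: "coeff (1 :: int poly) i = int p * coeff u i + coeff (binom * v) i" for i
    by (subst uv) simp
  have bv: "coeff (binom * v) i = (if i < q then 0 else coeff v (i - q)) - int a * coeff v i" for i
    by (simp add: binom_def left_diff_distrib coeff_monom_mult)
  have ex: "\<exists>i. \<not> int p dvd coeff v i"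
  proof (rule ccontr)
    assume "\<not> ?thesis"
    then have "int p dvd coeff (1 :: int poly) 0" unfolding c bv using q_gt_1 by auto
    then show False using p_gt_1 by simp
  qed
  have fin: "finite {i. \<not> int p dvd coeff v i}"
    by (rule finite_subset[of _ "{..degree v}"]) (auto intro: le_degree)
  define d where "d = Max {i. \<not> int p dvd coeff v i}"
  have d: "\<not> int p dvd coeff v d" using Max_in[OF fin] ex by (auto simp: d_def)
  have d': "int p dvd coeff v i" if "i > d" for i
    using Max_ge[OF fin, of i] that by (auto simp: d_def)
  have "0 = int p * coeff u (d + q) + (coeff v d - int a * coeff v (d + q))"
    using c[of "d + q"] bv[of "d + q"] q_gt_1 by simp
  moreover have "int p dvd coeff v (d + q)" using d' q_gt_1 by simp
  ultimately have "int p dvd coeff v d"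
    by (metis add_diff_cancel_left' diff_eq_diff_eq dvd_0_right dvd_add_right_iff dvd_diff_commute
        dvd_mult dvd_triv_left diff_add_cancel)
  with d show False by simp
qed

lemma S_card: "finite S" "card S = p ^ q"
proof -
  let ?F = "{..<q} \<rightarrow>\<^sub>E {0..<int p}"
  have b: "bij_betw (\<lambda>s. restrict (coeff s) {..<q}) S ?F"
  proof (rule bij_betw_byWitness[where f' = "\<lambda>c. Poly (map c [0..<q])"])
    show "\<forall>s\<in>S. Poly (map (restrict (coeff s) {..<q}) [0..<q]) = s"
      by (auto simp: S_def poly_eq_iff nth_default_def)
    show "\<forall>c\<in>?F. restrict (coeff (Poly (map c [0..<q]))) {..<q} = c"
      by (auto simp: fun_eq_iff nth_default_def PiE_def extensional_def)
    show "(\<lambda>s. restrict (coeff s) {..<q}) ` S \<subseteq> ?F"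
    proof (rule image_subsetI)
      fix s assume "s \<in> S"
      then show "restrict (coeff s) {..<q} \<in> ?F" unfolding restrict_PiE_iff by (auto simp: S_def)
    qed
    show "(\<lambda>c. Poly (map c [0..<q])) ` ?F \<subseteq> S"
      using p_gt_1 by (auto simp: S_def nth_default_def PiE_def Pi_def)
  qed
  show "finite S" using bij_betw_finite[OF b] by (simp add: finite_PiE)
  show "card S = p ^ q" using bij_betw_same_card[OF b] by (simp add: card_PiE)
qed

text \<open>An ideal above J is determined by its reduced elements, of which there are finitely
  many, so an ideal with the most reduced elements is maximal.\<close>

lemma maximal_exists:
  obtains M where "ideal_set M" "J \<subseteq> M" "1 \<notin> M"
    "\<And>I. ideal_set I \<Longrightarrow> M \<subseteq> I \<Longrightarrow> 1 \<notin> I \<Longrightarrow> I = M"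
proof -
  let ?P = "\<lambda>I. ideal_set I \<and> J \<subseteq> I \<and> 1 \<notin> I"
  have "?P J" using J_ideal one_notin_J by simp
  moreover have "\<forall>I. ?P I \<longrightarrow> card (I \<inter> S) < Suc (card S)"
    using S_card(1) by (auto intro!: le_imp_less_Suc card_mono)
  ultimately obtain M where M: "?P M" and max: "\<And>I. ?P I \<Longrightarrow> card (I \<inter> S) \<le> card (M \<inter> S)"
    using ex_has_greatest_nat[of ?P J "\<lambda>I. card (I \<inter> S)" "Suc (card S)"] by blast
  show ?thesis
  proof
    fix I assume I: "ideal_set I" "M \<subseteq> I" "1 \<notin> I"
    have "M \<inter> S = I \<inter> S"
      using I M max[of I] S_card(1) by (intro card_seteq) auto
    show "I = M"
    proof (intro equalityI subsetI)
      fix f assume f: "f \<in> I"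
      obtain s where s: "s \<in> S" "f - s \<in> J" using reduce by blast
      then have "f - s \<in> I" "f - s \<in> M" using I M by auto
      then have "s \<in> I \<inter> S" using ideal_setD(7)[OF I(1), of f s] f s by auto
      then have "s \<in> M" using \<open>M \<inter> S = I \<inter> S\<close> by auto
      then show "f \<in> M" using ideal_setD(7)[of M f s] \<open>f - s \<in> M\<close> M by auto
    qed (use I in auto)
  qed (use M in auto)
qed

end

section \<open>The residue field of a maximal ideal\<close>

locale kummer_maximal = kummer +
  fixes M :: "int poly set"
  assumes M: "ideal_set M" and JM: "J \<subseteq> M" and one: "1 \<notin> M"
    and maximal: "\<And>I. ideal_set I \<Longrightarrow> M \<subseteq> I \<Longrightarrow> 1 \<notin> I \<Longrightarrow> I = M"
begin

lemmas MD = ideal_setD[OF M]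

lemma inverse_mod: assumes "u \<notin> M" shows "\<exists>r. r * u - 1 \<in> M"
proof -
  let ?I = "{m + r * u | m r. m \<in> M}"
  have "ideal_set ?I"
    unfolding ideal_set_def
  proof (intro conjI ballI allI)
    show "0 \<in> ?I" using MD(1) by (auto intro!: exI[of _ 0])
    show "x + y \<in> ?I" if xy: "x \<in> ?I" "y \<in> ?I" for x y
    proof -
      obtain m r m' r' where "x = m + r * u" "y = m' + r' * u" "m \<in> M" "m' \<in> M" using xy by blast
      then have "x + y = (m + m') + (r + r') * u" "m + m' \<in> M" using MD(2) by (auto simp: algebra_simps)
      then show ?thesis by blast
    qed
    show "t * x \<in> ?I" if x: "x \<in> ?I" for t x
    proof -
      obtain m r where "x = m + r * u" "m \<in> M" using x by blast
      then have "t * x = t * m + (t * r) * u" "t * m \<in> M" using MD(3) by (auto simp: algebra_simps)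
      then show ?thesis by blast
    qed
  qed
  moreover have "M \<subseteq> ?I"
  proof
    fix m assume "m \<in> M"
    then have "m = m + 0 * u \<and> m \<in> M" by simp
    then show "m \<in> ?I" by blast
  qed
  moreover have "u \<in> ?I"
  proof -
    have "u = 0 + 1 * u \<and> 0 \<in> M" using MD(1) by simp
    then show ?thesis by blast
  qed
  ultimately have "1 \<in> ?I" using maximal assms by blast
  then obtain m r where "1 = m + r * u" "m \<in> M" by blast
  then have "r * u - 1 = - m" by (simp add: algebra_simps)
  then show ?thesis using MD(5) \<open>m \<in> M\<close> by metis
qed

lemma prime_M: assumes "u * v \<in> M" shows "u \<in> M \<or> v \<in> M"
proof (cases "u \<in> M")
  case False
  then obtain r where "r * u - 1 \<in> M" using inverse_mod by blast
  then have "r * (u * v) - v \<in> M" using MD(4)[of "r * u - 1" v] by (simp add: algebra_simps)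
  then show ?thesis using MD(7) MD(3)[OF assms] by blast
qed simp

lemma const_mem: "[:c:] \<in> M \<longleftrightarrow> int p dvd c"
proof
  assume "int p dvd c"
  then have "[:c:] \<in> J" by (intro dvd_coeffs_mem_J) (auto simp: coeff_pCons split: nat.splits)
  then show "[:c:] \<in> M" using JM by blast
next
  assume c: "[:c:] \<in> M"
  show "int p dvd c"
  proof (rule ccontr)
    assume "\<not> int p dvd c"
    then have "coprime (int p) c" using p by (simp add: prime_imp_coprime)
    then obtain x y where "x * int p + y * c = 1" by (metis bezout_int coprime_imp_gcd_eq_1)
    then have "[:x:] * [:int p:] + [:y:] * [:c:] = 1" by (simp add: one_pCons mult.commute)
    moreover have "[:int p:] \<in> M" using p_mem_J[of 1] JM by auto
    ultimately have "1 \<in> M" using MD(2,3) c by metis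
    with one show False by simp
  qed
qed

lemma X_notin: "[:0, 1:] \<notin> M"
proof
  assume "[:0, 1:] \<in> M"
  then have "[:0, 1:] * [:0, 1:] ^ (q - 1) \<in> M" by (rule MD(4))
  then have "[:0, 1:] ^ q \<in> M" using q_gt_1 by (simp flip: power_Suc)
  moreover have "[:0, 1:] ^ q - [:int a:] \<in> M" using binom_mem_J[of 1] JM by (auto simp: binom_eq)
  ultimately have "int p dvd int a" using MD(7) const_mem by blast
  then have "p dvd a" by simp
  then show False using coprime_pa p_gt_1 by (metis coprime_absorb_left nat_dvd_1_iff_1 nat_neq_iff)
qed

lemma X_pow_p: "[:0, 1:] ^ p - [:0, int z:] \<in> M"
proof -
  have pq: "p = Suc (q * ((p - 1) div q))" using qp p_gt_1 by simp
  let ?X = "[:0, 1:] :: int poly" and ?m = "(p - 1) div q"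
  have 1: "?X ^ q - [:int a:] \<in> M" using binom_mem_J[of 1] JM by (auto simp: binom_eq)
  have 2: "(?X ^ q) ^ m - [:int a:] ^ m \<in> M" for m
  proof (induction m)
    case (Suc m)
    have "(?X ^ q) ^ Suc m - [:int a:] ^ Suc m =
      ?X ^ q * ((?X ^ q) ^ m - [:int a:] ^ m) + (?X ^ q - [:int a:]) * [:int a:] ^ m"
      by (simp add: algebra_simps)
    then show ?case using MD(2)[OF MD(3)[OF Suc] MD(4)[OF 1]] by metis
  qed (simp add: MD(1))
  have "?X ^ p = ?X * (?X ^ q) ^ ?m" by (subst pq) (simp add: power_mult)
  moreover have "[:0, int z:] = ?X * [:int a:] ^ ?m" by (simp add: z_def poly_const_pow)
  ultimately have "?X ^ p - [:0, int z:] = ?X * ((?X ^ q) ^ ?m - [:int a:] ^ ?m)"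
    by (simp only: right_diff_distrib)
  then show ?thesis using MD(3)[OF 2] by metis
qed

lemma add_pow_p: "(u + v) ^ p - (u ^ p + v ^ p) \<in> M"
proof -
  have "of_nat p dvd (u + v) ^ p - u ^ p - v ^ p" by (rule prime_dvd_add_power[OF p])
  then obtain w where "(u + v) ^ p - u ^ p - v ^ p = of_nat p * w" by (elim dvdE)
  then have "(u + v) ^ p - (u ^ p + v ^ p) = [:int p:] * w"
    by (simp add: of_nat_poly diff_diff_eq)
  then show ?thesis using p_mem_J[of w] JM by auto
qed

lemma const_pow_p: "[:c:] ^ p - [:c:] \<in> M"
proof -
  have "[c ^ p = c] (mod int p)"
  proof (cases "int p dvd c")
    case True
    moreover have "c dvd c ^ p" using p_gt_1 by (intro dvd_power) auto
    ultimately have "int p dvd c ^ p" by (rule dvd_trans)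
    then show ?thesis using True unfolding cong_iff_dvd_diff by (rule dvd_diff)
  next
    case False
    define b where "b = nat (c mod int p)"
    have b: "int b = c mod int p" using p_gt_1 by (simp add: b_def)
    then have cb: "[c = int b] (mod int p)" by (simp add: cong_def)
    then have "\<not> int p dvd int b" using False cong_dvd_iff by blast
    then have "\<not> p dvd b" by simp
    then have "[b ^ (p - 1) = 1] (mod p)" using fermat_theorem p by blast
    then have "[int (b ^ (p - 1)) = int 1] (mod int p)" by (simp only: cong_int_iff)
    then have "[int b ^ (p - 1) = 1] (mod int p)" by simp
    then have "[c ^ (p - 1) = 1] (mod int p)" using cong_pow[OF cb] cong_trans by blast
    then have "[c * c ^ (p - 1) = c * 1] (mod int p)" by (rule cong_scalar_left)
    then show ?thesis using p_gt_1 by (simp flip: power_Suc)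
  qed
  then have "int p dvd c ^ p - c" by (simp add: cong_iff_dvd_diff)
  then have "[:c ^ p - c:] \<in> M" by (simp add: const_mem)
  then show ?thesis by (simp add: poly_const_pow)
qed

text \<open>Modulo M the p-th power map is additive and multiplicative, fixes constants and sends X
  to z X, so it is substitution of z X.\<close>

lemma frobenius_pcompose: "f ^ p - pcompose f [:0, int z:] \<in> M"
proof (induction f rule: pCons_induct)
  case 0
  show ?case using p_gt_1 MD(1) by (simp add: power_0_left)
next
  case (pCons c f)
  let ?X = "[:0, 1:] :: int poly" and ?Z = "[:0, int z:]"
  have e: "pCons c f = [:c:] + ?X * f" by simp
  have "(pCons c f) ^ p - ([:c:] ^ p + ?X ^ p * f ^ p) \<in> M"
    using add_pow_p[of "[:c:]" "?X * f"] by (simp only: e power_mult_distrib)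
  \<comment> \<open>The differences are grouped so that their sum with the previous one
    telescopes.\<close>
  moreover have "([:c:] ^ p - [:c:]) + (?X ^ p * (f ^ p - pcompose f ?Z) + (?X ^ p - ?Z) * pcompose f ?Z) \<in> M"
    using MD const_pow_p pCons X_pow_p by metis
  ultimately have "((pCons c f) ^ p - ([:c:] ^ p + ?X ^ p * f ^ p)) +
     (([:c:] ^ p - [:c:]) + (?X ^ p * (f ^ p - pcompose f ?Z) + (?X ^ p - ?Z) * pcompose f ?Z)) \<in> M"
    by (rule MD(2))
  moreover have "((pCons c f) ^ p - ([:c:] ^ p + ?X ^ p * f ^ p)) +
     (([:c:] ^ p - [:c:]) + (?X ^ p * (f ^ p - pcompose f ?Z) + (?X ^ p - ?Z) * pcompose f ?Z))
     = (pCons c f) ^ p - ([:c:] + ?Z * pcompose f ?Z)"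
    by (simp only: ring_distribs ac_simps)
  ultimately show ?case by (simp only: pcompose_pCons)
qed

text \<open>As a has order p - 1 modulo p, its power z has order q.\<close>

lemma z_pow_distinct:
  assumes "i < k" "k < q"
  shows "\<not> int p dvd int z ^ i - int z ^ k"
proof
  let ?m = "(p - 1) div q"
  assume "int p dvd int z ^ i - int z ^ k"
  then have "[int (z ^ i) = int (z ^ k)] (mod int p)" by (simp add: cong_iff_dvd_diff)
  then have "[z ^ i = z ^ k] (mod p)" by (simp only: cong_int_iff)
  then have "[a ^ (?m * i) = a ^ (?m * k)] (mod p)" by (simp add: z_def power_mult)
  then have "[?m * i = ?m * k] (mod (p - 1))"
    using order_divides_expdiff[OF coprime_pa] ord_a by metis
  moreover have pm: "p - 1 = ?m * q" using qp by simp
  ultimately have "(?m * q) dvd (?m * k - ?m * i)"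
    using assms by (metis cong_altdef_nat cong_sym less_imp_le mult_le_mono2)
  then have "(?m * q) dvd ?m * (k - i)" by (simp add: right_diff_distrib')
  moreover have "?m > 0" using pm p_gt_1 by (metis gr0I mult_0 zero_less_diff less_numeral_extra(3))
  ultimately have "q dvd k - i" by simp
  then show False using assms by (auto dest: dvd_imp_le)
qed

text \<open>The monomials \<open>1, X, \<dots>, X\<^bsup>q-1\<^esup>\<close> are eigenvectors of the Frobenius map for the distinct
  eigenvalues \<open>z\<^bsup>i\<^esup>\<close>, hence linearly independent modulo \<open>M\<close>.\<close>
lemma independent:
  assumes "f \<in> M" "\<And>i. i \<ge> k \<Longrightarrow> coeff f i = 0" "k \<le> q"
  shows "int p dvd coeff f i"
  using assms
proof (induction k arbitrary: f i)
  case 0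
  then show ?case by simp
next
  case (Suc k)
  let ?Z = "[:0, int z:]"
  have fp: "f ^ p \<in> M" using MD(4)[OF Suc.prems(1), of "f ^ (p - 1)"] p_gt_1 by (simp flip: power_Suc)
  then have "pcompose f ?Z \<in> M" using MD(7)[OF frobenius_pcompose[of f]] by simp
  moreover have "[:int z ^ k:] * f \<in> M" using MD(3)[OF Suc.prems(1)] .
  ultimately have g: "pcompose f ?Z - [:int z ^ k:] * f \<in> M" by (rule MD(6))
  have cg: "coeff (pcompose f ?Z - [:int z ^ k:] * f) j = (int z ^ j - int z ^ k) * coeff f j" for j
    by (simp add: coeff_pcompose_linear left_diff_distrib)
  have low: "int p dvd coeff f j" if j: "j < k" for j
  proof -
    have "int p dvd coeff (pcompose f ?Z - [:int z ^ k:] * f) j"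
    proof (rule Suc.IH[OF g])
      fix i assume "k \<le> i"
      then show "coeff (pcompose f ?Z - [:int z ^ k:] * f) i = 0"
        unfolding cg using Suc.prems(2)[of i] by (cases "i = k") auto
    qed (use Suc.prems in auto)
    then show ?thesis
      unfolding cg using z_pow_distinct[of j k] j Suc.prems(3) p by (simp add: prime_dvd_mult_iff)
  qed
  \<comment> \<open>Only the top monomial is left. M is prime and contains no power of X, so the
    coefficient itself lies in M.\<close>
  have "f - monom (coeff f k) k \<in> J"
  proof (rule dvd_coeffs_mem_J)
    fix i
    show "int p dvd coeff (f - monom (coeff f k) k) i"
      using low Suc.prems(2)[of i] by (cases i k rule: linorder_cases) auto
  qed
  then have "monom (coeff f k) k \<in> M" using MD(7) JM Suc.prems(1) by blast
  then have "[:coeff f k:] * [:0, 1:] ^ k \<in> M" by (simp add: monom_altdef)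
  moreover have "[:0, 1:] ^ j \<notin> M" for j
  proof (induction j)
    case (Suc j)
    then show ?case using prime_M[of "[:0, 1:]" "[:0, 1:] ^ j"] X_notin by (metis power_Suc)
  qed (use one in simp)
  ultimately have "[:coeff f k:] \<in> M" using prime_M by blast
  then have "int p dvd coeff f k" by (simp add: const_mem)
  then show ?case using low Suc.prems(2)[of i] by (cases i k rule: linorder_cases) auto
qed

lemma S_unique:
  assumes "s \<in> S" "s' \<in> S" "s - s' \<in> M"
  shows "s = s'"
proof (rule poly_eqI)
  fix i
  have "int p dvd coeff (s - s') i"
    by (rule independent[OF assms(3), of q]) (use assms in \<open>auto simp: S_def\<close>)
  then have "coeff s i mod int p = coeff s' i mod int p" by (simp add: mod_eq_dvd_iff)
  then show "coeff s i = coeff s' i" using assms by (simp add: S_def)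
qed

text \<open>Additivity of the p-th power is carried along because it is the form in which
  characteristic p enters the semilinear maps.\<close>

lemma field_exists:
  "\<exists>E :: nat ring. field E \<and> finite (carrier E) \<and> card (carrier E) = p ^ q \<and>
     (\<forall>x\<in>carrier E. \<forall>y\<in>carrier E. (x \<oplus>\<^bsub>E\<^esub> y) [^]\<^bsub>E\<^esub> p = x [^]\<^bsub>E\<^esub> p \<oplus>\<^bsub>E\<^esub> y [^]\<^bsub>E\<^esub> p)"
proof -
  \<comment> \<open>Numbers serve as names of the reduced polynomials; f below sends a polynomial to
    the name of its class modulo M.\<close>
  obtain e :: "int poly \<Rightarrow> nat" where e: "inj_on e S"
    using finite_imp_inj_to_nat_seg[OF S_card(1)] by blast
  have "\<forall>u. \<exists>s. s \<in> S \<and> u - s \<in> M" using reduce JM by blast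
  then obtain r where r: "\<And>u. r u \<in> S" "\<And>u. u - r u \<in> M" by metis
  define f where "f u = e (r u)" for u
  have f_eq: "f u = f v \<longleftrightarrow> u - v \<in> M" for u v
  proof -
    have "f u = f v \<longleftrightarrow> r u = r v" using e r(1) by (auto simp: f_def inj_on_def)
    also have "\<dots> \<longleftrightarrow> r u - r v \<in> M" using S_unique r(1) MD(1) by auto
    also have "\<dots> \<longleftrightarrow> u - v \<in> M"
    proof -
      have "(u - v) - (r u - r v) = (u - r u) - (v - r v)" by simp
      then have "(u - v) - (r u - r v) \<in> M" using MD(6)[OF r(2) r(2)] by metis
      then show ?thesis using MD(7) by blast
    qed
    finally show ?thesis .
  qed
  interpret ring_congruence f
  proof
    fix u u' v v' assume "f u = f u'" "f v = f v'"
    then have uv: "u - u' \<in> M" "v - v' \<in> M" by (simp_all add: f_eq)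
    have "(u + v) - (u' + v') = (u - u') + (v - v')" by simp
    then show "f (u + v) = f (u' + v')" using MD(2)[OF uv] f_eq by metis
    have "u * v - u' * v' = (u - u') * v + u' * (v - v')" by (simp add: algebra_simps)
    then show "f (u * v) = f (u' * v')" using MD(2)[OF MD(4)[OF uv(1)] MD(3)[OF uv(2)]] f_eq by metis
  qed
  have "field (image_comm_ring f)"
  proof (rule image_field)
    show "f 0 \<noteq> f 1" using one MD(5)[of "- 1"] by (auto simp: f_eq)
    show "\<exists>v. f (u * v) = f 1" if "f u \<noteq> f 0" for u
    proof -
      have "u \<notin> M" using that by (simp add: f_eq)
      then obtain r where "r * u - 1 \<in> M" using inverse_mod by blast
      then have "f (u * r) = f 1" unfolding f_eq by (simp only: mult.commute)
      then show ?thesis ..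
    qed
  qed
  moreover have "range f = e ` S"
  proof (intro equalityI subsetI)
    fix x assume "x \<in> e ` S"
    then obtain s where s: "s \<in> S" "x = e s" by blast
    have "r s = s" using S_unique[OF s(1) r(1) r(2)] by simp
    then have "x = f s" using s by (simp add: f_def)
    then show "x \<in> range f" by blast
  qed (use r in \<open>auto simp: f_def\<close>)
  then have "finite (range f)" "card (range f) = p ^ q" using S_card card_image[OF e] by simp_all
  moreover have "(x \<oplus>\<^bsub>image_comm_ring f\<^esub> y) [^]\<^bsub>image_comm_ring f\<^esub> p =
      x [^]\<^bsub>image_comm_ring f\<^esub> p \<oplus>\<^bsub>image_comm_ring f\<^esub> y [^]\<^bsub>image_comm_ring f\<^esub> p"
    if "x \<in> range f" "y \<in> range f" for x y
    using that add_pow_p by (auto simp: image_simps image_pow f_eq)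
  ultimately show ?thesis by (intro exI[of _ "image_comm_ring f"]) (auto simp: image_simps)
qed

end

lemma finite_field_exists:
  fixes p q :: nat
  assumes "prime p" "prime q" "q dvd p - 1" "p \<noteq> 2"
  obtains E :: "nat ring" where "field E" "finite (carrier E)" "card (carrier E) = p ^ q"
    "\<And>x y. x \<in> carrier E \<Longrightarrow> y \<in> carrier E \<Longrightarrow> (x \<oplus>\<^bsub>E\<^esub> y) [^]\<^bsub>E\<^esub> p = x [^]\<^bsub>E\<^esub> p \<oplus>\<^bsub>E\<^esub> y [^]\<^bsub>E\<^esub> p"
proof -
  obtain a where a: "residue_primroot p a"
    using prime_primitive_root_exists[of p] assms prime_gt_1_nat[of p] by auto
  interpret kummer p q a by (standard) (use assms a in auto)
  obtain M where M: "ideal_set M" "J \<subseteq> M" "1 \<notin> M"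
    "\<And>I. ideal_set I \<Longrightarrow> M \<subseteq> I \<Longrightarrow> 1 \<notin> I \<Longrightarrow> I = M" using maximal_exists by metis
  interpret kummer_maximal p q a M by standard (use M in auto)
  show ?thesis using field_exists that by blast
qed

section \<open>The quotient \<open>(p\<^sup>q - 1) / (p - 1)\<close>\<close>

lemma geometric_sum_nat: "(p - 1) * (\<Sum>t<q. p ^ t) = p ^ q - (1::nat)"
proof (cases "p = 0")
  case False
  then have "int ((p - 1) * (\<Sum>t<q. p ^ t)) = int (p ^ q - 1)"
    using power_diff_1_eq[of "int p" q] by (simp add: of_nat_diff)
  then show ?thesis by (simp only: of_nat_eq_iff)
qed (cases q; simp)

text \<open>The sum is q (q - 1) / 2, and q - 1 is even. Oddness of q enters the arithmetic of the
  geometric sum here.\<close>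

lemma sum_lt_odd: "odd q \<Longrightarrow> q dvd (\<Sum>t<q. t)" for q :: nat
proof -
  assume q: "odd q"
  then obtain k where k: "q = 2 * k + 1" by (elim oddE)
  have "2 * (\<Sum>t<q. t) = q * (q - 1)" by (induction q) (auto simp: algebra_simps diff_mult_distrib2)
  then have "2 * (\<Sum>t<q. t) = 2 * (q * k)" using k by simp
  then have "(\<Sum>t<q. t) = q * k" by simp
  then show ?thesis by simp
qed

lemma power_linear_mod_square:
  fixes x :: int
  shows "x\<^sup>2 dvd (1 + x) ^ t - 1 - of_nat t * x"
proof (induction t)
  case (Suc t)
  have "(1 + x) ^ Suc t - 1 - of_nat (Suc t) * x = (1 + x) * ((1 + x) ^ t - 1 - of_nat t * x) + x\<^sup>2 * of_nat t"
    by (simp add: algebra_simps power2_eq_square)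
  with Suc show ?case by simp
qed simp

text \<open>Write p = 1 + x with q dividing x. To first order the sum is q + x (0 + ... + (q - 1)),
  and both factors of the second term are multiples of q. Hence q divides the sum exactly
  once.\<close>

lemma geometric_sum_mod_square:
  fixes p q :: nat
  assumes p: "p > 0" and qp: "q dvd p - 1" and q: "odd q"
  shows "[(\<Sum>t<q. p ^ t) = q] (mod q\<^sup>2)"
proof -
  define x where "x = int p - 1"
  have px: "int p = 1 + x" by (simp add: x_def)
  have "x = int (p - 1)" using p by (simp add: x_def of_nat_diff)
  then have qx: "int q dvd x" using qp by (simp only: of_nat_dvd_iff)
  have "(int q)\<^sup>2 dvd (\<Sum>t<q. (1 + x) ^ t - 1 - of_nat t * x)"
    using power_linear_mod_square[of x] dvd_trans[OF dvd_power_same[OF qx]] by (intro dvd_sum) blast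
  moreover have "(\<Sum>t<q. (1 + x) ^ t - 1 - of_nat t * x) = (\<Sum>t<q. (1 + x) ^ t) - int q - int (\<Sum>t<q. t) * x"
    by (simp add: sum_subtractf sum_distrib_right)
  moreover have "(int q)\<^sup>2 dvd int (\<Sum>t<q. t) * x"
    using sum_lt_odd[OF q] qx unfolding power2_eq_square by (intro mult_dvd_mono) (simp_all only: of_nat_dvd_iff)
  ultimately have "(int q)\<^sup>2 dvd (\<Sum>t<q. (1 + x) ^ t) - int q"
    by (metis diff_add_cancel dvd_add)
  moreover have "int (\<Sum>t<q. p ^ t) = (\<Sum>t<q. (1 + x) ^ t)" by (simp add: px)
  ultimately have "[int (\<Sum>t<q. p ^ t) = int q] (mod int (q\<^sup>2))"
    by (simp add: cong_iff_dvd_diff)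
  then show ?thesis by (simp only: cong_int_iff)
qed

context
  fixes p q :: nat
  assumes p: "prime p" and q: "prime q" and odd: "odd q" and qp: "q dvd p - 1"
begin

definition "geo = (\<Sum>t<q. p ^ t)"

lemma p_gt_q: "p > q"
proof -
  have "p - 1 > 0" using p prime_gt_1_nat[of p] by simp
  then have "q \<le> p - 1" using qp by (intro dvd_imp_le)
  then show ?thesis using \<open>p - 1 > 0\<close> by simp
qed

lemma geo_mult: "(p - 1) * geo = p ^ q - 1" unfolding geo_def by (rule geometric_sum_nat)

lemma geo_div: "(p ^ q - 1) div (p - 1) = geo"
  using geo_mult p_gt_q q prime_gt_1_nat[of q] by (metis nonzero_mult_div_cancel_left zero_less_diff less_trans less_numeral_extra(3))

lemma geo_cong: "[geo = q] (mod q\<^sup>2)"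
  unfolding geo_def using geometric_sum_mod_square qp odd p_gt_q by simp

lemma q_dvd_geo: "q dvd geo"
proof -
  have "[geo = q] (mod q)" using geo_cong by (rule cong_dvd_modulus_nat) (simp add: power2_eq_square)
  then show ?thesis by (simp add: cong_dvd_iff)
qed

lemma not_q2_dvd_geo: "\<not> q\<^sup>2 dvd geo"
proof
  assume "q\<^sup>2 dvd geo"
  then have "q\<^sup>2 dvd q" using cong_dvd_iff[OF geo_cong] by simp
  then have "q * q \<le> q * 1" using q prime_gt_0_nat[of q] by (auto dest!: dvd_imp_le simp: power2_eq_square)
  then show False using q prime_gt_1_nat[of q] by simp
qed

lemma ppart_geo: "ppart q geo = q"
proof -
  have "multiplicity q geo = 1"
    using q_dvd_geo not_q2_dvd_geo by (intro multiplicity_eqI) (auto simp: power2_eq_square)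
  then show ?thesis by (simp add: ppart_def)
qed

definition "geo' = pprime_part q geo"

lemma geo_eq: "geo = q * geo'"
  using q_dvd_geo by (simp add: geo'_def pprime_part_def ppart_geo)

lemma not_q_dvd_geo': "\<not> q dvd geo'"
  using not_q2_dvd_geo by (auto simp: geo_eq power2_eq_square)

text \<open>The geometric sum is at least p, which exceeds q. This guarantees that Q is strictly
  larger than P.\<close>

lemma geo'_gt_1: "geo' > 1"
proof -
  have q1: "q > 1" using q by (rule prime_gt_1_nat)
  have "q < p ^ 1" using p_gt_q by simp
  also have "p ^ 1 \<le> (\<Sum>t<q. p ^ t)" by (rule member_le_sum) (use q1 in auto)
  finally have "q * 1 < q * geo'" unfolding geo_eq[symmetric] geo_def by simp
  then show ?thesis by (simp add: mult_less_cancel1)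
qed

text \<open>Here p must be odd, since q divides p - 1, and a sum of q odd numbers is odd. It serves
  to make n odd.\<close>

lemma odd_geo: "odd geo"
proof (cases "even p")
  case True
  then have "p = 2" using p primes_dvd_imp_eq two_is_prime_nat by blast
  then show ?thesis using qp q by (simp add: prime_nat_iff)
next
  case False
  have "odd (\<Sum>t<m. p ^ t) \<longleftrightarrow> odd m" for m using False by (induction m) auto
  then show ?thesis unfolding geo_def using odd by simp
qed

text \<open>For a common prime divisor r, the order of p modulo r divides both q and i, hence is 1.
  Then p = 1 modulo r makes the geometric sum congruent to q, so r = q, which does not divide
  \<open>geo'\<close>.\<close>

lemma coprime_geo':
  assumes i: "\<not> q dvd i"
  shows "coprime geo' (p ^ i - 1)"
proof (rule ccontr)
  assume "\<not> coprime geo' (p ^ i - 1)"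
  then have "gcd geo' (p ^ i - 1) \<noteq> 1" by (simp add: coprime_iff_gcd_eq_1)
  then obtain r where r: "prime r" "r dvd geo'" "r dvd p ^ i - 1"
    using prime_factor_nat[of "gcd geo' (p ^ i - 1)"] by auto
  have "r dvd geo" using r by (simp add: geo_eq)
  then have "r dvd p ^ q - 1" unfolding geo_mult[symmetric] by simp
  then have "[p ^ q = 1] (mod r)" "[p ^ i = 1] (mod r)"
    using r p_gt_q by (simp_all add: cong_altdef_nat Suc_leI)
  then have "ord r p dvd q" "ord r p dvd i" by (simp_all only: ord_divides)
  then have "ord r p = 1" using q i by (metis prime_nat_iff)
  then have "[p ^ 1 = 1] (mod r)" by (metis ord)
  then have pr: "[p = 1] (mod r)" by simp
  have "[(\<Sum>t<q. p ^ t) = (\<Sum>t<q. 1 ^ t)] (mod r)" by (intro cong_sum cong_pow pr)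
  then have "[geo = q] (mod r)" by (simp add: geo_def)
  then have "r dvd q" using \<open>r dvd geo\<close> by (simp add: cong_dvd_iff)
  then have "r = q" using r(1) q by (simp add: primes_dvd_imp_eq)
  then show False using r not_q_dvd_geo' by simp
qed

lemma ppart_facts: "ppart q (p - 1) dvd p - 1" "q dvd ppart q (p - 1)" "odd (ppart q (p - 1))"
proof -
  show "ppart q (p - 1) dvd p - 1" by (simp add: ppart_def multiplicity_dvd)
  have "multiplicity q (p - 1) > 0"
    using qp q p_gt_q prime_gt_1_nat[of q] by (intro multiplicity_gt_zero_iff[THEN iffD2]) auto
  then show "q dvd ppart q (p - 1)" by (simp add: ppart_def dvd_power)
  show "odd (ppart q (p - 1))" using odd by (simp add: ppart_def)
qed

end

section \<open>Semilinear maps\<close>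

text \<open>The group has to live on the naturals, so quadruples are coded by iterated pairing.\<close>

definition mk :: "nat \<Rightarrow> nat \<Rightarrow> nat \<Rightarrow> nat \<Rightarrow> nat" where
  "mk a b z i = prod_encode (a, prod_encode (b, prod_encode (z, i)))"
definition ca :: "nat \<Rightarrow> nat" where "ca x = fst (prod_decode x)"
definition cb :: "nat \<Rightarrow> nat" where "cb x = fst (prod_decode (snd (prod_decode x)))"
definition cz :: "nat \<Rightarrow> nat" where
  "cz x = fst (prod_decode (snd (prod_decode (snd (prod_decode x)))))"
definition ci :: "nat \<Rightarrow> nat" where
  "ci x = snd (prod_decode (snd (prod_decode (snd (prod_decode x)))))"

lemma coords_mk [simp]: "ca (mk a b z i) = a" "cb (mk a b z i) = b" "cz (mk a b z i) = z" "ci (mk a b z i) = i"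
  by (simp_all add: mk_def ca_def cb_def cz_def ci_def)

lemma coords_eqI: "ca x = ca y \<Longrightarrow> cb x = cb y \<Longrightarrow> cz x = cz y \<Longrightarrow> ci x = ci y \<Longrightarrow> x = y"
  unfolding ca_def cb_def cz_def ci_def
  by (metis prod.expand prod_decode_eq)

lemma mk_coords [simp]: "mk (ca x) (cb x) (cz x) (ci x) = x"
  by (rule coords_eqI) simp_all

lemma card_coords:
  "card {x. ca x \<in> X \<and> cb x \<in> Y \<and> cz x \<in> Z \<and> ci x \<in> I} = card X * (card Y * (card Z * card I))"
proof -
  have "bij_betw (\<lambda>x. (ca x, cb x, cz x, ci x)) {x. ca x \<in> X \<and> cb x \<in> Y \<and> cz x \<in> Z \<and> ci x \<in> I}
      (X \<times> Y \<times> Z \<times> I)"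
    by (rule bij_betw_byWitness[where f' = "\<lambda>(a, b, z, i). mk a b z i"])
      auto
  then show ?thesis by (simp add: bij_betw_same_card card_cartesian_product)
qed

lemma finite_coords:
  assumes "finite X" "finite Y" "finite Z" "finite I"
  shows "finite {x. ca x \<in> X \<and> cb x \<in> Y \<and> cz x \<in> Z \<and> ci x \<in> I}"
proof -
  have "{x. ca x \<in> X \<and> cb x \<in> Y \<and> cz x \<in> Z \<and> ci x \<in> I} \<subseteq> (\<lambda>(a, b, z, i). mk a b z i) ` (X \<times> Y \<times> Z \<times> I)"
  proof
    fix x assume "x \<in> {x. ca x \<in> X \<and> cb x \<in> Y \<and> cz x \<in> Z \<and> ci x \<in> I}"
    moreover have "x = (\<lambda>(a, b, z, i). mk a b z i) (ca x, cb x, cz x, ci x)" by simp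
    ultimately show "x \<in> (\<lambda>(a, b, z, i). mk a b z i) ` (X \<times> Y \<times> Z \<times> I)" by blast
  qed
  moreover have "finite ((\<lambda>(a, b, z, i). mk a b z i) ` (X \<times> Y \<times> Z \<times> I))" using assms by simp
  ultimately show ?thesis by (rule finite_subset)
qed

lemma (in monoid) group_of_right_inverses:
  assumes "\<And>x. x \<in> carrier G \<Longrightarrow> \<exists>y\<in>carrier G. x \<otimes> y = \<one>"
  shows "group G"
proof (rule groupI)
  fix x assume x: "x \<in> carrier G"
  then obtain y where y: "y \<in> carrier G" "x \<otimes> y = \<one>" using assms by blast
  then obtain w where w: "w \<in> carrier G" "y \<otimes> w = \<one>" using assms by blast
  have "x = x \<otimes> (y \<otimes> w)" using x w by simp
  also have "\<dots> = (x \<otimes> y) \<otimes> w" using x y(1) w(1) by (simp only: m_assoc)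
  also have "\<dots> = w" using y w by simp
  finally show "\<exists>y\<in>carrier G. y \<otimes> x = \<one>" using y w by blast
qed (auto simp: m_assoc)

text \<open>The conjugate y is described by \<open>y \<otimes> g = g \<otimes> x\<close>, so that
  normality can be checked in coordinates without a formula for inverses; closure under inverses
  follows from finiteness.\<close>

lemma (in group) normalI_finite:
  assumes fin: "finite (carrier G)" and N: "N \<subseteq> carrier G" and one: "\<one> \<in> N"
    and mult: "\<And>x y. x \<in> N \<Longrightarrow> y \<in> N \<Longrightarrow> x \<otimes> y \<in> N"
    and conj: "\<And>g x y. g \<in> carrier G \<Longrightarrow> x \<in> N \<Longrightarrow> y \<in> carrier G \<Longrightarrow> y \<otimes> g = g \<otimes> x \<Longrightarrow> y \<in> N"
  shows "N \<lhd> G"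
proof (rule normal_invI)
  show "subgroup N G"
  proof (rule subgroupI)
    show "inv x \<in> N" if x: "x \<in> N" for x
    proof -
      have xc: "x \<in> carrier G" using x N by blast
      have "x [^] k \<in> N" for k :: nat by (induction k) (auto simp: one mult x)
      moreover have "order G > 0" using fin order_gt_0_iff_finite by blast
      then have "x [^] (order G - 1) \<otimes> x = \<one>"
        using pow_order_eq_1[OF xc] by (metis Suc_diff_1 nat_pow_Suc)
      then have "inv x = x [^] (order G - 1)" using xc by (intro inv_equality) auto
      ultimately show ?thesis by simp
    qed
  qed (use N one mult in auto)
  fix g x assume gx: "g \<in> carrier G" "x \<in> N"
  then have "x \<in> carrier G" using N by blast
  then have "g \<otimes> x \<otimes> inv g \<in> carrier G" "g \<otimes> x \<otimes> inv g \<otimes> g = g \<otimes> x"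
    using gx(1) by (simp_all add: m_assoc)
  then show "g \<otimes> x \<otimes> inv g \<in> N" by (rule conj[OF gx])
qed

section \<open>The semilinear action\<close>

text \<open>\<open>cop\<close> is the source of the fixed-point-free action inside the complement,
  and \<open>odd_n\<close> makes the square of d have order n as well, as the action on the centre
  requires.\<close>

locale heisenberg_field = field E for E :: "nat ring" (structure) +
  fixes p q s m n :: nat and d :: nat
  assumes fin: "finite (carrier E)" and card_E: "card (carrier E) = p ^ q"
    and frob: "\<And>x y. x \<in> carrier E \<Longrightarrow> y \<in> carrier E \<Longrightarrow> (x \<oplus> y) [^] p = x [^] p \<oplus> y [^] p"
    and p: "prime p" and q: "prime q" and q_odd: "odd q" and qp: "q dvd p - 1"
    and geo: "(p - 1) * (q * m) = p ^ q - 1" and s: "s dvd p - 1" "q dvd s"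
    and n: "n = m * s * q" and odd_n: "odd n" and m: "m > 1"
    and cop: "\<And>i. \<not> q dvd i \<Longrightarrow> coprime m (p ^ i - 1)"
    and d: "d \<in> carrier E" and d_order: "\<And>k::nat. d [^] k = \<one> \<longleftrightarrow> n dvd k"
begin

lemma s_pos: "s > 0" using s p prime_gt_1_nat[of p] by (metis dvd_pos_nat zero_less_diff)

lemma n_pos: "n > 0" using odd_n by (cases n) auto
lemma q_dvd_n: "q dvd n" by (simp add: n)
lemma qs_dvd_n: "q * s dvd n" by (simp add: n)

lemma p_pos: "p > 0" using p prime_gt_0_nat by blast

lemma p_pow_pos: "p ^ i > 0" using p_pos by simp

lemma p_cong_1: "[p ^ i = 1] (mod (p - 1))"
proof -
  have "[p = 1] (mod (p - 1))" using p_pos by (simp add: cong_altdef_nat)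
  then show ?thesis using cong_pow by fastforce
qed

lemma p_pow_cong_q: "[p ^ i = 1] (mod q)"
  using cong_dvd_modulus_nat[OF p_cong_1 qp] .

lemma n_dvd: "n dvd p ^ q - 1"
proof -
  have "n dvd (p - 1) * (q * m)" unfolding n using s by (metis dvd_refl mult.assoc mult.commute mult_dvd_mono)
  then show ?thesis using geo by simp
qed

lemma p_pow_cong_n: "q dvd i \<Longrightarrow> [p ^ i = 1] (mod n)"
proof -
  assume "q dvd i"
  then obtain j where j: "i = q * j" by blast
  have "[p ^ q = 1] (mod n)" using n_dvd p_pow_pos[of q] by (simp add: cong_altdef_nat Suc_leI)
  then have "[(p ^ q) ^ j = 1 ^ j] (mod n)" by (rule cong_pow)
  then show ?thesis by (simp add: j power_mult)
qed

lemma pow_unit: assumes y: "y \<in> carrier E" "y \<noteq> \<zero>" shows "y [^] (p ^ q - 1) = \<one>"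
proof -
  interpret U: group "mult_of E" by (rule field_mult_group)
  have "y \<in> carrier (mult_of E)" using y by simp
  then show ?thesis
    using U.pow_order_eq_1 order_mult_of[OF fin] card_E by (simp add: nat_pow_mult_of Coset.order_def)
qed

lemma pow_pq: assumes y: "y \<in> carrier E" shows "y [^] (p ^ q) = y"
proof (cases "y = \<zero>")
  case True
  then show ?thesis using p_pow_pos[of q] by (simp add: nat_pow_zero)
next
  case False
  have "y [^] (p ^ q) = y [^] Suc (p ^ q - 1)" using p_pow_pos[of q] by (simp only: Suc_diff_1)
  also have "\<dots> = y" using pow_unit[OF y False] y by simp
  finally show ?thesis .
qed

lemma pow_nonzero: "y \<in> carrier E \<Longrightarrow> y \<noteq> \<zero> \<Longrightarrow> y [^] (k::nat) \<noteq> \<zero>"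
  by (induction k) (auto simp: integral_iff)

lemma pow_add_frob:
  assumes "x \<in> carrier E" "y \<in> carrier E"
  shows "(x \<oplus> y) [^] (p ^ i) = x [^] (p ^ i) \<oplus> y [^] (p ^ i)"
proof (induction i)
  case (Suc i)
  have "(x \<oplus> y) [^] (p ^ Suc i) = ((x \<oplus> y) [^] (p ^ i)) [^] p"
    using assms by (simp add: nat_pow_pow mult.commute)
  also have "\<dots> = (x [^] (p ^ i)) [^] p \<oplus> (y [^] (p ^ i)) [^] p" using Suc assms frob by simp
  finally show ?case using assms by (simp add: nat_pow_pow mult.commute)
qed (use assms in simp)

lemma pow_frob_mod_q:
  assumes y: "y \<in> carrier E" and ij: "[i = j] (mod q)"
  shows "y [^] (p ^ i) = y [^] (p ^ j)"
proof -
  have 1: "y [^] (p ^ (q * k)) = y" for k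
  proof (induction k)
    case (Suc k)
    have "y [^] (p ^ (q * Suc k)) = (y [^] (p ^ q)) [^] (p ^ (q * k))"
      using y by (simp add: nat_pow_pow power_add)
    then show ?case using Suc pow_pq y by simp
  qed (use y in simp)
  have 2: "y [^] (p ^ i) = y [^] (p ^ (i mod q))" for i
  proof -
    have "p ^ i = p ^ (q * (i div q)) * p ^ (i mod q)" by (simp flip: power_add)
    then have "y [^] (p ^ i) = (y [^] (p ^ (q * (i div q)))) [^] (p ^ (i mod q))"
      using y by (simp add: nat_pow_pow)
    then show ?thesis using 1 by simp
  qed
  show ?thesis using 2[of i] 2[of j] ij by (simp add: cong_def)
qed

lemma d_pow_mod: "d [^] (c * (k mod n)) = d [^] (c * k)"
proof -
  have dn: "d [^] (c * (n * l)) = \<one>" for l using d_order by simp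
  have "c * k = c * (n * (k div n)) + c * (k mod n)"
    by (metis distrib_left mult_div_mod_eq)
  then have "d [^] (c * k) = d [^] (c * (n * (k div n))) \<otimes> d [^] (c * (k mod n))"
    using d by (metis nat_pow_mult)
  then show ?thesis using dn d by simp
qed

text \<open>This is why one index can serve as an exponent of d modulo n and as a Frobenius exponent
  modulo q: the twist by p^i disappears modulo q.\<close>

lemma index_cong_q: "[(i + j * p ^ i) mod n = i + j] (mod q)"
proof -
  have "[(i + j * p ^ i) mod n = i + j * p ^ i] (mod q)"
    using q_dvd_n by (meson cong_dvd_modulus_nat cong_mod_left cong_refl)
  moreover have "[i + j * p ^ i = i + j * 1] (mod q)"
    by (intro cong_add cong_mult cong_refl p_pow_cong_q)
  ultimately show ?thesis using cong_trans by fastforce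
qed

text \<open>For \<open>c = 1, 2\<close> these are the semilinear maps by which the index \<open>i\<close> acts on the first two
  coordinates and on the third one. Their composition law gives the product
  \<open>i + j p\<^sup>i mod n\<close> of indices.\<close>

definition W :: "nat \<Rightarrow> nat \<Rightarrow> nat \<Rightarrow> nat" where "W c i y = d [^] (c * i) \<otimes> y [^] (p ^ i)"

lemma W_closed [simp, intro]: "y \<in> carrier E \<Longrightarrow> W c i y \<in> carrier E"
  using d by (simp add: W_def)

lemma W_add: "x \<in> carrier E \<Longrightarrow> y \<in> carrier E \<Longrightarrow> W c i (x \<oplus> y) = W c i x \<oplus> W c i y"
  using d by (simp add: W_def pow_add_frob r_distr)

lemma W_zero [simp]: "W c i \<zero> = \<zero>"
  using d p_pow_pos[of i] by (simp add: W_def nat_pow_zero)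

lemma W_0 [simp]: "y \<in> carrier E \<Longrightarrow> W c 0 y = y" by (simp add: W_def)

lemma W_comp:
  assumes y: "y \<in> carrier E"
  shows "W c i (W c j y) = W c ((i + j * p ^ i) mod n) y"
proof -
  have "[j + i = (i + j * p ^ i) mod n] (mod q)"
    using index_cong_q[of i j] by (simp only: add.commute cong_sym_eq)
  then have 1: "y [^] (p ^ (j + i)) = y [^] (p ^ ((i + j * p ^ i) mod n))" by (rule pow_frob_mod_q[OF y])
  have "W c i (W c j y) = d [^] (c * i) \<otimes> (d [^] (c * j * p ^ i) \<otimes> y [^] (p ^ j * p ^ i))"
    using y d by (simp add: W_def nat_pow_distrib nat_pow_pow)
  also have "\<dots> = d [^] (c * (i + j * p ^ i)) \<otimes> y [^] (p ^ (j + i))"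
    using y d by (simp add: m_assoc[symmetric] nat_pow_mult power_add distrib_left mult.assoc)
  also have "\<dots> = W c ((i + j * p ^ i) mod n) y" unfolding W_def d_pow_mod 1 by simp
  finally show ?thesis .
qed

text \<open>Products of two weight 1 coordinates have weight 2, which makes the bilinear term of the
  Heisenberg product compatible with the action.\<close>

lemma W_mult:
  assumes "x \<in> carrier E" "y \<in> carrier E"
  shows "W 1 i x \<otimes> W 1 i y = W 2 i (x \<otimes> y)"
proof -
  have "W 1 i x \<otimes> W 1 i y = (d [^] i \<otimes> d [^] i) \<otimes> (x [^] (p ^ i) \<otimes> y [^] (p ^ i))"
    using assms d by (simp add: W_def m_ac)
  also have "\<dots> = W 2 i (x \<otimes> y)"
    using assms d by (simp add: W_def nat_pow_mult nat_pow_distrib mult_2)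
  finally show ?thesis .
qed

lemma W_free:
  assumes y: "y \<in> carrier E" and fixed: "W c i y = y" and i: "0 < i" "i < n" and c: "c = 1 \<or> c = 2"
  shows "y = \<zero>"
proof (rule ccontr)
  assume y0: "y \<noteq> \<zero>"
  have cop_n: "coprime n c" using c odd_n by auto
  have cop_q: "coprime q c" using c q_odd by auto
  have "d [^] (c * i * (q * m)) \<otimes> y [^] (p ^ i * (q * m)) = y [^] (q * m)"
    using arg_cong[OF fixed, of "\<lambda>x. x [^] (q * m)"] y d
    by (simp add: W_def nat_pow_distrib nat_pow_pow)
  \<comment> \<open>Since p - 1 divides p^i - 1 and (p - 1) q m = p^q - 1, the exponent of y changes
    by a multiple of p^q - 1, and y can be cancelled.\<close>
  moreover obtain t where t: "p ^ i = 1 + (p - 1) * t"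
    using p_cong_1[of i] p_pow_pos[of i] by (metis One_nat_def Suc_leI cong_altdef_nat dvdE le_add_diff_inverse)
  have "y [^] (p ^ i * (q * m)) = y [^] (q * m)"
  proof -
    have "p ^ i * (q * m) = q * m + (p ^ q - 1) * t"
      unfolding t geo[symmetric] by (simp add: algebra_simps)
    then have "y [^] (p ^ i * (q * m)) = y [^] (q * m) \<otimes> (y [^] (p ^ q - 1)) [^] t"
      using y by (simp add: nat_pow_mult nat_pow_pow)
    then show ?thesis using y pow_unit[OF y y0] by simp
  qed
  moreover have "y [^] (q * m) \<noteq> \<zero>"
    using y y0 by (rule pow_nonzero)
  ultimately have "d [^] (c * i * (q * m)) = \<one>"
    using y d m_rcancel[of "y [^] (q * m)" "d [^] (c * i * (q * m))" \<one>] by simp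
  \<comment> \<open>As n = m s q, cancelling m q leaves s; q divides s and is coprime to c, so i is
    a multiple of q and the Frobenius factor acts trivially.\<close>
  then have "(m * q) * s dvd (m * q) * (c * i)" unfolding d_order n by (simp add: ac_simps)
  then have "s dvd c * i" using m q prime_gt_0_nat[of q] by (simp add: dvd_mult_cancel_left)
  then have "q dvd c * i" using s(2) dvd_trans by blast
  then have qi: "q dvd i" using cop_q coprime_dvd_mult_right_iff by blast
  then have "y [^] (p ^ i) = y"
    using pow_frob_mod_q[OF y, of i 0] y by (simp add: cong_0_iff)
  then have "d [^] (c * i) \<otimes> y = \<one> \<otimes> y" using fixed y by (simp add: W_def)
  then have "d [^] (c * i) = \<one>" using y y0 d m_rcancel[of y "d [^] (c * i)" \<one>] by simp
  then have "n dvd c * i" by (simp add: d_order)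
  then have "n dvd i" using cop_n coprime_dvd_mult_right_iff by blast
  then show False using i by (auto dest: dvd_imp_le)
qed

end

section \<open>The group\<close>

context heisenberg_field
begin

text \<open>The Heisenberg group of \<open>E\<close>, with product
  \<open>(a, b, z) (a', b', z') = (a + a', b + b', z + z' + a b')\<close>, extended by the indices modulo \<open>n\<close>.\<close>

definition H :: "nat monoid" where
  "H = \<lparr>carrier = {x. ca x \<in> carrier E \<and> cb x \<in> carrier E \<and> cz x \<in> carrier E \<and> ci x \<in> {..<n}},
     monoid.mult = (\<lambda>x y. mk (ca x \<oplus> W 1 (ci x) (ca y)) (cb x \<oplus> W 1 (ci x) (cb y))
       (cz x \<oplus> W 2 (ci x) (cz y) \<oplus> ca x \<otimes> W 1 (ci x) (cb y)) ((ci x + ci y * p ^ ci x) mod n)),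
     one = mk \<zero> \<zero> \<zero> 0\<rparr>"

lemma H_carrier: "x \<in> carrier H \<longleftrightarrow> ca x \<in> carrier E \<and> cb x \<in> carrier E \<and> cz x \<in> carrier E \<and> ci x < n"
  by (simp add: H_def)

lemma H_closedD [simp]:
  "x \<in> carrier H \<Longrightarrow> ca x \<in> carrier E" "x \<in> carrier H \<Longrightarrow> cb x \<in> carrier E"
  "x \<in> carrier H \<Longrightarrow> cz x \<in> carrier E" "x \<in> carrier H \<Longrightarrow> ci x < n"
  by (simp_all add: H_carrier)

lemma H_carrierI:
  "ca x \<in> carrier E \<Longrightarrow> cb x \<in> carrier E \<Longrightarrow> cz x \<in> carrier E \<Longrightarrow> ci x < n \<Longrightarrow> x \<in> carrier H"
  using H_carrier by blast

lemma mk_carrier [simp]: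
  "mk a b z i \<in> carrier H \<longleftrightarrow> a \<in> carrier E \<and> b \<in> carrier E \<and> z \<in> carrier E \<and> i < n"
  using H_carrier[of "mk a b z i"] by (simp only: coords_mk)

lemma H_mult: "x \<otimes>\<^bsub>H\<^esub> y = mk (ca x \<oplus> W 1 (ci x) (ca y)) (cb x \<oplus> W 1 (ci x) (cb y))
       (cz x \<oplus> W 2 (ci x) (cz y) \<oplus> ca x \<otimes> W 1 (ci x) (cb y)) ((ci x + ci y * p ^ ci x) mod n)"
  and H_one: "\<one>\<^bsub>H\<^esub> = mk \<zero> \<zero> \<zero> 0"
  by (simp_all only: H_def monoid.select_convs)

lemma H_coords [simp]:
  "ca (x \<otimes>\<^bsub>H\<^esub> y) = ca x \<oplus> W 1 (ci x) (ca y)"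
  "cb (x \<otimes>\<^bsub>H\<^esub> y) = cb x \<oplus> W 1 (ci x) (cb y)"
  "cz (x \<otimes>\<^bsub>H\<^esub> y) = cz x \<oplus> W 2 (ci x) (cz y) \<oplus> ca x \<otimes> W 1 (ci x) (cb y)"
  "ci (x \<otimes>\<^bsub>H\<^esub> y) = (ci x + ci y * p ^ ci x) mod n"
  "ca \<one>\<^bsub>H\<^esub> = \<zero>" "cb \<one>\<^bsub>H\<^esub> = \<zero>" "cz \<one>\<^bsub>H\<^esub> = \<zero>" "ci \<one>\<^bsub>H\<^esub> = 0"
  unfolding H_mult H_one by (rule coords_mk)+

text \<open>Modulo n the power p^l depends only on l modulo q, and modulo q the inner index is i +
  j.\<close>

lemma index_assoc:
  "((i + j * p ^ i) mod n + k * p ^ ((i + j * p ^ i) mod n)) mod n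
     = (i + ((j + k * p ^ j) mod n) * p ^ i) mod n"
proof -
  let ?l = "(i + j * p ^ i) mod n"
  have "[p ^ ?l = p ^ (i + j)] (mod n)"
  proof -
    have pq1: "[p ^ (a mod q) = p ^ a] (mod n)" for a
    proof -
      have "[p ^ (a mod q) * p ^ (q * (a div q)) = p ^ (a mod q) * 1] (mod n)"
        by (intro cong_mult cong_refl p_pow_cong_n) simp
      moreover have "p ^ (a mod q) * p ^ (q * (a div q)) = p ^ a" by (simp flip: power_add)
      ultimately show ?thesis by (simp add: cong_sym)
    qed
    have "[?l = i + j] (mod q)" by (rule index_cong_q)
    then have "?l mod q = (i + j) mod q" by (simp add: cong_def)
    then show ?thesis using pq1[of ?l] pq1[of "i + j"] by (metis cong_sym cong_trans)
  qed
  then have "[?l + k * p ^ ?l = (i + j * p ^ i) + k * p ^ (i + j)] (mod n)"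
    by (intro cong_add cong_mult cong_refl) simp
  moreover have "[(i + j * p ^ i) + k * p ^ (i + j) = i + ((j + k * p ^ j) mod n) * p ^ i] (mod n)"
  proof -
    have "[i + ((j + k * p ^ j) mod n) * p ^ i = i + (j + k * p ^ j) * p ^ i] (mod n)"
      by (intro cong_add cong_mult cong_refl) simp
    moreover have "i + (j + k * p ^ j) * p ^ i = (i + j * p ^ i) + k * p ^ (i + j)"
      by (simp add: algebra_simps power_add)
    ultimately show ?thesis by (metis cong_sym)
  qed
  ultimately have "[?l + k * p ^ ?l = i + ((j + k * p ^ j) mod n) * p ^ i] (mod n)" by (rule cong_trans)
  then show ?thesis by (simp add: cong_def)
qed

lemma index_inverse: "\<exists>j<n. (i + j * p ^ i) mod n = 0"
proof (intro exI conjI)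
  \<comment> \<open>This is -i p^(-i) modulo n: n - 1 stands for -1, and p^(i (q - 1)) inverts p^i
    because p^(i q) = 1 modulo n.\<close>
  let ?j = "((n - 1) * i * p ^ (i * (q - 1))) mod n"
  show "?j < n" using n_pos by simp
  have "[?j * p ^ i = (n - 1) * i * p ^ (i * (q - 1)) * p ^ i] (mod n)"
    by (intro cong_mult cong_refl) simp
  moreover have "(n - 1) * i * p ^ (i * (q - 1)) * p ^ i = (n - 1) * i * p ^ (i * q)"
  proof -
    have "i * (q - 1) + i = i * q" using prime_gt_0_nat[OF q] by (simp add: algebra_simps diff_mult_distrib2)
    then show ?thesis by (simp add: mult.assoc flip: power_add)
  qed
  moreover have "[(n - 1) * i * p ^ (i * q) = (n - 1) * i * 1] (mod n)"
    by (intro cong_mult cong_refl p_pow_cong_n) simp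
  ultimately have "[?j * p ^ i = (n - 1) * i] (mod n)" by (metis cong_trans mult.right_neutral)
  then have "[i + ?j * p ^ i = i + (n - 1) * i] (mod n)" by (intro cong_add cong_refl)
  moreover have "i + (n - 1) * i = n * i" using n_pos by (cases n) auto
  ultimately show "(i + ?j * p ^ i) mod n = 0" by (simp add: cong_def)
qed

lemma H_monoid: "monoid H"
proof (rule monoidI)
  show "x \<otimes>\<^bsub>H\<^esub> y \<in> carrier H" if "x \<in> carrier H" "y \<in> carrier H" for x y
    using that n_pos by (intro H_carrierI) simp_all
  show "\<one>\<^bsub>H\<^esub> \<in> carrier H" using n_pos by (simp add: H_one)
  show "x \<otimes>\<^bsub>H\<^esub> y \<otimes>\<^bsub>H\<^esub> w = x \<otimes>\<^bsub>H\<^esub> (y \<otimes>\<^bsub>H\<^esub> w)" if "x \<in> carrier H" "y \<in> carrier H" "w \<in> carrier H" for x y w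
  proof (rule coords_eqI)
    show "ci (x \<otimes>\<^bsub>H\<^esub> y \<otimes>\<^bsub>H\<^esub> w) = ci (x \<otimes>\<^bsub>H\<^esub> (y \<otimes>\<^bsub>H\<^esub> w))"
      using index_assoc by simp
    show "ca (x \<otimes>\<^bsub>H\<^esub> y \<otimes>\<^bsub>H\<^esub> w) = ca (x \<otimes>\<^bsub>H\<^esub> (y \<otimes>\<^bsub>H\<^esub> w))"
      "cb (x \<otimes>\<^bsub>H\<^esub> y \<otimes>\<^bsub>H\<^esub> w) = cb (x \<otimes>\<^bsub>H\<^esub> (y \<otimes>\<^bsub>H\<^esub> w))"
      using that by (simp_all add: W_add W_comp a_assoc)
    show "cz (x \<otimes>\<^bsub>H\<^esub> y \<otimes>\<^bsub>H\<^esub> w) = cz (x \<otimes>\<^bsub>H\<^esub> (y \<otimes>\<^bsub>H\<^esub> w))"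
    proof -
      let ?T = "W 1 (ci x)" and ?U = "W 2 (ci x)" and ?k = "(ci x + ci y * p ^ ci x) mod n"
      note c = that[THEN H_closedD(1)] that[THEN H_closedD(2)] that[THEN H_closedD(3)]
      have "cz (x \<otimes>\<^bsub>H\<^esub> (y \<otimes>\<^bsub>H\<^esub> w)) = cz x \<oplus> (?U (cz y) \<oplus> W 2 ?k (cz w) \<oplus> ?T (ca y) \<otimes> W 1 ?k (cb w))
          \<oplus> ca x \<otimes> (?T (cb y) \<oplus> W 1 ?k (cb w))"
        using c by (simp add: W_add W_comp W_mult[symmetric])
      also have "\<dots> = cz x \<oplus> ?U (cz y) \<oplus> ca x \<otimes> ?T (cb y) \<oplus> W 2 ?k (cz w) \<oplus> (ca x \<oplus> ?T (ca y)) \<otimes> W 1 ?k (cb w)"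
        using c W_closed by algebra
      finally show ?thesis using c by simp
    qed
  qed
  show "\<one>\<^bsub>H\<^esub> \<otimes>\<^bsub>H\<^esub> x = x" if "x \<in> carrier H" for x
    using that by (intro coords_eqI[of "\<one>\<^bsub>H\<^esub> \<otimes>\<^bsub>H\<^esub> x" x]) simp_all
  show "x \<otimes>\<^bsub>H\<^esub> \<one>\<^bsub>H\<^esub> = x" if "x \<in> carrier H" for x
    using that by (intro coords_eqI[of "x \<otimes>\<^bsub>H\<^esub> \<one>\<^bsub>H\<^esub>" x]) simp_all
qed

lemma H_group: "group H"
proof (rule monoid.group_of_right_inverses[OF H_monoid])
  fix x assume x: "x \<in> carrier H"
  obtain j where j: "j < n" "(ci x + j * p ^ ci x) mod n = 0" using index_inverse[of "ci x"] by (elim exE conjE) (rule that)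
  \<comment> \<open>The index j undoes the semilinear maps of x. The second coordinate is fixed
    first because the bilinear term puts it into the equation for the third.\<close>
  define b where "b = W 1 j (\<ominus> cb x)"
  define y where "y = mk (W 1 j (\<ominus> ca x)) b (W 2 j (\<ominus> (cz x \<oplus> ca x \<otimes> W 1 (ci x) b))) j"
  have b: "b \<in> carrier E" using x by (simp add: b_def)
  have WW: "W c (ci x) (W c j u) = u" if "u \<in> carrier E" for c u
    using that j by (simp add: W_comp)
  have "y \<in> carrier H" using x b j by (simp add: y_def)
  moreover have "x \<otimes>\<^bsub>H\<^esub> y = \<one>\<^bsub>H\<^esub>"
  proof (rule coords_eqI)
    show "ca (x \<otimes>\<^bsub>H\<^esub> y) = ca \<one>\<^bsub>H\<^esub>" using x by (simp add: y_def WW r_neg)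
    show "cb (x \<otimes>\<^bsub>H\<^esub> y) = cb \<one>\<^bsub>H\<^esub>" using x by (simp add: y_def b_def WW r_neg)
    show "ci (x \<otimes>\<^bsub>H\<^esub> y) = ci \<one>\<^bsub>H\<^esub>" using j by (simp add: y_def)
    let ?v = "ca x \<otimes> W 1 (ci x) b"
    have v: "?v \<in> carrier E" using x b by simp
    have "cz (x \<otimes>\<^bsub>H\<^esub> y) = cz x \<oplus> \<ominus> (cz x \<oplus> ?v) \<oplus> ?v" using x b by (simp add: y_def WW)
    also have "\<dots> = \<zero>" using v H_closedD(3)[OF x] by algebra
    finally show "cz (x \<otimes>\<^bsub>H\<^esub> y) = cz \<one>\<^bsub>H\<^esub>" by simp
  qed
  ultimately show "\<exists>y\<in>carrier H. x \<otimes>\<^bsub>H\<^esub> y = \<one>\<^bsub>H\<^esub>" by blast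
qed

sublocale H: group H by (rule H_group)

section \<open>The normal series of the group\<close>

text \<open>Indices divisible by q act without Frobenius, as multiplications by powers of d. Those
  divisible by q s form the part of order m in the complement, where p^i - 1 is invertible for q not
  dividing i.\<close>

definition "KH = {x \<in> carrier H. q dvd ci x}"
definition "QH = {x \<in> carrier H. q * s dvd ci x}"
definition "PH = {x \<in> carrier H. ci x = 0}"
definition "AH = {x \<in> carrier H. ci x = 0 \<and> ca x = \<zero>}"
definition "ZH = {x \<in> carrier H. ci x = 0 \<and> ca x = \<zero> \<and> cb x = \<zero>}"

lemma H_finite: "finite (carrier H)"
  unfolding H_def using finite_coords[OF fin fin fin, of "{..<n}"] by simp

lemma index_of_q_dvd: "q dvd i \<Longrightarrow> (i + j * p ^ i) mod n = (i + j) mod n"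
proof -
  assume "q dvd i"
  then have "[i + j * p ^ i = i + j * 1] (mod n)" by (intro cong_add cong_mult cong_refl p_pow_cong_n)
  then show ?thesis by (simp add: cong_def)
qed

text \<open>The extra factor w covers two cases at once: w trivial for conjugates, and x = y for
  commutators.\<close>

lemma conj_index_q:
  assumes "y \<otimes>\<^bsub>H\<^esub> g = w \<otimes>\<^bsub>H\<^esub> (g \<otimes>\<^bsub>H\<^esub> x)"
  shows "[ci y = ci w + ci x] (mod q)"
proof -
  have 1: "[ci (y \<otimes>\<^bsub>H\<^esub> g) = ci y + ci g] (mod q)" using index_cong_q by simp
  have 2: "[ci (w \<otimes>\<^bsub>H\<^esub> (g \<otimes>\<^bsub>H\<^esub> x)) = ci w + (ci g + ci x)] (mod q)"
  proof -
    have "[ci (w \<otimes>\<^bsub>H\<^esub> (g \<otimes>\<^bsub>H\<^esub> x)) = ci w + ci (g \<otimes>\<^bsub>H\<^esub> x)] (mod q)"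
      using index_cong_q[of "ci w" "ci (g \<otimes>\<^bsub>H\<^esub> x)"] by simp
    moreover have "[ci w + ci (g \<otimes>\<^bsub>H\<^esub> x) = ci w + (ci g + ci x)] (mod q)"
      using index_cong_q[of "ci g" "ci x"] by (intro cong_add cong_refl) simp
    ultimately show ?thesis by (rule cong_trans)
  qed
  have "[ci y + ci g = ci w + (ci g + ci x)] (mod q)"
    by (rule cong_trans[OF cong_sym[OF 1] 2[folded assms]])
  then have "[ci y + ci g = (ci w + ci x) + ci g] (mod q)" by (simp only: ac_simps)
  then show ?thesis by (simp add: cong_add_rcancel_nat)
qed

lemma conj_index:
  assumes e: "y \<otimes>\<^bsub>H\<^esub> g = g \<otimes>\<^bsub>H\<^esub> x" and c: "x \<in> carrier H" "y \<in> carrier H" "g \<in> carrier H" and q: "q dvd ci x"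
  shows "q dvd ci y" "ci y = ci x * p ^ ci g mod n"
proof -
  have "\<one>\<^bsub>H\<^esub> \<otimes>\<^bsub>H\<^esub> (g \<otimes>\<^bsub>H\<^esub> x) = g \<otimes>\<^bsub>H\<^esub> x" using c by simp
  then have "[ci y = ci \<one>\<^bsub>H\<^esub> + ci x] (mod q)" using conj_index_q[of y g "\<one>\<^bsub>H\<^esub>" x] e by simp
  then show qy: "q dvd ci y" using q by (simp add: cong_dvd_iff cong_def dvd_eq_mod_eq_0)
  have "(ci y + ci g) mod n = (ci g + ci x * p ^ ci g) mod n"
    using arg_cong[OF e, of ci] index_of_q_dvd[OF qy, of "ci g"] by simp
  then have "[ci y + ci g = ci x * p ^ ci g + ci g] (mod n)" by (simp add: cong_def add.commute)
  then have "[ci y = ci x * p ^ ci g] (mod n)" by (simp add: cong_add_rcancel_nat)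
  then show "ci y = ci x * p ^ ci g mod n" using c by (simp add: cong_def)
qed

lemma P_mult:
  assumes "x \<in> PH" "y \<in> carrier H"
  shows "ca (x \<otimes>\<^bsub>H\<^esub> y) = ca x \<oplus> ca y" "cb (x \<otimes>\<^bsub>H\<^esub> y) = cb x \<oplus> cb y"
    "cz (x \<otimes>\<^bsub>H\<^esub> y) = cz x \<oplus> cz y \<oplus> ca x \<otimes> cb y" "ci (x \<otimes>\<^bsub>H\<^esub> y) = ci y"
  using assms by (simp_all add: PH_def)

lemma PH_subset: "ZH \<subseteq> AH" "AH \<subseteq> PH" "PH \<subseteq> QH" "QH \<subseteq> KH"
  by (auto simp: ZH_def AH_def PH_def QH_def KH_def intro: dvd_mult_left)

lemma conj_P:
  assumes "g \<in> carrier H" "x \<in> PH" "y \<in> carrier H" "y \<otimes>\<^bsub>H\<^esub> g = g \<otimes>\<^bsub>H\<^esub> x"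
  shows "y \<in> PH" "ca y = W 1 (ci g) (ca x)" "cb y = W 1 (ci g) (cb x)"
proof -
  have x: "x \<in> carrier H" "ci x = 0" using assms by (auto simp: PH_def)
  then have "ci y = 0" using conj_index[OF assms(4) x(1) assms(3,1)] by simp
  then show y: "y \<in> PH" using assms by (simp add: PH_def)
  have "ca y \<oplus> ca g = ca g \<oplus> W 1 (ci g) (ca x)" "cb y \<oplus> cb g = cb g \<oplus> W 1 (ci g) (cb x)"
    using arg_cong[OF assms(4), of ca] arg_cong[OF assms(4), of cb] P_mult[OF y assms(1)] by simp_all
  then show "ca y = W 1 (ci g) (ca x)" "cb y = W 1 (ci g) (cb x)"
    using assms(1,3) x by (simp_all add: a_comm[of "ca g"] a_comm[of "cb g"])
qed

lemma normals: "ZH \<lhd> H" "AH \<lhd> H" "PH \<lhd> H" "QH \<lhd> H" "KH \<lhd> H"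
proof -
  have qx: "q dvd ci x" if "q * s dvd ci x" for x using that dvd_mult_left by blast
  show "KH \<lhd> H"
  proof (rule H.normalI_finite[OF H_finite])
    show "x \<otimes>\<^bsub>H\<^esub> y \<in> KH" if "x \<in> KH" "y \<in> KH" for x y
      using that q_dvd_n by (auto simp: KH_def dvd_mod_iff)
    show "y \<in> KH" if "g \<in> carrier H" "x \<in> KH" "y \<in> carrier H" "y \<otimes>\<^bsub>H\<^esub> g = g \<otimes>\<^bsub>H\<^esub> x" for g x y
      using conj_index(1)[OF that(4) _ that(3,1)] that by (simp add: KH_def)
  qed (auto simp: KH_def)
  show "QH \<lhd> H"
  proof (rule H.normalI_finite[OF H_finite])
    show "x \<otimes>\<^bsub>H\<^esub> y \<in> QH" if "x \<in> QH" "y \<in> QH" for x y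
      using that qs_dvd_n by (auto simp: QH_def dvd_mod_iff)
    show "y \<in> QH" if "g \<in> carrier H" "x \<in> QH" "y \<in> carrier H" "y \<otimes>\<^bsub>H\<^esub> g = g \<otimes>\<^bsub>H\<^esub> x" for g x y
      using conj_index(2)[OF that(4) _ that(3,1)] that qs_dvd_n qx by (simp add: QH_def dvd_mod_iff)
  qed (auto simp: QH_def)
  show "PH \<lhd> H"
  proof (rule H.normalI_finite[OF H_finite])
    show "x \<otimes>\<^bsub>H\<^esub> y \<in> PH" if "x \<in> PH" "y \<in> PH" for x y
      using that by (auto simp: PH_def)
    show "y \<in> PH" if "g \<in> carrier H" "x \<in> PH" "y \<in> carrier H" "y \<otimes>\<^bsub>H\<^esub> g = g \<otimes>\<^bsub>H\<^esub> x" for g x y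
      using conj_P(1)[OF that] .
  qed (auto simp: PH_def)
  show "AH \<lhd> H"
  proof (rule H.normalI_finite[OF H_finite])
    show "x \<otimes>\<^bsub>H\<^esub> y \<in> AH" if "x \<in> AH" "y \<in> AH" for x y
      using that by (auto simp: AH_def)
    show "y \<in> AH" if "g \<in> carrier H" "x \<in> AH" "y \<in> carrier H" "y \<otimes>\<^bsub>H\<^esub> g = g \<otimes>\<^bsub>H\<^esub> x" for g x y
      using conj_P[of g x y] that by (simp add: AH_def PH_def)
  qed (auto simp: AH_def)
  show "ZH \<lhd> H"
  proof (rule H.normalI_finite[OF H_finite])
    show "x \<otimes>\<^bsub>H\<^esub> y \<in> ZH" if "x \<in> ZH" "y \<in> ZH" for x y
      using that by (auto simp: ZH_def)
    show "y \<in> ZH" if "g \<in> carrier H" "x \<in> ZH" "y \<in> carrier H" "y \<otimes>\<^bsub>H\<^esub> g = g \<otimes>\<^bsub>H\<^esub> x" for g x y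
      using conj_P[of g x y] that by (simp add: ZH_def PH_def)
  qed (auto simp: ZH_def)
qed

lemma card_multiples: "card {i. i < n \<and> q dvd i} = m * s"
proof -
  have q0: "q > 0" using q prime_gt_0_nat by blast
  have "{i. i < n \<and> q dvd i} = (\<lambda>k. q * k) ` {..<m * s}"
  proof (intro equalityI subsetI)
    fix i assume "i \<in> {i. i < n \<and> q dvd i}"
    then obtain k where "i = q * k" "q * k < q * (m * s)" by (auto simp: n ac_simps)
    then show "i \<in> (\<lambda>k. q * k) ` {..<m * s}" by simp
  qed (use q0 in \<open>auto simp: n ac_simps\<close>)
  then show ?thesis using q0 by (simp add: card_image inj_on_def)
qed

lemma cards:
  "card (carrier H) = q * card KH" "card (carrier H) = n * card PH" "card (carrier H) = p ^ q * n * card AH"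
proof -
  let ?c = "card (carrier E)"
  have H: "card (carrier H) = ?c * (?c * (?c * n))"
    unfolding H_def using card_coords[of "carrier E" "carrier E" "carrier E" "{..<n}"] by simp
  have "KH = {x. ca x \<in> carrier E \<and> cb x \<in> carrier E \<and> cz x \<in> carrier E \<and> ci x \<in> {i. i < n \<and> q dvd i}}"
    by (auto simp: KH_def intro: H_carrierI)
  then have "card KH = ?c * (?c * (?c * (m * s)))"
    using card_coords[of "carrier E" "carrier E" "carrier E" "{i. i < n \<and> q dvd i}"] card_multiples by simp
  moreover have "?c * (?c * (?c * n)) = q * (?c * (?c * (?c * (m * s))))" by (simp add: n ac_simps)
  ultimately show "card (carrier H) = q * card KH" using H by simp
  have "PH = {x. ca x \<in> carrier E \<and> cb x \<in> carrier E \<and> cz x \<in> carrier E \<and> ci x \<in> {0}}"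
    using n_pos by (auto simp: PH_def intro: H_carrierI)
  then have "card PH = ?c * (?c * ?c)"
    using card_coords[of "carrier E" "carrier E" "carrier E" "{0}"] by simp
  then show "card (carrier H) = n * card PH" unfolding H by (simp only: ac_simps)
  have "AH = {x. ca x \<in> {\<zero>} \<and> cb x \<in> carrier E \<and> cz x \<in> carrier E \<and> ci x \<in> {0}}"
    using n_pos by (auto simp: AH_def intro: H_carrierI)
  then have "card AH = ?c * ?c"
    using card_coords[of "{\<zero>}" "carrier E" "carrier E" "{0}"] by simp
  then show "card (carrier H) = p ^ q * n * card AH" unfolding H card_E by (simp only: ac_simps)
qed

lemma H_cm_index:
  assumes "g \<in> carrier H" "u \<in> carrier H"
  shows "q dvd ci (H.cm g u)"
proof -
  have "g \<otimes>\<^bsub>H\<^esub> u = H.cm g u \<otimes>\<^bsub>H\<^esub> (u \<otimes>\<^bsub>H\<^esub> g)" using H.cm_mult assms by blast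
  then have "[ci g = ci (H.cm g u) + ci g] (mod q)" by (rule conj_index_q)
  then have "[0 + ci g = ci (H.cm g u) + ci g] (mod q)" by simp
  then have "[0 = ci (H.cm g u)] (mod q)" by (simp only: cong_add_rcancel_nat)
  then show ?thesis using cong_0_iff cong_sym by blast
qed

lemma H_cm_eqI:
  assumes "g \<in> carrier H" "u \<in> carrier H" "w \<in> carrier H" "g \<otimes>\<^bsub>H\<^esub> u = w \<otimes>\<^bsub>H\<^esub> (u \<otimes>\<^bsub>H\<^esub> g)"
  shows "H.cm g u = w"
proof -
  have "H.cm g u \<otimes>\<^bsub>H\<^esub> (u \<otimes>\<^bsub>H\<^esub> g) = w \<otimes>\<^bsub>H\<^esub> (u \<otimes>\<^bsub>H\<^esub> g)"
    using H.cm_mult[OF assms(1,2)] assms(4) by simp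
  then show ?thesis using assms by simp
qed

lemma H_tower: "frobenius_tower H ZH AH PH QH KH q n (p ^ q)"
proof (intro frobenius_tower.intro frobenius_tower_axioms.intro H.group_axioms normals H_finite
    PH_subset cards q)
  show "\<exists>z\<in>ZH. z \<noteq> \<one>\<^bsub>H\<^esub>"
  proof
    show "mk \<zero> \<zero> \<one> 0 \<in> ZH" using n_pos by (simp add: ZH_def)
    show "mk \<zero> \<zero> \<one> 0 \<noteq> \<one>\<^bsub>H\<^esub>" by (metis coords_mk(3) H_coords(7) one_not_zero)
  qed
  show "\<exists>u\<in>PH. u \<notin> AH"
    using n_pos by (intro bexI[of _ "mk \<one> \<zero> \<zero> 0"]) (auto simp: PH_def AH_def)
  show "\<exists>u\<in>QH. u \<notin> PH"
  proof
    \<comment> \<open>The bound m > 1 leaves room for q s as a nonzero index below n.\<close>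
    have "q * s * 1 < q * s * m" using m s_pos prime_gt_0_nat[OF q] by (intro mult_strict_left_mono) auto
    then have "q * s < n" by (simp add: n ac_simps)
    then show "mk \<zero> \<zero> \<zero> (q * s) \<in> QH" by (simp add: QH_def)
    show "mk \<zero> \<zero> \<zero> (q * s) \<notin> PH" using s_pos prime_gt_0_nat[OF q] by (simp add: PH_def)
  qed
  show "H.cm g u \<in> KH" if "g \<in> carrier H" "u \<in> carrier H" for g u
    using H_cm_index that by (simp add: KH_def)
  show "H.cm g u \<in> PH" if gu: "g \<in> KH" "u \<in> KH" for g u
  proof -
    have c: "g \<in> carrier H" "u \<in> carrier H" "q dvd ci g" "q dvd ci u" using gu by (auto simp: KH_def)
    have "ci (g \<otimes>\<^bsub>H\<^esub> u) = ci (H.cm g u \<otimes>\<^bsub>H\<^esub> (u \<otimes>\<^bsub>H\<^esub> g))" using H.cm_mult[OF c(1,2)] by simp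
    then have "(ci g + ci u) mod n = (ci (H.cm g u) + (ci u + ci g) mod n) mod n"
      using c index_of_q_dvd H_cm_index by simp
    then have "[ci (H.cm g u) + (ci u + ci g) = 0 + (ci u + ci g)] (mod n)"
      by (simp add: cong_def mod_simps add.commute)
    then have "[ci (H.cm g u) = 0] (mod n)" by (simp only: cong_add_rcancel_nat)
    then show ?thesis using c by (simp add: cong_def PH_def)
  qed
  show "H.cm g u \<in> ZH" if gu: "g \<in> PH" "u \<in> PH" for g u
  proof -
    have c: "g \<in> carrier H" "u \<in> carrier H" "ci g = 0" "ci u = 0" using gu by (auto simp: PH_def)
    have e: "H.cm g u \<otimes>\<^bsub>H\<^esub> (u \<otimes>\<^bsub>H\<^esub> g) = g \<otimes>\<^bsub>H\<^esub> u" using H.cm_mult[OF c(1,2)] by simp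
    have cm: "H.cm g u \<in> PH" using H.cm_normal(1)[OF normals(3) c(1)] gu by blast
    then have cc: "H.cm g u \<in> carrier H" "ci (H.cm g u) = 0" by (auto simp: PH_def)
    have "ca (H.cm g u) \<oplus> (ca u \<oplus> ca g) = ca g \<oplus> ca u" "cb (H.cm g u) \<oplus> (cb u \<oplus> cb g) = cb g \<oplus> cb u"
      using arg_cong[OF e, of ca] arg_cong[OF e, of cb] c cc by simp_all
    then have "ca (H.cm g u) \<oplus> (ca u \<oplus> ca g) = \<zero> \<oplus> (ca u \<oplus> ca g)"
      "cb (H.cm g u) \<oplus> (cb u \<oplus> cb g) = \<zero> \<oplus> (cb u \<oplus> cb g)"
      using c by (simp_all add: a_comm)
    then have "ca (H.cm g u) = \<zero>" "cb (H.cm g u) = \<zero>"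
      using c cc add.right_cancel[of "ca u \<oplus> ca g" "ca (H.cm g u)" \<zero>]
        add.right_cancel[of "cb u \<oplus> cb g" "cb (H.cm g u)" \<zero>] by simp_all
    then show ?thesis using cc by (simp add: ZH_def)
  qed
  show "g \<otimes>\<^bsub>H\<^esub> u = u \<otimes>\<^bsub>H\<^esub> g" if "g \<in> AH" "u \<in> AH" for g u
    using that by (intro coords_eqI[of "g \<otimes>\<^bsub>H\<^esub> u" "u \<otimes>\<^bsub>H\<^esub> g"]) (auto simp: AH_def a_comm)
  show "z \<otimes>\<^bsub>H\<^esub> u = u \<otimes>\<^bsub>H\<^esub> z" if "z \<in> ZH" "u \<in> PH" for z u
    using that by (intro coords_eqI[of "z \<otimes>\<^bsub>H\<^esub> u" "u \<otimes>\<^bsub>H\<^esub> z"]) (auto simp: ZH_def PH_def a_comm)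
  show "\<exists>b\<in>AH. H.cm g b = z" if gz: "g \<in> PH - AH" "z \<in> ZH" for g z
  proof -
    have g: "g \<in> carrier H" "ci g = 0" "ca g \<noteq> \<zero>" using gz by (auto simp: PH_def AH_def)
    have z: "z \<in> carrier H" "ci z = 0" "ca z = \<zero>" "cb z = \<zero>" using gz by (auto simp: ZH_def)
    have U: "ca g \<in> Units E" using g field_Units by simp
    \<comment> \<open>The commutator of g with (0, \<open>\<beta>\<close>, 0) is central with third
      coordinate \<open>ca g \<otimes> \<beta>\<close>, so \<open>\<beta>\<close> solves a division
      in the field.\<close>
    define \<beta> where "\<beta> = inv (ca g) \<otimes> cz z"
    have \<beta>: "\<beta> \<in> carrier E" "ca g \<otimes> \<beta> = cz z"
      using U z g Units_inv_closed[OF U] by (simp_all add: \<beta>_def m_assoc[symmetric] Units_r_inv)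
    define b where "b = mk \<zero> \<beta> \<zero> 0"
    have b: "b \<in> AH" "b \<in> carrier H" using \<beta> n_pos by (auto simp: b_def AH_def)
    have "g \<otimes>\<^bsub>H\<^esub> b = z \<otimes>\<^bsub>H\<^esub> (b \<otimes>\<^bsub>H\<^esub> g)"
      by (rule coords_eqI) (use g z \<beta> in \<open>simp_all add: b_def a_comm\<close>)
    then have "H.cm g b = z" using H_cm_eqI g b z by blast
    then show ?thesis using b by blast
  qed
  show "u = \<one>\<^bsub>H\<^esub>" if gu: "g \<in> carrier H - PH" "u \<in> PH" "g \<otimes>\<^bsub>H\<^esub> u = u \<otimes>\<^bsub>H\<^esub> g" for g u
  proof -
    have g: "g \<in> carrier H" "0 < ci g" "ci g < n" using gu by (auto simp: PH_def)
    have u: "u \<in> carrier H" "ci u = 0" using gu by (auto simp: PH_def)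
    have "ca u = W 1 (ci g) (ca u)" "cb u = W 1 (ci g) (cb u)"
      using conj_P(2,3)[OF g(1) gu(2) u(1) gu(3)[symmetric]] by auto
    then have ab: "ca u = \<zero>" "cb u = \<zero>" using W_free[of _ 1 "ci g"] g u by (metis H_closedD(1,2))+
    \<comment> \<open>Once the first two coordinates vanish the bilinear terms drop out, and the
      third is a fixed point of weight 2.\<close>
    have "cz g \<oplus> W 2 (ci g) (cz u) = cz u \<oplus> cz g"
      using arg_cong[OF gu(3), of cz] g u ab by simp
    then have "W 2 (ci g) (cz u) \<oplus> cz g = cz u \<oplus> cz g"
      using g u a_comm[of "cz g" "W 2 (ci g) (cz u)"] by simp
    then have "W 2 (ci g) (cz u) = cz u" using g u by (simp only: add.right_cancel W_closed H_closedD)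
    then have "cz u = \<zero>" using W_free[of "cz u" 2 "ci g"] g u by simp
    then show ?thesis using ab u by (intro coords_eqI[of u "\<one>\<^bsub>H\<^esub>"]) simp_all
  qed
  show "u \<in> PH" if gu: "g \<in> carrier H - KH" "u \<in> QH" "H.cm g u \<in> PH" for g u
  proof -
    have g: "g \<in> carrier H" "\<not> q dvd ci g" using gu by (auto simp: KH_def)
    have u: "u \<in> carrier H" "q * s dvd ci u" "q dvd ci u" using gu by (auto simp: QH_def intro: dvd_mult_left)
    have "g \<otimes>\<^bsub>H\<^esub> u = H.cm g u \<otimes>\<^bsub>H\<^esub> (u \<otimes>\<^bsub>H\<^esub> g)" using H.cm_mult g u by blast
    \<comment> \<open>Left multiplication by a commutator in P leaves the index unchanged.\<close>
    then have "ci (g \<otimes>\<^bsub>H\<^esub> u) = ci (u \<otimes>\<^bsub>H\<^esub> g)" using P_mult(4)[OF gu(3) H.m_closed[OF u(1) g(1)]] by metis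
    then have "(ci g + ci u * p ^ ci g) mod n = (ci u + ci g) mod n" using index_of_q_dvd u by simp
    then have "[ci u * p ^ ci g + ci g = ci u + ci g] (mod n)" by (simp add: cong_def add.commute)
    then have "[ci u * p ^ ci g = ci u] (mod n)" by (simp only: cong_add_rcancel_nat)
    then have "n dvd ci u * p ^ ci g - ci u * 1"
      using p_pow_pos[of "ci g"] by (simp add: cong_altdef_nat Suc_leI)
    then have "n dvd ci u * (p ^ ci g - 1)" by (simp only: diff_mult_distrib2)
    moreover obtain k where k: "ci u = q * s * k" using u by blast
    \<comment> \<open>Cancelling q s isolates m, which is coprime to \<open>p ^ ci g - 1\<close>
      because g lies outside K.\<close>
    ultimately have "(q * s) * m dvd (q * s) * (k * (p ^ ci g - 1))" by (simp add: n ac_simps)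
    then have "m dvd k * (p ^ ci g - 1)" using s_pos prime_gt_0_nat[OF q] by (simp add: dvd_mult_cancel_left)
    then have "m dvd k" using cop[OF g(2)] by (simp add: coprime_dvd_mult_left_iff)
    then have "n dvd ci u" unfolding k n by (metis mult.assoc mult.commute mult_dvd_mono dvd_refl)
    then have "ci u = 0" using u by (metis H_closedD(4) dvd_imp_le gr0I not_le)
    then show ?thesis using u by (simp add: PH_def)
  qed
qed

end

text \<open>The unit group is cyclic; d is the power of a generator whose exponent is the cofactor
  of n in the group order.\<close>

lemma (in field) exists_element_of_order:
  assumes fin: "finite (carrier R)" and n: "n dvd card (carrier R) - 1" "n > 0"
  obtains d where "d \<in> carrier R" "\<And>k::nat. d [^] k = \<one> \<longleftrightarrow> n dvd k"
proof -
  interpret U: group "mult_of R" by (rule field_mult_group)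
  obtain a where a: "a \<in> carrier (mult_of R)" "carrier (mult_of R) = {a [^] i | i::nat. i \<in> UNIV}"
    using finite_field_mult_group_has_gen[OF fin] by blast
  have finU: "finite (carrier (mult_of R))" using finite_mult_of[OF fin] .
  have N: "order (mult_of R) = card (carrier R) - 1" using order_mult_of[OF fin] by (simp add: Coset.order_def)
  have "card (carrier (mult_of R)) \<le> U.ord a"
  proof -
    have "carrier (mult_of R) = (\<lambda>i. a [^]\<^bsub>mult_of R\<^esub> i) ` {0..U.ord a - 1}"
      using a(2) U.ord_elems[OF finU a(1)] by (auto simp: nat_pow_mult_of)
    then have "card (carrier (mult_of R)) \<le> card {0..U.ord a - 1}" by (metis card_image_le finite_atLeastAtMost)
    then show ?thesis using U.ord_ge_1[OF finU a(1)] by simp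
  qed
  moreover have "U.ord a \<le> order (mult_of R)" using U.ord_le_group_order[OF finU a(1)] .
  ultimately have o: "U.ord a = card (carrier R) - 1" using N by (simp add: Coset.order_def)
  have pos: "card (carrier R) - 1 > 0" using N finU U.order_gt_0_iff_finite by simp
  then obtain l where l: "card (carrier R) - 1 = n * l" "l > 0" using n by (metis dvdE gr0I mult_0_right)
  define d where "d = a [^] l"
  have d: "d \<in> carrier (mult_of R)" using a(1) U.nat_pow_closed by (simp add: d_def nat_pow_mult_of)
  have "U.ord d = n"
    using U.ord_pow[OF a(1), of l] l o by (simp add: d_def nat_pow_mult_of)
  then have dn: "d [^] k = \<one> \<longleftrightarrow> n dvd k" for k :: nat
    using U.pow_eq_id[OF d, of k] by (simp add: nat_pow_mult_of)
  have "d \<in> carrier R" using d by simp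
  then show ?thesis using dn by (rule that)
qed

theorem theorem3p1:
  fixes p q :: nat
  assumes "prime p" and "prime q" and "odd q" and "q dvd p - 1"
  shows "\<exists>G :: nat monoid. group G \<and> finite (carrier G) \<and> solvable G \<and>
           derived_length G = 4 \<and> fitting_height G = 3 \<and>
           char_degrees G =
             {1, q,
              pprime_part q ((p ^ q - 1) div (p - 1)) * ppart q (p - 1) * q,
              p ^ q * pprime_part q ((p ^ q - 1) div (p - 1)) * ppart q (p - 1) * q}"
proof -
  let ?m = "geo' p q" and ?s = "ppart q (p - 1)"
  let ?n = "?m * ?s * q"
  have "p \<noteq> 2" using assms(2,4) by (auto simp: prime_nat_iff)
  then obtain E :: "nat ring" where E: "field E" "finite (carrier E)" "card (carrier E) = p ^ q"
    "\<And>x y. x \<in> carrier E \<Longrightarrow> y \<in> carrier E \<Longrightarrow> (x \<oplus>\<^bsub>E\<^esub> y) [^]\<^bsub>E\<^esub> p = x [^]\<^bsub>E\<^esub> p \<oplus>\<^bsub>E\<^esub> y [^]\<^bsub>E\<^esub> p"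
    using finite_field_exists[OF assms(1,2,4)] by blast
  have geo: "(p - 1) * (q * ?m) = p ^ q - 1"
    using geo_mult[OF assms] geo_eq[OF assms] by simp
  note s = ppart_facts[OF assms]
  have odd: "odd ?n"
    using odd_geo[OF assms] geo_eq[OF assms] s(3) assms(3) by simp
  have "?n dvd p ^ q - 1"
    unfolding geo[symmetric] using s(1) by (metis dvd_refl mult.assoc mult.commute mult_dvd_mono)
  moreover have "?n > 0" using odd by (metis even_zero gr0I)
  ultimately obtain d where d: "d \<in> carrier E" "\<And>k::nat. d [^]\<^bsub>E\<^esub> k = \<one>\<^bsub>E\<^esub> \<longleftrightarrow> ?n dvd k"
    using field.exists_element_of_order[OF E(1,2), of ?n] E(3) by metis
  interpret heisenberg_field E p q ?s ?m ?n d
    by (intro heisenberg_field.intro heisenberg_field_axioms.intro E assms geo s odd d refl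
        geo'_gt_1 coprime_geo')
  interpret T: frobenius_tower H ZH AH PH QH KH q ?n "p ^ q" by (rule H_tower)
  have "?m = pprime_part q ((p ^ q - 1) div (p - 1))"
    by (simp only: geo'_def[OF assms] geo_div[OF assms])
  then have "char_degrees H = {1, q, pprime_part q ((p ^ q - 1) div (p - 1)) * ?s * q,
      p ^ q * pprime_part q ((p ^ q - 1) div (p - 1)) * ?s * q}"
    using T.char_degrees_eq by (simp only: mult.assoc)
  then show ?thesis
    using H.group_axioms H_finite T.solvable T.derived_length_eq T.fitting_height_eq by blast
qed

end
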